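(* Assume (A1)-(A3). Let $\varphi$ be the unique solution in $C_b([0,T]\times S)\cap C^1([0,T)\times S)$ of $$\frac{d\varphi}{dt}(t,i)+\inf_{u\in U_i}\Bigl[\theta c(t,i,u)\varphi(t,i)+\sum_{j\in S}\lambda_{ij}(u)\varphi(t,j)\Bigr]=0\ \text{ on } [0,T)\times S,\qquad \varphi(T,i)=e^{\theta g(i)}\ \text{ for } i\in S,$$ and define $\psi=\theta^{-1}\log\varphi$. Then for all $(t,i)\in[0,T]\times S$, $$\psi(t,i)=\inf_{\mathbf u\in\mathcal U}\frac1\theta\log\mathbb E^{\mathbf u}_{t,i}\Bigl[\exp\Bigl(\theta\Bigl[\int_t^Tc(s,X_s,U_s)\,ds+g(X_T)\Bigr]\Bigr)\Bigr].$$ Moreover, the Markov control $U^*_t=\mathbf u^*(t,X_{t-})$, where $\mathbf u^*$ satisfies, for all $(t,i)\in[0,T)\times S$, $$\inf_{u\in U_i}\Bigl[\theta c(t,i,u)V_T(t,i)+\sum_{j}\lambda_{ij}(u)V_T(t,j)\Bigr]=\theta c(t,i,\mathbf{u}^*(t,i))V_T(t,i)+\sum_{j}\lambda_{ij}(\mathbf{u}^*(t,i))V_T(t,j),$$ is optimal, i.e. for all $(t,i)\in[0,T]\times S$ it attains the infimum $$\inf_{\mathbf u\in\mathcal U}\frac1\theta\log\mathbb E^{\mathbf u}_{t,i}\Bigl[\exp\Bigl(\theta\Bigl[\int_t^Tc(s,X_s,U_s)\,ds+g(X_T)\Bigr]\Bigr)\Bigr].$$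
   Context: State space $S=\{0,1,2,\dots\}$ (countable, discrete). For each $i\in S$, $U_i$ is a (nonempty) compact metric space of actions; $U=\bigcup_i U_i$, $K=\{(i,u): i\in S,u\in U_i\}$. For $j\ne i$, $\lambda_{ij}:U_i\to[0,\infty)$ are given transition rates, and $\lambda_{ii}(u)=-\sum_{j\ne i}\lambda_{ij}(u)$. Assumptions: (A1) every $\lambda_{ij}$ is continuous; (A2) $\sup_i\sup_{u\in U_i}\{-\lambda_{ii}(u)\}\le M<\infty$; (A3) for each $i$ the series $\sum_{j\neq i}\lambda_{ij}(u)$ converges uniformly in $u\in U_i$ (so $\lambda_{ii}$ is continuous). A Markov control is a map $\mathbf{u}:[0,\infty)\times S\to U$ with $\mathbf{u}(\cdot,i)$ measurable and $U_i$-valued for each $i$; $\mathcal U$ is the set of Markov controls. Let $\Lambda^{\mathbf u}_tf(i)=\sum_j\lambda_{ij}(\mathbf u(t,i))f(j)$ for bounded $f:S\to\mathbb R$. Let $(X_t)_{t\ge0}$ be the canonical process on the space of right-continuous $S$-valued paths with left limits. $\mathbb P^{\mathbf u}_{s,i}$ (expectation $\mathbb E^{\mathbf u}_{s,i}$) is the law solving the well-posed martingale problem: $X_s=i$ a.s. and $f(X_t)-\int_s^t\Lambda^{\mathbf u}_rf(X_r)\,dr$, $t\ge s$, is a martingale for every bounded $f$; i.e. from time $s$ on, $X$ is a Markov jump process started at $i$ with rates $\lambda_{ij}(\mathbf u(t,i))$. The control process is $U_t=\mathbf u(t,X_{t-})$. Finite horizon data: $0<T<\infty$; $\theta\in(0,1)$;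 $c:[0,\infty)\times K\to[0,\infty)$ bounded with $(t,u)\mapsto c(t,i,u)$ continuous for each $i$; $g:S\to[0,\infty)$ bounded. The exponential value function is $$V_T(t,i)=\inf_{\mathbf u\in\mathcal U}\mathbb E^{\mathbf u}_{t,i}\Bigl[\exp\Bigl(\theta\Bigl[\int_t^Tc(s,X_s,U_s)\,ds+g(X_T)\Bigr]\Bigr)\Bigr].$$ $C_b([0,T]\times S)$ is the space of bounded continuous functions; $C^1([0,T)\times S)$ is the set of functions continuously differentiable in the first variable on $[0,T)$ for each $i$. *)

theory Defs
  imports "HOL-Probability.Probability"
begin

text \<open>
  The state space is \<^typ>\<open>nat\<close>. The action spaces are a family
  \<open>U :: nat \<Rightarrow> 'u metric\<close>: each \<open>U i\<close> carries its own metric, and \<open>mspace (U i)\<close> is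
  its underlying set. Functions of \<open>(i, u)\<close> with \<open>u\<close> an action are total on the type \<open>'u\<close>;
  only their values for \<open>u\<close> in \<open>mspace (U i)\<close> are constrained.
\<close>

definition action_borel :: "'u metric \<Rightarrow> 'u measure" where
  "action_borel m = sigma (mspace m) {V. openin (mtopology_of m) V}"

text \<open>Only the off-diagonal entries of \<open>lam\<close> are data; the diagonal ones are overridden.\<close>

definition rate :: "(nat \<Rightarrow> nat \<Rightarrow> 'u \<Rightarrow> real) \<Rightarrow> nat \<Rightarrow> nat \<Rightarrow> 'u \<Rightarrow> real" where
  "rate lam i j u =
     (if j = i then - (\<Sum>k. if k = i then 0 else lam i k u) else lam i j u)"

definition markov_controls :: "(nat \<Rightarrow> 'u metric) \<Rightarrow> (real \<Rightarrow> nat \<Rightarrow> 'u) set" where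
  "markov_controls U =
     {\<u>. \<forall>i. (\<lambda>t. \<u> t i) \<in> measurable (restrict_space borel {0..}) (action_borel (U i))}"

definition generator ::
  "(nat \<Rightarrow> nat \<Rightarrow> 'u \<Rightarrow> real) \<Rightarrow> (real \<Rightarrow> nat \<Rightarrow> 'u) \<Rightarrow> real \<Rightarrow> (nat \<Rightarrow> real) \<Rightarrow> nat \<Rightarrow> real" where
  "generator lam \<u> t f i = (\<Sum>j. rate lam i j (\<u> t i) * f j)"

text \<open>
  Paths are functions on \<open>[0, \<infinity>)\<close>, encoded as extensional functions on the reals.
\<close>

definition cadlag_paths :: "(real \<Rightarrow> nat) set" where
  "cadlag_paths =
     {\<omega> \<in> extensional {0..}.
        (\<forall>t\<ge>0. (\<omega> \<longlongrightarrow> \<omega> t) (at_right t)) \<and> (\<forall>t>0. \<exists>l. (\<omega> \<longlongrightarrow> l) (at_left t))}"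

definition path_space :: "(real \<Rightarrow> nat) measure" where
  "path_space = sigma cadlag_paths {{\<omega> \<in> cadlag_paths. \<omega> r = j} | r j. 0 \<le> r}"

definition path_filtration :: "real \<Rightarrow> (real \<Rightarrow> nat) measure" where
  "path_filtration t =
     sigma cadlag_paths {{\<omega> \<in> cadlag_paths. \<omega> r = j} | r j. 0 \<le> r \<and> r \<le> t}"

text \<open>The left limit \<open>X\<^bsub>t-\<^esub>\<close>, with the convention \<open>X\<^bsub>0-\<^esub> = X\<^bsub>0\<^esub>\<close>.\<close>

definition left_lim :: "(real \<Rightarrow> nat) \<Rightarrow> real \<Rightarrow> nat" where
  "left_lim \<omega> t = (if t = 0 then \<omega> 0 else Lim (at_left t) \<omega>)"

definition martingale_from ::
  "real \<Rightarrow> (real \<Rightarrow> 'a measure) \<Rightarrow> 'a measure \<Rightarrow> (real \<Rightarrow> 'a \<Rightarrow> real) \<Rightarrow> bool" where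
  "martingale_from s F P Y \<longleftrightarrow>
     (\<forall>t\<ge>s. Y t \<in> borel_measurable (F t) \<and> integrable P (Y t)) \<and>
     (\<forall>r t. s \<le> r \<and> r \<le> t \<longrightarrow> (AE \<omega> in P. real_cond_exp P (F r) (Y t) \<omega> = Y r \<omega>))"

text \<open>
  \<open>P\<close> is a law on path space under which, from time \<open>s\<close> on, the canonical process is the
  chain controlled by \<open>\<u>\<close> and started in \<open>i\<close>. Nothing is required of the path before \<open>s\<close>,
  so only the law of the path restricted to \<open>[s, \<infinity>)\<close> is determined.
\<close>

definition solves_martingale_problem ::
  "(nat \<Rightarrow> nat \<Rightarrow> 'u \<Rightarrow> real) \<Rightarrow> (real \<Rightarrow> nat \<Rightarrow> 'u) \<Rightarrow> real \<Rightarrow> nat \<Rightarrow> (real \<Rightarrow> nat) measure \<Rightarrow> bool"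
  where
  "solves_martingale_problem lam \<u> s i P \<longleftrightarrow>
     prob_space P \<and> sets P = sets path_space \<and>
     (AE \<omega> in P. \<omega> s = i) \<and>
     (\<forall>f :: nat \<Rightarrow> real. bounded (range f) \<longrightarrow>
        martingale_from s path_filtration P
          (\<lambda>t \<omega>. f (\<omega> t) - (LINT r:{s..t}|lborel. generator lam \<u> r f (\<omega> r))))"

text \<open>
  In the next three definitions \<open>P\<close> is a family of laws: \<open>P \<u> t i\<close> is the law of the
  process controlled by \<open>\<u>\<close> and started at time \<open>t\<close> in state \<open>i\<close>. The action used at time
  \<open>s\<close> is \<open>\<u> s (left_lim \<omega> s)\<close>.
\<close>

definition exp_cost ::
  "((real \<Rightarrow> nat \<Rightarrow> 'u) \<Rightarrow> real \<Rightarrow> nat \<Rightarrow> (real \<Rightarrow> nat) measure) \<Rightarrow> (real \<Rightarrow> nat \<Rightarrow> 'u \<Rightarrow> real) \<Rightarrow>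
   (nat \<Rightarrow> real) \<Rightarrow> real \<Rightarrow> real \<Rightarrow> (real \<Rightarrow> nat \<Rightarrow> 'u) \<Rightarrow> real \<Rightarrow> nat \<Rightarrow> real" where
  "exp_cost P c g T \<theta> \<u> t i =
     prob_space.expectation (P \<u> t i)
       (\<lambda>\<omega>. exp (\<theta> * ((LINT s:{t..T}|lborel. c s (\<omega> s) (\<u> s (left_lim \<omega> s))) + g (\<omega> T))))"

definition exp_value ::
  "(nat \<Rightarrow> 'u metric) \<Rightarrow> ((real \<Rightarrow> nat \<Rightarrow> 'u) \<Rightarrow> real \<Rightarrow> nat \<Rightarrow> (real \<Rightarrow> nat) measure) \<Rightarrow>
   (real \<Rightarrow> nat \<Rightarrow> 'u \<Rightarrow> real) \<Rightarrow> (nat \<Rightarrow> real) \<Rightarrow> real \<Rightarrow> real \<Rightarrow> real \<Rightarrow> nat \<Rightarrow> real" where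
  "exp_value U P c g T \<theta> t i = (INF \<u>\<in>markov_controls U. exp_cost P c g T \<theta> \<u> t i)"

definition risk_cost ::
  "((real \<Rightarrow> nat \<Rightarrow> 'u) \<Rightarrow> real \<Rightarrow> nat \<Rightarrow> (real \<Rightarrow> nat) measure) \<Rightarrow> (real \<Rightarrow> nat \<Rightarrow> 'u \<Rightarrow> real) \<Rightarrow>
   (nat \<Rightarrow> real) \<Rightarrow> real \<Rightarrow> real \<Rightarrow> (real \<Rightarrow> nat \<Rightarrow> 'u) \<Rightarrow> real \<Rightarrow> nat \<Rightarrow> real" where
  "risk_cost P c g T \<theta> \<u> t i = 1 / \<theta> * ln (exp_cost P c g T \<theta> \<u> t i)"

definition hjb_term ::
  "(nat \<Rightarrow> nat \<Rightarrow> 'u \<Rightarrow> real) \<Rightarrow> (real \<Rightarrow> nat \<Rightarrow> 'u \<Rightarrow> real) \<Rightarrow> real \<Rightarrow> (real \<Rightarrow> nat \<Rightarrow> real) \<Rightarrow>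
   real \<Rightarrow> nat \<Rightarrow> 'u \<Rightarrow> real" where
  "hjb_term lam c \<theta> \<phi> t i u = \<theta> * c t i u * \<phi> t i + (\<Sum>j. rate lam i j u * \<phi> t j)"

text \<open>
  The first two conjuncts say \<open>\<phi> \<in> C\<^sub>b([0,T] \<times> S)\<close>; the derivative at \<open>0\<close> is one-sided.
\<close>

definition hjb_solution ::
  "(nat \<Rightarrow> 'u metric) \<Rightarrow> (nat \<Rightarrow> nat \<Rightarrow> 'u \<Rightarrow> real) \<Rightarrow> (real \<Rightarrow> nat \<Rightarrow> 'u \<Rightarrow> real) \<Rightarrow>
   (nat \<Rightarrow> real) \<Rightarrow> real \<Rightarrow> real \<Rightarrow> (real \<Rightarrow> nat \<Rightarrow> real) \<Rightarrow> bool" where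
  "hjb_solution U lam c g T \<theta> \<phi> \<longleftrightarrow>
     continuous_on ({0..T} \<times> UNIV) (\<lambda>(t, i). \<phi> t i) \<and>
     bounded ((\<lambda>(t, i). \<phi> t i) ` ({0..T} \<times> UNIV)) \<and>
     (\<exists>\<phi>'. \<forall>i.
        continuous_on {0..<T} (\<lambda>t. \<phi>' t i) \<and>
        (\<forall>t\<in>{0..<T}.
           ((\<lambda>s. \<phi> s i) has_real_derivative \<phi>' t i) (at t within {0..<T}) \<and>
           \<phi>' t i + (INF u\<in>mspace (U i). hjb_term lam c \<theta> \<phi> t i u) = 0)) \<and>
     (\<forall>i. \<phi> T i = exp (\<theta> * g i))"

end

theory Submission
  imports Defs
begin

text \<open>
  Let \<open>\<phi>\<close> be any solution of the Hamilton-Jacobi-Bellman equation and \<open>\<u>\<close> any control. Along a grid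
  \<open>t\<^sub>0 < \<dots> < t\<^sub>N\<close> of mesh \<open>h\<close>, replace the exponential weight by its discretisation
  \<open>W\<^sub>k = exp (\<theta> * (\<Sum>l<k. C\<^sub>l (X (t\<^sub>l))))\<close>, where \<open>C\<^sub>l x\<close> integrates the running cost over
  \<open>[t\<^sub>l, t\<^bsub>l+1\<^esub>]\<close> with the state frozen at \<open>x\<close>. The martingale property for
  \<open>\<phi> t\<^bsub>k+1\<^esub>\<close>, together with the fact that the chain leaves its state within time \<open>h\<close> with probability
  at most \<open>M * h\<close>, shows that the mean of \<open>W\<^sub>k * \<phi> t\<^sub>k (X (t\<^sub>k))\<close> changes in one step by a
  nonnegative amount (zero if \<open>\<u>\<close> minimises the Hamiltonian) up to \<open>O(h\<^sup>2)\<close>. Summing and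
  letting \<open>h\<close> tend to 0 gives \<open>\<phi> \<le>\<close> cost, with equality for minimising controls. As measurable
  minimisers exist, every solution is the value function, so uniqueness comes for free; existence
  is a Picard iteration in a weighted sup norm.
\<close>

section \<open>Minimisation over a compact action space\<close>

text \<open>The martingale problem is posed for bounded functions of the state alone, whereas the
  weight times \<open>\<phi> t (X t)\<close> depends on time and on the whole past. The grid removes
  both obstacles. On one step \<open>\<phi>\<close> is frozen at the right endpoint, which leaves a
  function of the state. The cost \<open>C\<^sub>k\<close> reads the path only at the left endpoint,
  so \<open>W\<close> at index \<open>k + 1\<close> is already known at time
  \<open>t\<^sub>k\<close> and can be carried through the conditional expectation as a bounded
  factor. The time dependence of \<open>\<phi>\<close> re-enters through the equation in integrated
  form. Each step makes three errors of order \<open>h\<^sup>2\<close>: the state may move,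
  \<open>\<phi>\<close> varies over the step, and the exponential is linearised. There are about
  \<open>1 / h\<close> steps, so the total is of order \<open>h\<close>. The constant
  \<open>L = \<theta> * B + 2 * M\<close> governs the estimates: it is the sup-norm Lipschitz
  constant of the Hamiltonian, it decides the weight of the Picard norm, and it bounds the
  exponential weights by \<open>exp (L * T)\<close>.\<close>

lemma compactin_attains_inf:
  fixes f :: "'a \<Rightarrow> real"
  assumes "compactin X K" "K \<noteq> {}" "continuous_map X euclideanreal f"
  obtains x where "x \<in> K" "\<And>y. y \<in> K \<Longrightarrow> f x \<le> f y"
proof -
  have "compact (f ` K)"
    using image_compactin[OF assms(1,3)] by simp
  then show thesis
    using compact_attains_inf[of "f ` K"] assms(2) that by blast
qed

lemma continuous_map_slice:
  assumes "continuous_map (prod_topology (top_of_set S) X) Z (\<lambda>(s, u). h s u)" "s \<in> S"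
  shows "continuous_map X Z (h s)"
proof -
  have "continuous_map X (prod_topology (top_of_set S) X) (\<lambda>u. (s, u))"
    using assms(2) by (intro continuous_map_pairedI) auto
  from continuous_map_compose[OF this assms(1)] show ?thesis
    by (simp add: o_def)
qed

lemma continuous_on_slice:
  assumes "continuous_map (prod_topology (top_of_set S) X) euclidean (\<lambda>(s, u). h s u)"
    and "u \<in> topspace X"
  shows "continuous_on S (\<lambda>s. h s u)"
proof -
  have "continuous_map (top_of_set S) (prod_topology (top_of_set S) X) (\<lambda>s. (s, u))"
    using assms(2) by (intro continuous_map_pairedI) auto
  from continuous_map_compose[OF this assms(1)] show ?thesis
    by (simp add: o_def)
qed

text \<open>The sets where the infimum is below \<open>a\<close>, strictly or weakly, are
  projections of the corresponding sublevel sets of \<open>h\<close>. Projections are open maps, and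
  closed maps when the factor projected away is compact, so the infimum is upper and lower
  semicontinuous. Attainment of the infimum makes the weak version an exact projection.\<close>

lemma continuous_on_INF_compact:
  fixes h :: "'a::topological_space \<Rightarrow> 'b \<Rightarrow> real"
  assumes X: "compact_space X" "topspace X \<noteq> {}"
    and h: "continuous_map (prod_topology (top_of_set S) X) euclideanreal (\<lambda>(s, u). h s u)"
  shows "continuous_on S (\<lambda>s. INF u\<in>topspace X. h s u)"
proof -
  let ?Y = "prod_topology (top_of_set S) X"
  let ?m = "\<lambda>s. INF u\<in>topspace X. h s u"
  have att: "\<exists>x\<in>topspace X. ?m s = h s x \<and> (\<forall>y\<in>topspace X. h s x \<le> h s y)" if s: "s \<in> S" for s
  proof -
    obtain x where x: "x \<in> topspace X" "\<And>y. y \<in> topspace X \<Longrightarrow> h s x \<le> h s y"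
      using compactin_attains_inf[OF _ X(2) continuous_map_slice[OF h s]] X(1)
      by (auto simp: compact_space_def)
    moreover have "?m s = h s x"
      by (rule cInf_eq_minimum) (use x in auto)
    ultimately show ?thesis by blast
  qed
  have "{s \<in> S. ?m s < a} = fst ` {z \<in> topspace ?Y. (case z of (s, u) \<Rightarrow> h s u) < a}" for a
  proof safe
    fix s assume "s \<in> S" "?m s < a"
    then show "s \<in> fst ` {z \<in> topspace ?Y. (case z of (s, u) \<Rightarrow> h s u) < a}"
      using att[of s] by (force simp: image_iff)
  next
    fix s u assume "(s, u) \<in> topspace ?Y" "h s u < a"
    then show "fst (s, u) \<in> S" "?m (fst (s, u)) < a"
      using att[of s] by force+
  qed
  moreover have "openin ?Y {z \<in> topspace ?Y. (case z of (s, u) \<Rightarrow> h s u) < a}" for a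
    using h unfolding continuous_map_upper_lower_semicontinuous_lt by blast
  ultimately have lt: "openin (top_of_set S) {s \<in> S. ?m s < a}" for a
    using open_map_fst[of "top_of_set S" X] by (simp add: open_map_def)
  have "{s \<in> S. ?m s \<le> a} = fst ` {z \<in> topspace ?Y. (case z of (s, u) \<Rightarrow> h s u) \<le> a}" for a
  proof safe
    fix s assume "s \<in> S" "?m s \<le> a"
    then show "s \<in> fst ` {z \<in> topspace ?Y. (case z of (s, u) \<Rightarrow> h s u) \<le> a}"
      using att[of s] by (force simp: image_iff)
  next
    fix s u assume "(s, u) \<in> topspace ?Y" "h s u \<le> a"
    then show "fst (s, u) \<in> S" "?m (fst (s, u)) \<le> a"
      using att[of s] by force+
  qed
  moreover have "closedin ?Y {z \<in> topspace ?Y. (case z of (s, u) \<Rightarrow> h s u) \<le> a}" for a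
    using h unfolding continuous_map_upper_lower_semicontinuous_lte by blast
  ultimately have "closedin (top_of_set S) {s \<in> S. ?m s \<le> a}" for a
    using closed_map_fst[OF X(1), of "top_of_set S"] by (simp add: closed_map_def)
  then have "openin (top_of_set S) (S - {s \<in> S. ?m s \<le> a})" for a
    by (metis closedin_def topspace_euclidean_subtopology)
  moreover have "S - {s \<in> S. ?m s \<le> a} = {s \<in> S. ?m s > a}" for a
    by auto
  ultimately have gt: "openin (top_of_set S) {s \<in> S. ?m s > a}" for a
    by simp
  show ?thesis
    using lt gt unfolding continuous_map_iff_continuous[symmetric]
      continuous_map_upper_lower_semicontinuous_lt by simp
qed

text \<open>A closed-set-valued map is tracked by the parameters at which it meets a closed set
  \<open>C\<close>. The minimisers over \<open>F s\<close> meet \<open>C\<close> iff the minimum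
  over \<open>F s \<inter> C\<close> does not exceed the one over \<open>F s\<close>; rational
  thresholds \<open>q\<close> reduce this comparison to countably many events of the form in
  \<open>meas\<close>.\<close>

lemma argmin_hit_measurable:
  fixes f :: "'a \<Rightarrow> 'b \<Rightarrow> real"
  assumes X: "compact_space X"
    and F: "\<And>s. s \<in> space N \<Longrightarrow> closedin X (F s) \<and> F s \<noteq> {}"
    and f: "\<And>s. s \<in> space N \<Longrightarrow> continuous_map X euclideanreal (f s)"
    and meas: "\<And>C q. closedin X C \<Longrightarrow> {s \<in> space N. \<exists>u\<in>F s \<inter> C. f s u \<le> q} \<in> sets N"
  defines "G \<equiv> \<lambda>s. {u \<in> F s. \<forall>v\<in>F s. f s u \<le> f s v}"
  shows "\<And>s. s \<in> space N \<Longrightarrow> closedin X (G s) \<and> G s \<noteq> {}"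
    and "\<And>C. closedin X C \<Longrightarrow> {s \<in> space N. G s \<inter> C \<noteq> {}} \<in> sets N"
proof -
  have att: "\<exists>u\<in>F s \<inter> C. \<forall>v\<in>F s \<inter> C. f s u \<le> f s v"
    if "s \<in> space N" "closedin X C" "F s \<inter> C \<noteq> {}" for s C
  proof -
    have "compactin X (F s \<inter> C)"
      using X F[OF that(1)] that(2) by (simp add: closedin_Int closedin_compact_space)
    from compactin_attains_inf[OF this that(3) f[OF that(1)]]
    obtain u where "u \<in> F s \<inter> C" "\<And>v. v \<in> F s \<inter> C \<Longrightarrow> f s u \<le> f s v"
      by metis
    then show ?thesis by blast
  qed
  show "closedin X (G s) \<and> G s \<noteq> {}" if s: "s \<in> space N" for s
  proof
    have sub: "F s \<subseteq> topspace X"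
      using F[OF s] by (simp add: closedin_subset)
    obtain u where u: "u \<in> F s" "\<forall>v\<in>F s. f s u \<le> f s v"
      using att[OF s closedin_topspace] F[OF s] by (auto simp: Int_absorb2[OF sub])
    then show "G s \<noteq> {}"
      by (auto simp: G_def)
    have "G s = F s \<inter> {x \<in> topspace X. f s x \<le> f s u}"
      unfolding G_def using u sub by (blast intro: order_trans)
    moreover have "closedin X {x \<in> topspace X. f s x \<le> f s u}"
      using f[OF s] unfolding continuous_map_upper_lower_semicontinuous_lte by blast
    ultimately show "closedin X (G s)"
      using F[OF s] by (simp add: closedin_Int)
  qed
  show "{s \<in> space N. G s \<inter> C \<noteq> {}} \<in> sets N" if C: "closedin X C" for C
  proof -
    have "{s \<in> space N. G s \<inter> C \<noteq> {}} =
      {s \<in> space N. \<forall>q::rat.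
        (\<exists>u\<in>F s \<inter> topspace X. f s u \<le> of_rat q) \<longrightarrow> (\<exists>u\<in>F s \<inter> C. f s u \<le> of_rat q)}" (is "?L = ?R")
    proof (intro equalityI subsetI)
      fix s assume "s \<in> ?L"
      then obtain u where "s \<in> space N" "u \<in> F s" "u \<in> C" "\<forall>v\<in>F s. f s u \<le> f s v"
        by (auto simp: G_def)
      then show "s \<in> ?R"
        by (blast intro: order_trans)
    next
      fix s assume s: "s \<in> ?R"
      then have sN: "s \<in> space N" by simp
      have sub: "F s \<subseteq> topspace X"
        using F[OF sN] by (simp add: closedin_subset)
      obtain u where u: "u \<in> F s" "\<forall>v\<in>F s. f s u \<le> f s v"
        using att[OF sN closedin_topspace] F[OF sN] by (auto simp: Int_absorb2[OF sub])
      have ex: "\<exists>w\<in>F s \<inter> C. f s w \<le> q" if q: "q \<in> \<rat>" "f s u \<le> q" for q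
      proof -
        obtain r where "q = of_rat r"
          using q(1) by (rule Rats_cases)
        moreover have "u \<in> F s \<inter> topspace X"
          using u sub by blast
        ultimately show ?thesis
          using s q(2) by blast
      qed
      \<comment> \<open>Some rational lies above the minimum, and this already forces
        \<open>F s \<inter> C\<close> to be nonempty, so that a minimiser on it can be
        taken.\<close>
      obtain q0 where "q0 \<in> \<rat>" "f s u < q0"
        using Rats_dense_in_real[of "f s u" "f s u + 1"] by auto
      then have "F s \<inter> C \<noteq> {}"
        using ex[of q0] by auto
      from att[OF sN C this] obtain w where w: "w \<in> F s" "w \<in> C" "\<forall>v\<in>F s \<inter> C. f s w \<le> f s v"
        by auto
      have "f s w \<le> f s u"
      proof (rule ccontr)
        assume "\<not> f s w \<le> f s u"
        then obtain q where "q \<in> \<rat>" "f s u < q" "q < f s w"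
          using Rats_dense_in_real[of "f s u" "f s w"] by auto
        with ex[of q] w show False by force
      qed
      then have "w \<in> G s"
        unfolding G_def using w(1) u(2) by (blast intro: order_trans)
      then show "s \<in> ?L"
        using w sN by auto
    qed
    also have "\<dots> \<in> sets N"
      by (intro sets.sets_Collect_countable_All sets.sets_Collect_imp meas closedin_topspace C)
    finally show ?thesis .
  qed
qed
text \<open>Compactness gives finite nets at every scale \<open>1 / Suc n\<close>; their union is
  countable and dense.\<close>

lemma compact_space_dense_seq:
  assumes "compact_space (mtopology_of m)" "mspace m \<noteq> {}"
  obtains d :: "nat \<Rightarrow> 'a"
  where "\<forall>x\<in>mspace m. \<forall>e>0. \<exists>k. mdist m x (d k) < e" "range d \<subseteq> mspace m"
proof -
  interpret Metric_space "mspace m" "mdist m"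
    by (rule Metric_space_mspace_mdist)
  have "mtotally_bounded (mspace m)"
    using assms(1) compact_space_eq_mcomplete_mtotally_bounded by (simp add: mtopology_of_def)
  then have "\<exists>K. finite K \<and> K \<subseteq> mspace m \<and> mspace m \<subseteq> (\<Union>x\<in>K. mball x (1 / Suc n))" for n
    by (simp add: mtotally_bounded_def)
  then obtain K where K: "\<And>n. finite (K n)" "\<And>n. K n \<subseteq> mspace m"
    "\<And>n. mspace m \<subseteq> (\<Union>x\<in>K n. mball x (1 / Suc n))"
    by metis
  have count: "countable (\<Union>n. K n)"
    using K(1) by (simp add: countable_finite)
  have ne: "(\<Union>n. K n) \<noteq> {}"
    using K(3)[of 0] assms(2) by auto
  show thesis
  proof (rule that[of "from_nat_into (\<Union>n. K n)"], intro ballI allI impI)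
    fix x e assume "x \<in> mspace m" "0 < (e::real)"
    then obtain n where n: "1 / Suc n < e"
      using nat_approx_posE by blast
    obtain y where "y \<in> K n" "x \<in> mball y (1 / Suc n)"
      using K(3)[of n] \<open>x \<in> mspace m\<close> by auto
    then have "mdist m x y < e"
      using n by (simp add: commute)
    moreover obtain k where "y = from_nat_into (\<Union>n. K n) k"
      using from_nat_into_surj[OF count] \<open>y \<in> K n\<close> by blast
    ultimately show "\<exists>k. mdist m x (from_nat_into (\<Union>n. K n) k) < e"
      by blast
  next
    show "range (from_nat_into (\<Union>n. K n)) \<subseteq> mspace m"
      using from_nat_into[OF ne] K(2) by blast
  qed
qed

text \<open>Ties are broken lexicographically by the distances to a dense sequence, which leaves exactly one
  minimiser; measurability is tracked through the sets of parameters whose minimisers hit a closed set.\<close>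

lemma measurable_argmin_selection:
  fixes h :: "'a::topological_space \<Rightarrow> 'u \<Rightarrow> real"
  assumes m: "compact_space (mtopology_of m)" "mspace m \<noteq> {}"
    and h: "continuous_map (prod_topology (top_of_set S) (mtopology_of m)) euclideanreal
              (\<lambda>(s, u). h s u)"
  obtains v where "v \<in> measurable (restrict_space borel S) (action_borel m)"
    and "\<And>s u. s \<in> S \<Longrightarrow> u \<in> mspace m \<Longrightarrow> h s (v s) \<le> h s u"
proof -
  let ?X = "mtopology_of m" and ?N = "restrict_space borel S"
  interpret Metric_space "mspace m" "mdist m"
    by (rule Metric_space_mspace_mdist)
  have top: "topspace ?X = mspace m" and N: "space ?N = S"
    by (simp_all add: space_restrict_space)
  have closed_N: "C \<in> sets ?N" if C: "closedin (top_of_set S) C" for C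
  proof -
    obtain T where T: "closed T" "C = S \<inter> T"
      using C by (auto simp: closedin_closed)
    show ?thesis
      unfolding sets_restrict_space T(2) by (intro imageI borel_closed T(1))
  qed
  obtain d :: "nat \<Rightarrow> 'u" where d: "\<forall>x\<in>mspace m. \<forall>e>0. \<exists>k. mdist m x (d k) < e"
    "range d \<subseteq> mspace m"
    by (rule compact_space_dense_seq[OF m])
  \<comment> \<open>Level 0 holds the minimisers of \<open>h s\<close>; level \<open>Suc k\<close>
    keeps the points of level \<open>k\<close> nearest to \<open>d k\<close>. The levels are nested
    compact sets.\<close>
  define A where "A \<equiv> rec_nat (\<lambda>s. {u \<in> mspace m. \<forall>v\<in>mspace m. h s u \<le> h s v})
    (\<lambda>k F s. {u \<in> F s. \<forall>v\<in>F s. mdist m u (d k) \<le> mdist m v (d k)})"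
  have A0: "A 0 = (\<lambda>s. {u \<in> mspace m. \<forall>v\<in>mspace m. h s u \<le> h s v})"
    and AS: "A (Suc k) = (\<lambda>s. {u \<in> A k s. \<forall>v\<in>A k s. mdist m u (d k) \<le> mdist m v (d k)})" for k
    by (simp_all add: A_def)
  have A: "(\<forall>s\<in>S. closedin ?X (A k s) \<and> A k s \<noteq> {}) \<and>
    (\<forall>C. closedin ?X C \<longrightarrow> {s \<in> S. A k s \<inter> C \<noteq> {}} \<in> sets ?N)" for k
  proof (induction k)
    case 0
    have meas: "{s \<in> space ?N. \<exists>u\<in>mspace m \<inter> C. h s u \<le> q} \<in> sets ?N" if C: "closedin ?X C" for C q
    proof -
      let ?Y = "prod_topology (top_of_set S) ?X"
      \<comment> \<open>The parameters reaching a value at most \<open>q\<close> inside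
        \<open>C\<close> form the projection of a closed set along a compact factor, hence a closed
        and therefore Borel subset of \<open>S\<close>.\<close>
      let ?Z = "{z \<in> topspace ?Y. (case z of (s, u) \<Rightarrow> h s u) \<le> q} \<inter> S \<times> C"
      have "closedin ?Y ?Z"
        using h C unfolding continuous_map_upper_lower_semicontinuous_lte
        by (intro closedin_Int) (auto simp: closedin_prod_Times_iff)
      then have "closedin (top_of_set S) (fst ` ?Z)"
        using closed_map_fst[OF m(1), of "top_of_set S"] by (simp add: closed_map_def)
      moreover have "fst ` ?Z = {s \<in> space ?N. \<exists>u\<in>mspace m \<inter> C. h s u \<le> q}"
      proof (intro equalityI subsetI)
        fix s assume "s \<in> {s \<in> space ?N. \<exists>u\<in>mspace m \<inter> C. h s u \<le> q}"
        then obtain u where "s \<in> S" "u \<in> mspace m" "u \<in> C" "h s u \<le> q"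
          by (auto simp: N)
        then show "s \<in> fst ` ?Z"
          by (intro image_eqI[of _ _ "(s, u)"]) auto
      qed (auto simp: N)
      ultimately show ?thesis
        using closed_N by simp
    qed
    have F: "closedin ?X (mspace m) \<and> mspace m \<noteq> {}"
      using m(2) closedin_topspace[of ?X] by simp
    have f: "continuous_map ?X euclideanreal (h s)" if "s \<in> space ?N" for s
      using continuous_map_slice[OF h] that N by simp
    show ?case
      using argmin_hit_measurable[OF m(1) F f meas] unfolding A0 N by simp
  next
    case (Suc k)
    have f: "continuous_map ?X euclideanreal (\<lambda>u. mdist m u (d k))"
      using d(2) continuous_map_mdist[of ?X m "\<lambda>u. u" "\<lambda>_. d k"]
      by (simp add: continuous_map_id[unfolded id_def] image_subset_iff)
    have "{s \<in> space ?N. \<exists>u\<in>A k s \<inter> C. mdist m u (d k) \<le> q} \<in> sets ?N" if C: "closedin ?X C" for C q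
    proof -
      \<comment> \<open>The distance to \<open>d k\<close> does not involve \<open>s\<close>, so its
        threshold is absorbed into the closed set and the induction hypothesis on hitting sets
        applies.\<close>
      have "closedin ?X (C \<inter> {u \<in> topspace ?X. mdist m u (d k) \<le> q})"
        using f C unfolding continuous_map_upper_lower_semicontinuous_lte
        by (intro closedin_Int) auto
      moreover have "{s \<in> space ?N. \<exists>u\<in>A k s \<inter> C. mdist m u (d k) \<le> q} =
        {s \<in> S. A k s \<inter> (C \<inter> {u \<in> topspace ?X. mdist m u (d k) \<le> q}) \<noteq> {}}"
        using closedin_subset[OF C] by (auto simp: N)
      ultimately show ?thesis
        using Suc by simp
    qed
    note meas = this
    have F: "closedin ?X (A k s) \<and> A k s \<noteq> {}" if "s \<in> space ?N" for s
      using Suc that N by simp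
    show ?case
      using argmin_hit_measurable[OF m(1) F f meas] unfolding AS N by simp
  qed
  have dec: "decseq (\<lambda>k. A k s)" for s
    by (rule decseq_SucI) (auto simp: AS)
  have "\<exists>u. (\<Inter>k. A k s) = {u}" if s: "s \<in> S" for s
  proof -
    have "(\<Inter>k. A k s) \<noteq> {}"
      using A s by (intro compact_space_imp_nest[OF m(1)] dec) auto
    then obtain u where u: "u \<in> (\<Inter>k. A k s)"
      by blast
    have "v = u" if v: "v \<in> (\<Inter>k. A k s)" for v
    proof (rule ccontr)
      have "A 0 s \<subseteq> mspace m"
        by (auto simp: A0)
      then have uv: "u \<in> mspace m" "v \<in> mspace m"
        using u v by blast+
      assume "v \<noteq> u"
      then have "0 < mdist m u v / 2"
        using uv by auto
      then obtain k where k: "mdist m u (d k) < mdist m u v / 2"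
        using d(1) uv(1) by blast
      have "u \<in> A (Suc k) s" "v \<in> A (Suc k) s"
        using u v by blast+
      \<comment> \<open>Both points survive stage \<open>Suc k\<close>, so they are equally far from
        \<open>d k\<close>. As this distance is less than half of \<open>mdist m u v\<close>, the
        triangle inequality is violated.\<close>
      then have "mdist m v (d k) = mdist m u (d k)"
        by (auto simp: AS intro: antisym)
      moreover have "mdist m u v \<le> mdist m u (d k) + mdist m v (d k)"
        using triangle[of u "d k" v] uv d(2) by (auto simp: commute[of v])
      ultimately show False
        using k by simp
    qed
    then show ?thesis
      using u by blast
  qed
  then obtain v where v: "\<And>s. s \<in> S \<Longrightarrow> (\<Inter>k. A k s) = {v s}"
    by metis
  have vA: "v s \<in> A k s" if "s \<in> S" for s k
    using v[OF that] by blast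
  have v_in: "v s \<in> mspace m" "\<And>u. u \<in> mspace m \<Longrightarrow> h s (v s) \<le> h s u" if "s \<in> S" for s
    using vA[OF that, of 0] by (simp_all add: A0)
  have closed: "{s \<in> S. v s \<in> C} \<in> sets ?N" if C: "closedin ?X C" for C
  proof -
    \<comment> \<open>The inclusion from right to left is the substantial one: the sets
      \<open>A k s \<inter> C\<close> are nonempty, compact and decreasing, so they share a point,
      which can only be \<open>v s\<close>.\<close>
    have "{s \<in> S. v s \<in> C} = {s \<in> space ?N. \<forall>k. A k s \<inter> C \<noteq> {}}"
    proof (intro equalityI subsetI)
      fix s assume "s \<in> {s \<in> S. v s \<in> C}"
      then show "s \<in> {s \<in> space ?N. \<forall>k. A k s \<inter> C \<noteq> {}}"
        using vA by (auto simp: N)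
    next
      fix s assume "s \<in> {s \<in> space ?N. \<forall>k. A k s \<inter> C \<noteq> {}}"
      then have s: "s \<in> S" and ne: "\<And>k. A k s \<inter> C \<noteq> {}"
        by (auto simp: N)
      have "decseq (\<lambda>k. A k s \<inter> C)"
        using dec[of s] unfolding decseq_def by blast
      moreover have "closedin ?X (A k s \<inter> C)" for k
        using A[of k] s C by (simp add: closedin_Int)
      ultimately have "(\<Inter>k. A k s \<inter> C) \<noteq> {}"
        using compact_space_imp_nest[OF m(1), of "\<lambda>k. A k s \<inter> C"] ne by simp
      then obtain x where "x \<in> (\<Inter>k. A k s)" "x \<in> C"
        by blast
      then show "s \<in> {s \<in> S. v s \<in> C}"
        using v[OF s] s by simp
    qed
    also have "\<dots> \<in> sets ?N"
      using A C by (intro sets.sets_Collect_countable_All) (simp add: N)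
    finally show ?thesis .
  qed
  have "v \<in> measurable ?N (action_borel m)"
    unfolding action_borel_def
  proof (rule measurable_measure_of)
    show "{V. openin ?X V} \<subseteq> Pow (mspace m)"
      using openin_subset[of ?X] by auto
    show "v \<in> space ?N \<rightarrow> mspace m"
      using v_in by (auto simp: N)
    fix V assume "V \<in> {V. openin ?X V}"
    then have "closedin ?X (mspace m - V)"
      by (simp add: closedin_def openin_subset[of ?X, simplified] double_diff)
    from closed[OF this] have "space ?N - {s \<in> S. v s \<in> mspace m - V} \<in> sets ?N"
      by (rule sets.compl_sets)
    moreover have "space ?N - {s \<in> S. v s \<in> mspace m - V} = v -` V \<inter> space ?N"
      using v_in by (auto simp: N)
    ultimately show "v -` V \<inter> space ?N \<in> sets ?N"
      by simp
  qed
  then show thesis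
    using that v_in by blast
qed

section \<open>Right-continuous step paths\<close>

lemma space_path_space [simp]: "space path_space = cadlag_paths"
  unfolding path_space_def by (rule space_measure_of) auto

lemma space_path_filtration [simp]: "space (path_filtration t) = cadlag_paths"
  unfolding path_filtration_def by (rule space_measure_of) auto

lemma measurable_coordinate:
  assumes "0 \<le> r"
  shows "(\<lambda>\<omega>. \<omega> r) \<in> measurable path_space (count_space UNIV)"
proof -
  have "{\<omega> \<in> cadlag_paths. \<omega> r = j} \<in> sets path_space" for j
    unfolding path_space_def using assms by (intro in_measure_of) auto
  moreover have "(\<lambda>\<omega>. \<omega> r) -` {j} \<inter> cadlag_paths = {\<omega> \<in> cadlag_paths. \<omega> r = j}" for j
    by auto
  ultimately show ?thesis
    by (subst measurable_count_space_eq2_countable) auto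
qed

lemma measurable_coordinate_filtration:
  assumes "0 \<le> r" "r \<le> t"
  shows "(\<lambda>\<omega>. \<omega> r) \<in> measurable (path_filtration t) (count_space UNIV)"
proof -
  have "{\<omega> \<in> cadlag_paths. \<omega> r = j} \<in> sets (path_filtration t)" for j
    unfolding path_filtration_def using assms by (intro in_measure_of) auto
  moreover have "(\<lambda>\<omega>. \<omega> r) -` {j} \<inter> cadlag_paths = {\<omega> \<in> cadlag_paths. \<omega> r = j}" for j
    by auto
  ultimately show ?thesis
    by (subst measurable_count_space_eq2_countable) auto
qed

lemma subalgebra_path_filtration:
  assumes "sets P = sets path_space"
  shows "subalgebra P (path_filtration t)"
proof -
  have "sets (path_filtration t) \<subseteq> sets path_space"
    unfolding path_filtration_def path_space_def
    by (subst (1 2) sets_measure_of) (auto intro!: sigma_sets_mono')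
  then show ?thesis
    using assms sets_eq_imp_space_eq[OF assms] by (simp add: subalgebra_def)
qed

text \<open>\<open>nat\<close> is discrete, so a convergent path is eventually constant. Right
  continuity thus becomes constancy on a short interval to the right.\<close>

lemma eventually_at_right_path:
  assumes "\<omega> \<in> cadlag_paths" "0 \<le> t"
  shows "eventually (\<lambda>r. \<omega> r = \<omega> t) (at_right t)"
  using assms by (simp add: cadlag_paths_def tendsto_discrete)

lemma left_lim_eqI:
  assumes "eventually (\<lambda>r. \<omega> r = l) (at_left t)" "t \<noteq> 0"
  shows "left_lim \<omega> t = l"
proof -
  have "(\<omega> \<longlongrightarrow> l) (at_left t)"
    using assms(1) by (simp add: tendsto_discrete)
  then show ?thesis
    using assms(2) by (simp add: left_lim_def tendsto_Lim)
qed

lemma eventually_at_left_path: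
  assumes "\<omega> \<in> cadlag_paths" "0 < t"
  shows "eventually (\<lambda>r. \<omega> r = left_lim \<omega> t) (at_left t)"
proof -
  obtain l where "eventually (\<lambda>r. \<omega> r = l) (at_left t)"
    using assms by (auto simp: cadlag_paths_def tendsto_discrete)
  with left_lim_eqI[OF this] assms(2) show ?thesis
    by simp
qed

text \<open>On a short enough interval to either side of any time there is no jump, so the jump
  times have no limit point, which forces countability. This makes
  \<open>left_lim \<omega> r\<close> and \<open>\<omega> r\<close> interchangeable under time
  integrals.\<close>

lemma countable_jump_times:
  assumes \<omega>: "\<omega> \<in> cadlag_paths"
  shows "countable {t. 0 < t \<and> left_lim \<omega> t \<noteq> \<omega> t}" (is "countable ?D")
proof (rule no_limpt_imp_countable)
  have jump_free: "y \<notin> ?D" if "a < y" "y < b" "\<forall>r. a < r \<longrightarrow> r < b \<longrightarrow> \<omega> r = l" for a b l y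
  proof
    assume "y \<in> ?D"
    moreover have "eventually (\<lambda>r. \<omega> r = l) (at_left y)"
      unfolding eventually_at_left_field using that by (intro exI[of _ a]) auto
    ultimately show False
      using left_lim_eqI[of \<omega> l y] that by auto
  qed
  have "\<exists>b>x. \<forall>y. x < y \<longrightarrow> y < b \<longrightarrow> y \<notin> ?D" for x
  proof (cases "0 \<le> x")
    case True
    obtain b where b: "b > x" "\<forall>r. x < r \<longrightarrow> r < b \<longrightarrow> \<omega> r = \<omega> x"
      using eventually_at_right_path[OF \<omega> True] unfolding eventually_at_right_field by blast
    show ?thesis
    proof (intro exI conjI allI impI)
      show "b > x" by fact
      fix y assume "x < y" "y < b"
      then show "y \<notin> ?D" using jump_free b(2) by blast
    qed
  next
    case False
    then show ?thesis by (intro exI[of _ 0]) auto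
  qed
  moreover have "\<exists>a<x. \<forall>y. a < y \<longrightarrow> y < x \<longrightarrow> y \<notin> ?D" for x
  proof (cases "0 < x")
    case True
    obtain a where a: "a < x" "\<forall>r. a < r \<longrightarrow> r < x \<longrightarrow> \<omega> r = left_lim \<omega> x"
      using eventually_at_left_path[OF \<omega> True] unfolding eventually_at_left_field by blast
    show ?thesis
    proof (intro exI conjI allI impI)
      show "a < x" by fact
      fix y assume "a < y" "y < x"
      then show "y \<notin> ?D" using jump_free a(2) by blast
    qed
  next
    case False
    then show ?thesis by (intro exI[of _ "x - 1"]) auto
  qed
  ultimately show "\<not> x islimpt ?D" for x
  proof -
    obtain b where b: "b > x" "\<forall>y. x < y \<longrightarrow> y < b \<longrightarrow> y \<notin> ?D"
      using \<open>\<And>x. \<exists>b>x. \<forall>y. x < y \<longrightarrow> y < b \<longrightarrow> y \<notin> ?D\<close> by meson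
    obtain a where a: "a < x" "\<forall>y. a < y \<longrightarrow> y < x \<longrightarrow> y \<notin> ?D"
      using \<open>\<And>x. \<exists>a<x. \<forall>y. a < y \<longrightarrow> y < x \<longrightarrow> y \<notin> ?D\<close> by meson
    show ?thesis
    proof
      assume "x islimpt ?D"
      moreover have "x \<in> {a<..<b}" "open {a<..<b}"
        using a b by auto
      ultimately obtain y where "y \<in> ?D" "y \<in> {a<..<b}" "y \<noteq> x"
        by (rule islimptE)
      moreover from this have "x < y \<or> y < x" "a < y" "y < b"
        by auto
      ultimately show False
        using a(2) b(2) by blast
    qed
  qed
qed

lemma eventually_path_eq_at_right_seq:
  assumes \<omega>: "\<omega> \<in> cadlag_paths" and t: "0 \<le> t" and x: "\<And>n::nat. t \<le> x n" "x \<longlonglongrightarrow> t"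
  shows "eventually (\<lambda>n. \<omega> (x n) = \<omega> t) sequentially"
proof -
  obtain b where b: "b > t" "\<forall>r. t < r \<longrightarrow> r < b \<longrightarrow> \<omega> r = \<omega> t"
    using eventually_at_right_path[OF \<omega> t] unfolding eventually_at_right_field by blast
  have "eventually (\<lambda>n. x n < b) sequentially"
    using order_tendstoD(2)[OF x(2) b(1)] .
  then show ?thesis
    by eventually_elim (use b(2) x(1) in \<open>metis order_le_less\<close>)
qed

text \<open>Approximate the time from the right by points of a countable grid: each approximation is
  a countable gluing of coordinate maps, and right continuity makes it eventually equal to the
  limit. Evaluation at \<open>max t r\<close> keeps to times where paths are constrained.\<close>

lemma measurable_jointly_coordinate:
  assumes P: "sets P = sets path_space" and t: "0 \<le> t"
  shows "(\<lambda>(r, \<omega>). \<omega> (max t r)) \<in> measurable (borel \<Otimes>\<^sub>M P) (count_space UNIV)"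
proof -
  \<comment> \<open>The \<open>+ 1\<close> puts the grid point strictly to the right of
    \<open>r\<close>, where right continuity can be used.\<close>
  define Y where "Y n r = max t ((of_int \<lfloor>r * real (Suc n)\<rfloor> + 1) / real (Suc n))" for n and r :: real
  have coord: "(\<lambda>\<omega>. \<omega> r) \<in> measurable P (count_space UNIV)" if "0 \<le> r" for r
    using measurable_coordinate[OF that] measurable_cong_sets[OF P refl] by blast
  have meas: "(\<lambda>z :: real \<times> (real \<Rightarrow> nat). snd z (Y n (fst z))) \<in> measurable (borel \<Otimes>\<^sub>M P) (count_space UNIV)" for n
    unfolding Y_def
  proof (rule measurable_compose_countable[where
      f = "\<lambda>i z. snd z (max t ((real_of_int i + 1) / real (Suc n)))"
      and g = "\<lambda>z. \<lfloor>fst z * real (Suc n)\<rfloor>"])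
    fix i :: int
    show "(\<lambda>z :: real \<times> (real \<Rightarrow> nat). snd z (max t ((real_of_int i + 1) / real (Suc n))))
        \<in> measurable (borel \<Otimes>\<^sub>M P) (count_space UNIV)"
      using t by (intro measurable_compose[OF measurable_snd coord]) auto
  qed simp
  have tends: "(\<lambda>n. Y n r) \<longlonglongrightarrow> max t r" for r
  proof -
    have "(\<lambda>n. (of_int \<lfloor>r * real (Suc n)\<rfloor> + 1) / real (Suc n)) \<longlonglongrightarrow> r"
    proof (rule tendsto_sandwich[of "\<lambda>_. r" _ _ "\<lambda>n. r + 1 / real (Suc n)"])
      show "eventually (\<lambda>n. r \<le> (of_int \<lfloor>r * real (Suc n)\<rfloor> + 1) / real (Suc n)) sequentially"
        by (intro always_eventually allI) (simp add: field_simps del: of_nat_Suc, linarith)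
      show "eventually (\<lambda>n. (of_int \<lfloor>r * real (Suc n)\<rfloor> + 1) / real (Suc n) \<le> r + 1 / real (Suc n)) sequentially"
        by (intro always_eventually allI) (simp add: field_simps del: of_nat_Suc)
      show "(\<lambda>n. r + 1 / real (Suc n)) \<longlonglongrightarrow> r"
        using tendsto_add[OF tendsto_const[of r] LIMSEQ_inverse_real_of_nat]
        by (simp add: inverse_eq_divide)
    qed simp
    then show ?thesis
      unfolding Y_def by (intro tendsto_max tendsto_const)
  qed
  have ge: "max t r \<le> Y n r" for n r
  proof -
    have "r \<le> (of_int \<lfloor>r * real (Suc n)\<rfloor> + 1) / real (Suc n)"
      by (simp add: field_simps del: of_nat_Suc, linarith)
    then show ?thesis
      unfolding Y_def by linarith
  qed
  \<comment> \<open>The limit theorem is for real-valued functions; the floor taken afterwards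
    returns to \<open>nat\<close>.\<close>
  have real_meas: "(\<lambda>z :: real \<times> (real \<Rightarrow> nat). real (snd z (max t (fst z)))) \<in> borel_measurable (borel \<Otimes>\<^sub>M P)"
  proof (rule borel_measurable_LIMSEQ_real)
    fix z :: "real \<times> (real \<Rightarrow> nat)" assume z: "z \<in> space (borel \<Otimes>\<^sub>M P)"
    have "space P = cadlag_paths"
      using sets_eq_imp_space_eq[OF P] by simp
    then have "snd z \<in> cadlag_paths"
      using z by (simp add: space_pair_measure mem_Times_iff)
    then have "eventually (\<lambda>n. snd z (Y n (fst z)) = snd z (max t (fst z))) sequentially"
      using t by (intro eventually_path_eq_at_right_seq tends ge) simp_all
    then show "(\<lambda>n. real (snd z (Y n (fst z)))) \<longlonglongrightarrow> real (snd z (max t (fst z)))"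
      by (intro tendsto_eventually) (simp add: eventually_mono)
  next
    show "(\<lambda>z :: real \<times> (real \<Rightarrow> nat). real (snd z (Y n (fst z)))) \<in> borel_measurable (borel \<Otimes>\<^sub>M P)" for n
      by (rule measurable_compose[OF meas]) simp
  qed
  have "(\<lambda>z :: real \<times> (real \<Rightarrow> nat). nat \<lfloor>real (snd z (max t (fst z)))\<rfloor>) \<in> measurable (borel \<Otimes>\<^sub>M P) (count_space UNIV)"
    using real_meas by measurable
  then show ?thesis
    by (simp add: split_beta)
qed

lemma measurable_path:
  assumes "\<omega> \<in> cadlag_paths" "0 \<le> t"
  shows "(\<lambda>r. \<omega> (max t r)) \<in> measurable borel (count_space UNIV)"
proof -
  have "(\<lambda>r. (r, \<omega>)) \<in> measurable borel (borel \<Otimes>\<^sub>M path_space)"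
    using assms by (intro measurable_Pair) auto
  from measurable_compose[OF this measurable_jointly_coordinate[OF refl assms(2)]] show ?thesis
    by simp
qed

lemma measurable_path_restrict:
  assumes "\<omega> \<in> cadlag_paths"
  shows "\<omega> \<in> measurable (restrict_space borel {0..}) (count_space UNIV)"
proof -
  have "(\<lambda>r. \<omega> (max 0 r)) \<in> measurable (restrict_space borel {0..}) (count_space UNIV)"
    by (rule measurable_restrict_space1[OF measurable_path[OF assms order_refl]])
  then show ?thesis
    by (rule iffD1[OF measurable_cong, rotated]) (auto simp: space_restrict_space)
qed

section \<open>Bounded transition rates\<close>

text \<open>Controls, and hence rates and running costs along them, are measurable on the half-line
  only, so measurability is required there and the indicator of \<open>{a..b}\<close> hides the
  rest.\<close>

lemma set_integrable_bounded_measurable: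
  fixes h :: "real \<Rightarrow> real"
  assumes h: "h \<in> borel_measurable (restrict_space borel {0..})" and a: "0 \<le> a"
    and K: "\<And>r. a \<le> r \<Longrightarrow> r \<le> b \<Longrightarrow> \<bar>h r\<bar> \<le> K"
  shows "set_integrable lborel {a..b} h"
proof -
  have "(\<lambda>r. indicator {0..} r *\<^sub>R h r) \<in> borel_measurable lborel"
    using h by (simp add: borel_measurable_restrict_space_iff)
  then have "integrable lborel (\<lambda>r. indicator {a..b} r *\<^sub>R (indicator {0..} r *\<^sub>R h r))"
    using a K by (intro integrableI_bounded_set_indicator[where B = K])
      (auto simp: indicator_def emeasure_lborel_Icc_eq)
  moreover have "(\<lambda>r. indicator {a..b} r *\<^sub>R (indicator {0..} r *\<^sub>R h r)) =
      (\<lambda>r. indicator {a..b} r *\<^sub>R h r)"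
    using a by (auto simp: indicator_def)
  ultimately show ?thesis
    by (simp add: set_integrable_def)
qed

lemma abs_set_integral_le:
  fixes h :: "real \<Rightarrow> real"
  assumes K: "\<And>r. a \<le> r \<Longrightarrow> r \<le> b \<Longrightarrow> \<bar>h r\<bar> \<le> K" and "a \<le> b" "0 \<le> K"
  shows "\<bar>LINT r:{a..b}|lborel. h r\<bar> \<le> K * (b - a)"
proof (cases "set_integrable lborel {a..b} h")
  case True
  have "\<bar>LINT r:{a..b}|lborel. h r\<bar> \<le> (LINT r:{a..b}|lborel. \<bar>h r\<bar>)"
    using set_integral_norm_bound[OF True] by simp
  also have "\<dots> \<le> (LINT r:{a..b}|lborel. K)"
    using K borel_integrable_atLeastAtMost'[of a b "\<lambda>_. K"]
    by (intro set_integral_mono set_integrable_abs True) auto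
  also have "\<dots> = K * (b - a)"
    using assms(2) by (simp add: set_lebesgue_integral_def)
  finally show ?thesis .
next
  case False
  \<comment> \<open>A non-integrable function has integral 0 by convention, and the claimed bound is
    nonnegative.\<close>
  then have "(LINT r:{a..b}|lborel. h r) = 0"
    by (simp add: set_lebesgue_integral_def set_integrable_def not_integrable_integral_eq)
  then show ?thesis
    using assms by simp
qed

lemma set_integral_Icc_split:
  fixes h :: "real \<Rightarrow> real"
  assumes "set_integrable lborel {a..c} h" "a \<le> b" "b \<le> c"
  shows "(LINT r:{a..c}|lborel. h r) = (LINT r:{a..b}|lborel. h r) + (LINT r:{b..c}|lborel. h r)"
proof -
  have "{a..c} = {a..b} \<union> {b<..c}"
    using assms by auto
  moreover have "set_integrable lborel {a..b} h" "set_integrable lborel {b<..c} h"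
    by (rule set_integrable_subset[OF assms(1)]; use assms in force)+
  ultimately have "(LINT r:{a..c}|lborel. h r) =
      (LINT r:{a..b}|lborel. h r) + (LINT r:{b<..c}|lborel. h r)"
    by (metis set_integral_Un ivl_disj_int_two(8))
  also have "(LINT r:{b<..c}|lborel. h r) = (LINT r:{b..c}|lborel. h r)"
    by (intro set_integral_discrete_difference[where X = "{b}"]) auto
  finally show ?thesis .
qed

lemma abs_INF_diff_le:
  fixes f g :: "'a \<Rightarrow> real"
  assumes "A \<noteq> {}" "bdd_below (f ` A)" "bdd_below (g ` A)"
    and d: "\<And>u. u \<in> A \<Longrightarrow> \<bar>f u - g u\<bar> \<le> d"
  shows "\<bar>(INF u\<in>A. f u) - (INF u\<in>A. g u)\<bar> \<le> d"
proof -
  have "(INF u\<in>A. f u) - d \<le> (INF u\<in>A. g u)"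
  proof (rule cINF_greatest[OF assms(1)])
    fix u assume u: "u \<in> A"
    show "(INF u\<in>A. f u) - d \<le> g u"
      using cINF_lower[OF assms(2) u] d[OF u] by linarith
  qed
  moreover have "(INF u\<in>A. g u) - d \<le> (INF u\<in>A. f u)"
  proof (rule cINF_greatest[OF assms(1)])
    fix u assume u: "u \<in> A"
    show "(INF u\<in>A. g u) - d \<le> f u"
      using cINF_lower[OF assms(3) u] d[OF u] by linarith
  qed
  ultimately show ?thesis
    by linarith
qed

lemma borel_measurable_action_borel:
  assumes "continuous_map (mtopology_of m) euclideanreal f"
  shows "f \<in> borel_measurable (action_borel m)"
proof (rule borel_measurableI)
  have sub: "{V. openin (mtopology_of m) V} \<subseteq> Pow (mspace m)"
    using openin_subset[of "mtopology_of m"] by auto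
  have sp: "space (action_borel m) = mspace m"
    unfolding action_borel_def by (rule space_measure_of[OF sub])
  fix S :: "real set" assume "open S"
  then have "openin (mtopology_of m) {x \<in> topspace (mtopology_of m). f x \<in> S}"
    using assms by (intro openin_continuous_map_preimage) auto
  moreover have "{x \<in> topspace (mtopology_of m). f x \<in> S} = f -` S \<inter> space (action_borel m)"
    by (auto simp: sp)
  ultimately show "f -` S \<inter> space (action_borel m) \<in> sets (action_borel m)"
    unfolding action_borel_def using sub by (auto simp: in_measure_of)
qed

lemma space_action_borel: "space (action_borel m) = mspace m"
  unfolding action_borel_def by (rule space_measure_of) (use openin_subset[of "mtopology_of m"] in auto)

lemma markov_controls_action:
  assumes "v \<in> markov_controls U" "0 \<le> t"
  shows "v t i \<in> mspace (U i)"
proof -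
  have "(\<lambda>t. v t i) \<in> measurable (restrict_space borel {0..}) (action_borel (U i))"
    using assms(1) by (simp add: markov_controls_def)
  from measurable_space[OF this, of t] assms(2) show ?thesis
    by (simp add: space_restrict_space space_action_borel)
qed

locale controlled_chain =
  fixes U :: "nat \<Rightarrow> 'u metric" and lam :: "nat \<Rightarrow> nat \<Rightarrow> 'u \<Rightarrow> real" and M :: real
  assumes U_nonempty: "\<And>i. mspace (U i) \<noteq> {}"
    and U_compact: "\<And>i. compact_space (mtopology_of (U i))"
    and lam_nonneg: "\<And>i j u. i \<noteq> j \<Longrightarrow> u \<in> mspace (U i) \<Longrightarrow> 0 \<le> lam i j u"
    and A1: "\<And>i j. i \<noteq> j \<Longrightarrow> continuous_map (mtopology_of (U i)) euclideanreal (lam i j)"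
    and A2: "\<And>i u. u \<in> mspace (U i) \<Longrightarrow> - rate lam i i u \<le> M"
    and A3: "\<And>i. uniformly_convergent_on (mspace (U i)) (\<lambda>n u. \<Sum>j\<in>{..<n} - {i}. lam i j u)"
begin

text \<open>With the diagonal set to 0 the rates out of \<open>i\<close> form a nonnegative series
  of total mass \<open>- rate lam i i u \<le> M\<close>, to which comparison tests apply.\<close>

definition off_rate :: "nat \<Rightarrow> nat \<Rightarrow> 'u \<Rightarrow> real" where
  "off_rate i j u = (if j = i then 0 else lam i j u)"

lemma off_rate_nonneg: "u \<in> mspace (U i) \<Longrightarrow> 0 \<le> off_rate i j u"
  using lam_nonneg by (simp add: off_rate_def)

lemma sum_off_rate: "(\<Sum>j<n. off_rate i j u) = (\<Sum>j\<in>{..<n} - {i}. lam i j u)"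
  by (rule sum.mono_neutral_cong_right) (auto simp: off_rate_def)

lemma uniform_limit_off_rate:
  "uniform_limit (mspace (U i)) (\<lambda>n u. \<Sum>j<n. off_rate i j u) (\<lambda>u. \<Sum>j. off_rate i j u) sequentially"
proof -
  obtain l where l: "uniform_limit (mspace (U i)) (\<lambda>n u. \<Sum>j<n. off_rate i j u) l sequentially"
    using A3[of i] unfolding uniformly_convergent_on_def by (auto simp: sum_off_rate)
  have "l u = (\<Sum>j. off_rate i j u)" if "u \<in> mspace (U i)" for u
    using tendsto_uniform_limitI[OF l that] sums_def sums_unique by blast
  with l show ?thesis
    by (simp cong: uniform_limit_cong')
qed

lemma sums_off_rate:
  assumes "u \<in> mspace (U i)"
  shows "(\<lambda>j. off_rate i j u) sums (- rate lam i i u)"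
proof -
  have "(\<lambda>j. off_rate i j u) sums (\<Sum>j. off_rate i j u)"
    using tendsto_uniform_limitI[OF uniform_limit_off_rate assms] by (simp add: sums_def)
  then show ?thesis
    by (simp add: rate_def off_rate_def)
qed

lemma rate_diag_nonpos: "u \<in> mspace (U i) \<Longrightarrow> rate lam i i u \<le> 0"
  using sums_off_rate[of u i] suminf_nonneg[of "\<lambda>j. off_rate i j u"] off_rate_nonneg
  by (auto simp: sums_iff)

lemma M_nonneg: "0 \<le> M"
proof -
  obtain u where "u \<in> mspace (U 0)"
    using U_nonempty[of 0] by auto
  then show ?thesis
    using A2[of u 0] rate_diag_nonpos[of u 0] by linarith
qed

lemma sums_off_rate_mult:
  assumes u: "u \<in> mspace (U i)" and f: "\<And>j. \<bar>f j\<bar> \<le> K"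
  shows "summable (\<lambda>j. off_rate i j u * f j)" "\<bar>\<Sum>j. off_rate i j u * f j\<bar> \<le> M * K"
proof -
  have K: "0 \<le> K"
    using f[of 0] by linarith
  have le: "norm (off_rate i j u * f j) \<le> off_rate i j u * K" for j
    using f[of j] off_rate_nonneg[OF u, of j] by (simp add: abs_mult mult_left_mono)
  have s: "(\<lambda>j. off_rate i j u * K) sums (- rate lam i i u * K)"
    using sums_mult2[OF sums_off_rate[OF u]] .
  show "summable (\<lambda>j. off_rate i j u * f j)"
    by (rule summable_comparison_test'[OF sums_summable[OF s] le])
  have "\<bar>\<Sum>j. off_rate i j u * f j\<bar> \<le> (\<Sum>j. off_rate i j u * K)"
    using norm_suminf_le[OF le sums_summable[OF s]] by simp
  also have "\<dots> = - rate lam i i u * K"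
    using sums_unique[OF s] by simp
  also have "\<dots> \<le> M * K"
    using A2[OF u] K by (rule mult_right_mono)
  finally show "\<bar>\<Sum>j. off_rate i j u * f j\<bar> \<le> M * K" .
qed

lemma sums_rate:
  assumes u: "u \<in> mspace (U i)" and f: "\<And>j. \<bar>f j\<bar> \<le> K"
  shows "(\<lambda>j. rate lam i j u * f j) sums (rate lam i i u * f i + (\<Sum>j. off_rate i j u * f j))"
proof -
  have "(\<lambda>j. if j = i then rate lam i i u * f i else 0) sums (rate lam i i u * f i)"
    using sums_single[of i "\<lambda>j. rate lam i i u * f i"] by simp
  from sums_add[OF this summable_sums[OF sums_off_rate_mult(1)[OF u f]]]
  show ?thesis
    by (rule sums_cong[THEN iffD1, rotated]) (auto simp: rate_def off_rate_def)
qed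

text \<open>The diagonal term and the off-diagonal series are each at most \<open>M * K\<close> in
  absolute value, whence the factor 2.\<close>

lemma suminf_rate_bound:
  assumes u: "u \<in> mspace (U i)" and f: "\<And>j. \<bar>f j\<bar> \<le> K"
  shows "\<bar>\<Sum>j. rate lam i j u * f j\<bar> \<le> 2 * M * K"
proof -
  have "\<bar>rate lam i i u * f i\<bar> \<le> M * K"
    using A2[OF u] rate_diag_nonpos[OF u] f[of i] M_nonneg
    unfolding abs_mult by (intro mult_mono) auto
  then show ?thesis
    using sums_unique[OF sums_rate[of u i f K, OF u f]] sums_off_rate_mult(2)[of u i f K, OF u f]
    by simp
qed

lemma suminf_rate_diff:
  assumes u: "u \<in> mspace (U i)" and f: "\<And>j. \<bar>f j\<bar> \<le> K" and g: "\<And>j. \<bar>g j\<bar> \<le> K'"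
  shows "(\<Sum>j. rate lam i j u * f j) - (\<Sum>j. rate lam i j u * g j) =
    (\<Sum>j. rate lam i j u * (f j - g j))"
  using suminf_diff[OF sums_summable[OF sums_rate[of u i f K, OF u f]]
      sums_summable[OF sums_rate[of u i g K', OF u g]]]
  by (simp add: right_diff_distrib)

text \<open>Partial sums are jointly continuous, and the tail after \<open>n\<close> terms is at
  most \<open>K\<close> times the tail of the rates, which is small uniformly in the action by
  \<open>A3\<close>. A uniform limit of continuous maps is continuous.\<close>

lemma continuous_map_suminf_off_rate:
  assumes f: "\<And>j. continuous_on S (\<lambda>s. f s j)" and K: "\<And>s j. s \<in> S \<Longrightarrow> \<bar>f s j\<bar> \<le> K"
  shows "continuous_map (prod_topology (top_of_set S) (mtopology_of (U i))) euclideanreal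
    (\<lambda>(s, u). \<Sum>j. off_rate i j u * f s j)"
proof (cases "S = {}")
  case True
  then show ?thesis
    by (simp add: continuous_map_def)
next
  case False
  then have K0: "0 \<le> K"
    using K by force
  let ?X = "prod_topology (top_of_set S) (mtopology_of (U i))"
  have off: "continuous_map (mtopology_of (U i)) euclideanreal (off_rate i j)" for j
    using A1[of i j] by (cases "j = i") (auto simp: off_rate_def[abs_def])
  have snd: "continuous_map ?X euclideanreal (\<lambda>z. off_rate i j (snd z))" for j
    using continuous_map_compose[OF continuous_map_snd off] by (simp add: o_def)
  have "continuous_map (top_of_set S) euclideanreal (\<lambda>s. f s j)" for j
    using f[of j] by simp
  then have fst: "continuous_map ?X euclideanreal (\<lambda>z. f (fst z) j)" for j
    using continuous_map_compose[OF continuous_map_fst[of "top_of_set S" "mtopology_of (U i)"],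
        of euclideanreal "\<lambda>s. f s j" for j] by (simp add: o_def)
  have part: "continuous_map ?X euclideanreal (\<lambda>z. \<Sum>j<n. off_rate i j (snd z) * f (fst z) j)" for n
    by (intro continuous_map_sum continuous_map_real_mult snd fst) auto
  have "continuous_map ?X Met_TC.mtopology (\<lambda>z. \<Sum>j. off_rate i j (snd z) * f (fst z) j)"
  proof (rule Met_TC.continuous_map_uniform_limit)
    show "\<forall>\<^sub>F n in sequentially. continuous_map ?X Met_TC.mtopology
        (\<lambda>z. \<Sum>j<n. off_rate i j (snd z) * f (fst z) j)"
      using part by simp
    fix e :: real assume e: "0 < e"
    \<comment> \<open>The divisor is \<open>K + 1\<close> because \<open>K\<close> may be 0.\<close>
    then have "0 < e / (K + 1)"
      using K0 by simp
    from uniform_limitD[OF uniform_limit_off_rate[of i] this]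
    show "\<forall>\<^sub>F n in sequentially. \<forall>z\<in>topspace ?X.
      (\<Sum>j. off_rate i j (snd z) * f (fst z) j) \<in> UNIV \<and>
      dist (\<Sum>j<n. off_rate i j (snd z) * f (fst z) j) (\<Sum>j. off_rate i j (snd z) * f (fst z) j) < e"
    proof eventually_elim
      case (elim n)
      show ?case
      proof (intro ballI conjI UNIV_I)
        fix z assume "z \<in> topspace ?X"
        then have s: "fst z \<in> S" and u: "snd z \<in> mspace (U i)"
          by auto
        let ?a = "\<lambda>j. off_rate i j (snd z)" and ?f = "f (fst z)"
        have sum: "summable ?a"
          using sums_summable[OF sums_off_rate[OF u]] .
        have summ: "summable (\<lambda>j. ?a j * ?f j)"
          by (rule sums_off_rate_mult(1)[OF u K[OF s]])
        have tail: "(\<Sum>j. ?a j) - (\<Sum>j<n. ?a j) = (\<Sum>j. ?a (j + n))"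
          using suminf_split_initial_segment[OF sum, of n] by simp
        have "(\<Sum>j. ?a j * ?f j) - (\<Sum>j<n. ?a j * ?f j) = (\<Sum>j. ?a (j + n) * ?f (j + n))"
          using suminf_split_initial_segment[OF summ, of n] by simp
        moreover have "\<bar>\<Sum>j. ?a (j + n) * ?f (j + n)\<bar> \<le> (\<Sum>j. ?a (j + n) * K)"
        proof -
          have "norm (?a (j + n) * ?f (j + n)) \<le> ?a (j + n) * K" for j
            using K[OF s, of "j + n"] off_rate_nonneg[OF u, of "j + n"]
            by (simp add: abs_mult mult_left_mono)
          moreover have "summable (\<lambda>j. ?a (j + n) * K)"
            using summable_mult2[OF summable_ignore_initial_segment[OF sum]] .
          ultimately show ?thesis
            using norm_suminf_le[of "\<lambda>j. ?a (j + n) * ?f (j + n)" "\<lambda>j. ?a (j + n) * K"] by simp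
        qed
        moreover have "(\<Sum>j. ?a (j + n) * K) = ((\<Sum>j. ?a j) - (\<Sum>j<n. ?a j)) * K"
          unfolding tail using suminf_mult2[OF summable_ignore_initial_segment[OF sum]] by metis
        moreover have "\<bar>(\<Sum>j. ?a j) - (\<Sum>j<n. ?a j)\<bar> < e / (K + 1)"
          using elim u by (auto simp: dist_real_def abs_minus_commute)
        then have "((\<Sum>j. ?a j) - (\<Sum>j<n. ?a j)) * K \<le> e / (K + 1) * K"
          using K0 by (intro mult_right_mono) auto
        moreover have "e / (K + 1) * K < e"
          using e K0 by (simp add: field_simps)
        ultimately show "dist (\<Sum>j<n. ?a j * ?f j) (\<Sum>j. ?a j * ?f j) < e"
          unfolding dist_real_def by linarith
      qed
    qed
  qed simp
  then show ?thesis
    by (simp add: case_prod_unfold)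
qed

lemma continuous_map_rate:
  "continuous_map (mtopology_of (U i)) euclideanreal (rate lam i j)"
proof (cases "j = i")
  case True
  \<comment> \<open>The diagonal rate is minus the series with \<open>f\<close> constantly 1; its
    continuity is read off over a one-point parameter set.\<close>
  have "continuous_map (mtopology_of (U i)) (prod_topology (top_of_set {0::real}) (mtopology_of (U i))) (\<lambda>u. (0, u))"
    by (intro continuous_map_pairedI) auto
  from continuous_map_compose[OF this continuous_map_suminf_off_rate[of "{0::real}" "\<lambda>_ _. 1" 1 i]]
  have "continuous_map (mtopology_of (U i)) euclideanreal (\<lambda>u. \<Sum>j. off_rate i j u)"
    by (simp add: o_def)
  then have "continuous_map (mtopology_of (U i)) euclideanreal (\<lambda>u. - (\<Sum>j. off_rate i j u))"
    by (rule continuous_map_minus)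
  then show ?thesis
    by (simp add: True rate_def[abs_def] off_rate_def)
next
  case False
  then show ?thesis
    using A1[of i j] by (simp add: rate_def[abs_def])
qed

lemma continuous_map_suminf_rate:
  assumes f: "\<And>j. continuous_on S (\<lambda>s. f s j)" and K: "\<And>s j. s \<in> S \<Longrightarrow> \<bar>f s j\<bar> \<le> K"
  shows "continuous_map (prod_topology (top_of_set S) (mtopology_of (U i))) euclideanreal
    (\<lambda>(s, u). \<Sum>j. rate lam i j u * f s j)"
proof -
  let ?X = "prod_topology (top_of_set S) (mtopology_of (U i))"
  have snd: "continuous_map ?X euclideanreal (\<lambda>z. rate lam i i (snd z))"
    using continuous_map_compose[OF continuous_map_snd continuous_map_rate] by (simp add: o_def)
  have "continuous_map (top_of_set S) euclideanreal (\<lambda>s. f s i)"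
    using f[of i] by simp
  then have fst: "continuous_map ?X euclideanreal (\<lambda>z. f (fst z) i)"
    using continuous_map_compose[OF continuous_map_fst[of "top_of_set S" "mtopology_of (U i)"],
        of euclideanreal "\<lambda>s. f s i"] by (simp add: o_def)
  have "continuous_map ?X euclideanreal
      (\<lambda>z. rate lam i i (snd z) * f (fst z) i + (\<Sum>j. off_rate i j (snd z) * f (fst z) j))"
    using continuous_map_suminf_off_rate[of S f K i, OF f K]
    by (intro continuous_map_add continuous_map_real_mult snd fst) (auto simp: case_prod_unfold)
  then show ?thesis
  proof (rule continuous_map_eq)
    fix z assume "z \<in> topspace ?X"
    then have "fst z \<in> S" "snd z \<in> mspace (U i)"
      by auto
    then show "rate lam i i (snd z) * f (fst z) i + (\<Sum>j. off_rate i j (snd z) * f (fst z) j) =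
        (case z of (s, u) \<Rightarrow> \<Sum>j. rate lam i j u * f s j)"
      using sums_unique[OF sums_rate[of "snd z" i "f (fst z)" K]] K by (simp add: split_beta)
  qed
qed

lemma measurable_generator:
  assumes "v \<in> markov_controls U"
  shows "(\<lambda>r. generator lam v r f i) \<in> borel_measurable (restrict_space borel {0..})"
proof -
  have "(\<lambda>r. rate lam i j (v r i)) \<in> borel_measurable (restrict_space borel {0..})" for j
    using assms by (intro measurable_compose[OF _ borel_measurable_action_borel[OF continuous_map_rate]])
      (simp add: markov_controls_def)
  then show ?thesis
    unfolding generator_def by (intro borel_measurable_suminf borel_measurable_times) auto
qed

lemma generator_bound:
  assumes "v \<in> markov_controls U" "0 \<le> r" "\<And>j. \<bar>f j\<bar> \<le> K"
  shows "\<bar>generator lam v r f i\<bar> \<le> 2 * M * K"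
  unfolding generator_def
  by (rule suminf_rate_bound[OF markov_controls_action[OF assms(1,2)] assms(3)])

end

section \<open>The Hamilton-Jacobi-Bellman equation\<close>

text \<open>Stated for any type whose points are open, as it serves both \<open>nat\<close> and
  \<open>nat discrete\<close>.\<close>

lemma continuous_on_prod_discrete:
  fixes f :: "'a::topological_space \<Rightarrow> 'b::topological_space \<Rightarrow> 'c::topological_space"
  assumes "\<And>j. continuous_on A (\<lambda>t. f t j)" and discrete: "\<And>j::'b. open {j}"
  shows "continuous_on (A \<times> UNIV) (\<lambda>(t, j). f t j)"
  unfolding continuous_on_topological
proof safe
  fix t j V assume "t \<in> A" "open V" "f t j \<in> V"
  then obtain W where W: "open W" "t \<in> W" "\<forall>s\<in>A. s \<in> W \<longrightarrow> f s j \<in> V"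
    using assms(1)[of j] unfolding continuous_on_topological by metis
  then show "\<exists>W. open W \<and> (t, j) \<in> W \<and> (\<forall>y\<in>A \<times> UNIV. y \<in> W \<longrightarrow> (case y of (t, j) \<Rightarrow> f t j) \<in> V)"
    by (intro exI[of _ "W \<times> {j}"]) (auto intro!: open_Times discrete)
qed

locale control_problem = controlled_chain U lam M
  for U :: "nat \<Rightarrow> 'u metric" and lam and M +
  fixes c :: "real \<Rightarrow> nat \<Rightarrow> 'u \<Rightarrow> real" and g :: "nat \<Rightarrow> real" and T \<theta> B :: real
  assumes T_pos: "0 < T" and \<theta>_pos: "0 < \<theta>"
    and c_nonneg: "\<And>t i u. 0 \<le> t \<Longrightarrow> u \<in> mspace (U i) \<Longrightarrow> 0 \<le> c t i u"
    and c_le: "\<And>t i u. 0 \<le> t \<Longrightarrow> u \<in> mspace (U i) \<Longrightarrow> c t i u \<le> B"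
    and c_cont: "\<And>i. continuous_map (prod_topology (top_of_set {0..}) (mtopology_of (U i)))
                   euclideanreal (\<lambda>(t, u). c t i u)"
    and g_nonneg: "\<And>i. 0 \<le> g i"
    and g_bounded: "bounded (range g)"
begin

text \<open>Bound of the linear operator \<open>hjb_term\<close> in sup norm:
  \<open>\<theta> * B\<close> from the running cost and \<open>2 * M\<close> from the generator.
  Hence it is also a Lipschitz constant of \<open>ham\<close>, and it dominates the growth rate
  \<open>\<theta> * B\<close> of the exponential weight.\<close>

definition L :: real where "L = \<theta> * B + 2 * M"

definition ham :: "(real \<Rightarrow> nat \<Rightarrow> real) \<Rightarrow> real \<Rightarrow> nat \<Rightarrow> real" where
  "ham \<phi> t i = (INF u\<in>mspace (U i). hjb_term lam c \<theta> \<phi> t i u)"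

lemma B_nonneg: "0 \<le> B"
proof -
  obtain u where "u \<in> mspace (U 0)"
    using U_nonempty[of 0] by auto
  then show ?thesis
    using c_nonneg[of 0 u 0] c_le[of 0 u 0] by linarith
qed

lemma L_nonneg: "0 \<le> L"
  using B_nonneg M_nonneg \<theta>_pos by (simp add: L_def)

lemma hjb_bound:
  assumes u: "u \<in> mspace (U i)" and t: "0 \<le> t" and K: "\<And>j. \<bar>\<phi> t j\<bar> \<le> K"
  shows "\<bar>hjb_term lam c \<theta> \<phi> t i u\<bar> \<le> L * K"
proof -
  have "\<bar>\<theta> * c t i u\<bar> \<le> \<theta> * B"
    using c_nonneg[OF t u] c_le[OF t u] \<theta>_pos by (simp add: mult_left_mono)
  then have "\<bar>\<theta> * c t i u * \<phi> t i\<bar> \<le> \<theta> * B * K"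
    unfolding abs_mult[of "\<theta> * c t i u"] using K[of i] B_nonneg \<theta>_pos by (intro mult_mono) auto
  moreover have "\<bar>\<Sum>j. rate lam i j u * \<phi> t j\<bar> \<le> 2 * M * K"
    by (rule suminf_rate_bound[OF u K])
  ultimately show ?thesis
    unfolding hjb_term_def L_def by (simp add: algebra_simps)
qed

text \<open>\<open>hjb_term\<close> is linear in the function, so \<open>hjb_bound\<close> applies
  to the difference.\<close>

lemma hjb_diff:
  assumes u: "u \<in> mspace (U i)" and t: "0 \<le> t"
    and K: "\<And>j. \<bar>\<phi> t j\<bar> \<le> K" "\<And>j. \<bar>\<psi> t j\<bar> \<le> K'" and d: "\<And>j. \<bar>\<phi> t j - \<psi> t j\<bar> \<le> d"
  shows "\<bar>hjb_term lam c \<theta> \<phi> t i u - hjb_term lam c \<theta> \<psi> t i u\<bar> \<le> L * d"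
proof -
  have "hjb_term lam c \<theta> \<phi> t i u - hjb_term lam c \<theta> \<psi> t i u =
      hjb_term lam c \<theta> (\<lambda>t j. \<phi> t j - \<psi> t j) t i u"
    using suminf_rate_diff[of u i "\<phi> t" K "\<psi> t" K', OF u K]
    by (simp add: hjb_term_def algebra_simps)
  then show ?thesis
    using hjb_bound[of u i t "\<lambda>t j. \<phi> t j - \<psi> t j" d, OF u t d] by simp
qed

lemma hjb_bdd_below:
  assumes "0 \<le> t" "\<And>j. \<bar>\<phi> t j\<bar> \<le> K"
  shows "bdd_below (hjb_term lam c \<theta> \<phi> t i ` mspace (U i))"
  using hjb_bound[of _ i t \<phi> K, OF _ assms] by (intro bdd_belowI2[of _ "- (L * K)"]) (simp add: abs_le_iff, smt (verit))

lemma ham_le: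
  assumes "u \<in> mspace (U i)" "0 \<le> t" "\<And>j. \<bar>\<phi> t j\<bar> \<le> K"
  shows "ham \<phi> t i \<le> hjb_term lam c \<theta> \<phi> t i u"
  unfolding ham_def using assms by (intro cINF_lower hjb_bdd_below[of t \<phi> K]) auto

lemma ham_bound:
  assumes t: "0 \<le> t" and K: "\<And>j. \<bar>\<phi> t j\<bar> \<le> K"
  shows "\<bar>ham \<phi> t i\<bar> \<le> L * K"
proof -
  have b: "\<bar>hjb_term lam c \<theta> \<phi> t i u\<bar> \<le> L * K" if "u \<in> mspace (U i)" for u
    by (rule hjb_bound[of u i t \<phi> K, OF that t K])
  obtain u where u: "u \<in> mspace (U i)"
    using U_nonempty[of i] by auto
  have "ham \<phi> t i \<le> L * K"
    using ham_le[of u i t \<phi> K, OF u t K] b[OF u] by linarith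
  moreover have "- (L * K) \<le> ham \<phi> t i"
    unfolding ham_def using b U_nonempty by (intro cINF_greatest) (force simp: abs_le_iff)+
  ultimately show ?thesis
    by (simp add: abs_le_iff)
qed

lemma ham_diff:
  assumes t: "0 \<le> t" and K: "\<And>j. \<bar>\<phi> t j\<bar> \<le> K" "\<And>j. \<bar>\<psi> t j\<bar> \<le> K'"
    and d: "\<And>j. \<bar>\<phi> t j - \<psi> t j\<bar> \<le> d"
  shows "\<bar>ham \<phi> t i - ham \<psi> t i\<bar> \<le> L * d"
  unfolding ham_def
  by (intro abs_INF_diff_le U_nonempty hjb_bdd_below[of t \<phi> K] hjb_bdd_below[of t \<psi> K']
      hjb_diff[of _ i t \<phi> K \<psi> K' d] t K d)

lemma continuous_map_hjb:
  assumes S: "S \<subseteq> {0..}" and f: "\<And>j. continuous_on S (\<lambda>s. \<phi> s j)"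
    and K: "\<And>s j. s \<in> S \<Longrightarrow> \<bar>\<phi> s j\<bar> \<le> K"
  shows "continuous_map (prod_topology (top_of_set S) (mtopology_of (U i))) euclideanreal
    (\<lambda>(s, u). hjb_term lam c \<theta> \<phi> s i u)"
proof -
  let ?X = "prod_topology (top_of_set S) (mtopology_of (U i))"
  have "continuous_map ?X (prod_topology (top_of_set {0..}) (mtopology_of (U i))) (\<lambda>z. (fst z, snd z))"
    using S continuous_map_fst[of "top_of_set S" "mtopology_of (U i)"]
      continuous_map_snd[of "top_of_set S" "mtopology_of (U i)"]
    by (intro continuous_map_pairedI)
      (auto simp: continuous_map_in_subtopology image_subset_iff)
  from continuous_map_compose[OF this c_cont]
  have c: "continuous_map ?X euclideanreal (\<lambda>z. c (fst z) i (snd z))"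
    by (simp add: o_def case_prod_unfold)
  have "continuous_map (top_of_set S) euclideanreal (\<lambda>s. \<phi> s i)"
    using f[of i] by simp
  then have fst: "continuous_map ?X euclideanreal (\<lambda>z. \<phi> (fst z) i)"
    using continuous_map_compose[OF continuous_map_fst[of "top_of_set S" "mtopology_of (U i)"],
        of euclideanreal "\<lambda>s. \<phi> s i"] by (simp add: o_def)
  have "continuous_map ?X euclideanreal (\<lambda>z. \<theta> * c (fst z) i (snd z) * \<phi> (fst z) i +
      (\<Sum>j. rate lam i j (snd z) * \<phi> (fst z) j))"
    using continuous_map_suminf_rate[of S \<phi> K i, OF f K]
    by (intro continuous_map_add continuous_map_real_mult c fst) (auto simp: case_prod_unfold)
  then show ?thesis
    by (simp add: hjb_term_def case_prod_unfold)
qed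

lemma continuous_on_ham:
  assumes "S \<subseteq> {0..}" "\<And>j. continuous_on S (\<lambda>s. \<phi> s j)"
    and "\<And>s j. s \<in> S \<Longrightarrow> \<bar>\<phi> s j\<bar> \<le> K"
  shows "continuous_on S (\<lambda>s. ham \<phi> s i)"
  using continuous_on_INF_compact[OF U_compact[of i] _ continuous_map_hjb[of S \<phi> K i, OF assms]]
    U_nonempty[of i] by (simp add: ham_def)

text \<open>Verification uses the equation in integrated form. The fundamental theorem asks for a
  derivative only inside the interval and for continuity at its ends, so the one-sided derivative at
  0 and the absence of one at \<open>T\<close> do no harm.\<close>

lemma hjb_solutionE:
  assumes "hjb_solution U lam c g T \<theta> \<phi>"
  obtains K where "\<And>t j. 0 \<le> t \<Longrightarrow> t \<le> T \<Longrightarrow> \<bar>\<phi> t j\<bar> \<le> K"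
    and "\<And>j. continuous_on {0..T} (\<lambda>t. \<phi> t j)"
    and "\<And>a b i. 0 \<le> a \<Longrightarrow> a \<le> b \<Longrightarrow> b \<le> T \<Longrightarrow> \<phi> a i - \<phi> b i = (LINT r:{a..b}|lborel. ham \<phi> r i)"
    and "\<And>i. \<phi> T i = exp (\<theta> * g i)"
proof -
  from assms obtain \<phi>' where
    c: "continuous_on ({0..T} \<times> UNIV) (\<lambda>(t, i). \<phi> t i)" and
    b: "bounded ((\<lambda>(t, i). \<phi> t i) ` ({0..T} \<times> UNIV))" and
    d: "\<And>i t. t \<in> {0..<T} \<Longrightarrow> ((\<lambda>s. \<phi> s i) has_real_derivative \<phi>' t i) (at t within {0..<T})" and
    e: "\<And>i t. t \<in> {0..<T} \<Longrightarrow> \<phi>' t i + ham \<phi> t i = 0" and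
    f: "\<And>i. \<phi> T i = exp (\<theta> * g i)"
    unfolding hjb_solution_def ham_def by blast
  obtain K where K: "\<And>t j. 0 \<le> t \<Longrightarrow> t \<le> T \<Longrightarrow> \<bar>\<phi> t j\<bar> \<le> K"
    using b by (force simp: bounded_iff)
  have cont: "continuous_on {0..T} (\<lambda>t. \<phi> t j)" for j
  proof -
    have "continuous_on {0..T} (\<lambda>t. (t, j))"
      by (intro continuous_intros)
    from continuous_on_compose2[OF c this] show ?thesis
      by auto
  qed
  have ham: "continuous_on {0..T} (\<lambda>t. ham \<phi> t i)" for i
    using K cont by (intro continuous_on_ham[of _ _ K]) auto
  have "\<phi> a i - \<phi> b i = (LINT r:{a..b}|lborel. ham \<phi> r i)" if ab: "0 \<le> a" "a \<le> b" "b \<le> T" for a b i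
  proof -
    have "((\<lambda>t. - ham \<phi> t i) has_integral (\<phi> b i - \<phi> a i)) {a..b}"
    proof (rule fundamental_theorem_of_calculus_interior[OF ab(2)])
      show "continuous_on {a..b} (\<lambda>t. \<phi> t i)"
        using ab by (intro continuous_on_subset[OF cont]) auto
      fix t assume t: "t \<in> {a<..<b}"
      then have t': "t \<in> {0<..<T}"
        using ab by auto
      then have "((\<lambda>s. \<phi> s i) has_real_derivative \<phi>' t i) (at t within {0<..<T})"
        using d[of t i] by (auto intro: DERIV_subset)
      then have "((\<lambda>s. \<phi> s i) has_real_derivative \<phi>' t i) (at t)"
        using t' at_within_open[of t "{0<..<T}"] by simp
      moreover have "\<phi>' t i = - ham \<phi> t i"
        using e[of t i] t' by auto
      ultimately show "((\<lambda>t. \<phi> t i) has_vector_derivative - ham \<phi> t i) (at t)"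
        by (simp add: has_real_derivative_iff_has_vector_derivative)
    qed
    from has_integral_neg[OF this] have "integral {a..b} (\<lambda>t. ham \<phi> t i) = \<phi> a i - \<phi> b i"
      by (simp add: integral_unique)
    moreover have "set_integrable lborel {a..b} (\<lambda>t. ham \<phi> t i)"
      using ab by (intro borel_integrable_atLeastAtMost' continuous_on_subset[OF ham]) auto
    ultimately show ?thesis
      by (simp add: set_borel_integral_eq_integral)
  qed
  with K cont f show thesis
    using that by blast
qed

section \<open>Existence of a solution by a contraction in a weighted norm\<close>

lemma integral_exp_weight:
  assumes "t \<le> T" "0 < \<kappa>"
  shows "((\<lambda>s. exp (\<kappa> * (T - s))) has_integral ((exp (\<kappa> * (T - t)) - 1) / \<kappa>)) {t..T}"
proof -
  have "((\<lambda>s. exp (\<kappa> * (T - s))) has_integral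
      (- exp (\<kappa> * (T - T)) / \<kappa> - (- exp (\<kappa> * (T - t)) / \<kappa>))) {t..T}"
    using assms
    by (intro fundamental_theorem_of_calculus)
      (auto simp flip: has_real_derivative_iff_has_vector_derivative intro!: derivative_eq_intros)
  then show ?thesis
    by (simp add: diff_divide_distrib)
qed

lemma bounded_g: obtains G where "\<And>i. \<bar>exp (\<theta> * g i)\<bar> \<le> G"
proof -
  obtain G where G: "\<And>i. \<bar>g i\<bar> \<le> G"
    using g_bounded by (auto simp: bounded_iff)
  have "exp (\<theta> * g i) \<le> exp (\<theta> * G)" for i
    using G[of i] \<theta>_pos by (simp add: abs_le_iff)
  then show thesis
    using that[of "exp (\<theta> * G)"] by simp
qed

text \<open>The weight \<open>exp (\<kappa> * (T - t))\<close> with \<open>\<kappa> > L\<close> makes the Picard operator a contraction on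
  all of \<open>[0, T]\<close>; clamping the time argument extends it to functions on the real line.\<close>

lemma hjb_solution_exists: "\<exists>\<phi>. hjb_solution U lam c g T \<theta> \<phi>"
proof -
  \<comment> \<open>This choice gives contraction factor 1/2 and stays positive when
    \<open>L = 0\<close>.\<close>
  define \<kappa> where "\<kappa> = 2 * L + 1"
  have \<kappa>: "0 < \<kappa>" "L / \<kappa> \<le> 1 / 2"
    using L_nonneg by (auto simp: \<kappa>_def field_simps)
  define cl where "cl t = max 0 (min T t)" for t :: real
  have cl: "0 \<le> cl t" "cl t \<le> T" for t
    using T_pos by (auto simp: cl_def)
  have cl_id: "cl t = t" if "0 \<le> t" "t \<le> T" for t
    using that by (simp add: cl_def)
  \<comment> \<open>The unknown \<open>v\<close> is the solution divided by the weight, so that its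
    sup norm is the weighted norm; \<open>w v\<close> restores the unweighted function, and
    \<open>\<Phi>\<close> is the integral equation divided by the weight.\<close>
  define w where "w v t j = exp (\<kappa> * (T - t)) * apply_bcontfun v (t, discrete j)"
    for v :: "(real \<times> nat discrete) \<Rightarrow>\<^sub>C real" and t j
  define \<Phi> where "\<Phi> v t i = exp (- \<kappa> * (T - cl t)) *
      (exp (\<theta> * g i) + integral {cl t..T} (\<lambda>s. ham (w v) s i))" for v t i
  define \<Psi> where "\<Psi> v = (\<lambda>(t, i). \<Phi> v t (of_discrete i))" for v
  obtain G where G: "\<And>i. \<bar>exp (\<theta> * g i)\<bar> \<le> G"
    using bounded_g by blast
  have v_cont: "continuous_on S (\<lambda>t. apply_bcontfun v (t, discrete j))" for v :: "(real \<times> nat discrete) \<Rightarrow>\<^sub>C real" and j S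
    by (rule continuous_on_compose2[OF continuous_on_apply_bcontfun[of UNIV v]])
      (auto intro!: continuous_intros)
  have w_cont: "continuous_on S (\<lambda>t. w v t j)" for v j S
    unfolding w_def by (intro continuous_intros v_cont)
  have w_bound: "\<bar>w v t j\<bar> \<le> exp (\<kappa> * T) * norm v" if "0 \<le> t" for v t j
  proof -
    have "\<bar>apply_bcontfun v (t, discrete j)\<bar> \<le> norm v"
      using norm_bounded[of v "(t, discrete j)"] by simp
    then show ?thesis
      unfolding w_def abs_mult using that \<kappa> by (intro mult_mono) auto
  qed
  have ham_cont: "continuous_on {0..T} (\<lambda>s. ham (w v) s i)" for v i
    using w_cont w_bound by (intro continuous_on_ham[of _ _ "exp (\<kappa> * T) * norm v"]) auto
  have ham_int: "(\<lambda>s. ham (w v) s i) integrable_on {t..T}" if "0 \<le> t" for v i t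
    using that by (intro integrable_continuous_real continuous_on_subset[OF ham_cont]) auto
  have exp_le: "\<bar>exp (- \<kappa> * (T - cl t))\<bar> \<le> 1" for t
    using cl[of t] \<kappa>(1) by simp
  have \<Phi>_bcontfun: "(\<Psi> v) \<in> bcontfun" for v
  proof -
    have "continuous_on UNIV (\<lambda>t. \<Phi> v t i)" for i
    proof -
      have clc: "continuous_on UNIV cl"
        unfolding cl_def by (intro continuous_intros)
      have "continuous_on {0..T} (\<lambda>x. integral {x..T} (\<lambda>s. ham (w v) s i))"
        by (rule indefinite_integral_continuous_1'[OF ham_int]) simp
      then have "continuous_on UNIV (\<lambda>t. integral {cl t..T} (\<lambda>s. ham (w v) s i))"
        by (rule continuous_on_compose2[OF _ clc]) (use cl in auto)
      then show ?thesis
        unfolding \<Phi>_def by (intro continuous_intros clc)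
    qed
    then have "continuous_on (UNIV \<times> UNIV) (\<Psi> v)"
      unfolding \<Psi>_def by (intro continuous_on_prod_discrete open_discrete)
    moreover have "\<bar>\<Phi> v t i\<bar> \<le> G + L * (exp (\<kappa> * T) * norm v) * T" for t i
    proof -
      let ?K = "L * (exp (\<kappa> * T) * norm v)"
      have "norm (integral {cl t..T} (\<lambda>s. ham (w v) s i)) \<le> ?K * (T - cl t)"
        using cl[of t] ham_bound[of _ "w v" "exp (\<kappa> * T) * norm v" i, OF _ w_bound]
        by (intro integral_bound continuous_on_subset[OF ham_cont]) auto
      also have "\<dots> \<le> ?K * T"
        using cl[of t] L_nonneg by (intro mult_left_mono) auto
      finally have "\<bar>exp (\<theta> * g i) + integral {cl t..T} (\<lambda>s. ham (w v) s i)\<bar> \<le> G + ?K * T"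
        using G[of i] unfolding real_norm_def by linarith
      then show ?thesis
        unfolding \<Phi>_def abs_mult using mult_mono[OF exp_le[of t]] by fastforce
    qed
    then have "bounded (range (\<Psi> v))"
      unfolding \<Psi>_def by (intro boundedI[of _ "G + L * (exp (\<kappa> * T) * norm v) * T"]) auto
    ultimately show ?thesis
      by (simp add: bcontfun_def)
  qed
  have apply_\<Psi>: "apply_bcontfun (Bcontfun (\<Psi> v)) (t, discrete i) = \<Phi> v t i" for v t i
    unfolding Bcontfun_inverse[OF \<Phi>_bcontfun] by (simp add: \<Psi>_def discrete_inverse)
  have contr: "dist (Bcontfun (\<Psi> v)) (Bcontfun (\<Psi> v')) \<le> 1 / 2 * dist v v'" for v v'
  proof (rule dist_bound)
    fix x :: "real \<times> nat discrete"
    obtain t i where x: "x = (t, discrete i)"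
      by (cases x) (metis of_discrete_inverse)
    let ?I = "\<lambda>v. integral {cl t..T} (\<lambda>s. ham (w v) s i)"
    have ptw: "\<bar>ham (w v) s i - ham (w v') s i\<bar> \<le> L * dist v v' * exp (\<kappa> * (T - s))" if "0 \<le> s" for s
    proof -
      have "\<bar>w v s j - w v' s j\<bar> \<le> exp (\<kappa> * (T - s)) * dist v v'" for j
        using dist_bounded[of v "(s, discrete j)" v']
        by (simp add: w_def dist_real_def abs_mult flip: right_diff_distrib)
      from ham_diff[of s "w v" _ "w v'", OF that w_bound[OF that] w_bound[OF that] this] show ?thesis
        by (simp add: mult_ac)
    qed
    have e: "((\<lambda>s. L * dist v v' * exp (\<kappa> * (T - s))) has_integral
        L * dist v v' * ((exp (\<kappa> * (T - cl t)) - 1) / \<kappa>)) {cl t..T}"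
      by (intro has_integral_mult_right integral_exp_weight cl \<kappa>)
    have "\<bar>?I v - ?I v'\<bar> = norm (integral {cl t..T} (\<lambda>s. ham (w v) s i - ham (w v') s i))"
      using ham_int cl by (simp add: integral_diff)
    also have "\<dots> \<le> integral {cl t..T} (\<lambda>s. L * dist v v' * exp (\<kappa> * (T - s)))"
      using ham_int cl ptw order_trans[OF cl(1)]
      by (intro integral_norm_bound_integral integrable_diff has_integral_integrable[OF e]) auto
    also have "\<dots> = L * dist v v' * ((exp (\<kappa> * (T - cl t)) - 1) / \<kappa>)"
      using e by (rule integral_unique)
    \<comment> \<open>Integrating the weight has gained the factor \<open>1 / \<kappa>\<close>; the
      exponential that remains is cancelled by the prefactor of \<open>\<Phi>\<close>.\<close>
    also have "\<dots> \<le> L * dist v v' * (exp (\<kappa> * (T - cl t)) / \<kappa>)"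
      using \<kappa> L_nonneg by (intro mult_left_mono divide_right_mono) auto
    finally have I: "\<bar>?I v - ?I v'\<bar> \<le> L / \<kappa> * dist v v' * exp (\<kappa> * (T - cl t))"
      by (simp add: field_simps)
    have "\<bar>\<Phi> v t i - \<Phi> v' t i\<bar> = exp (- \<kappa> * (T - cl t)) * \<bar>?I v - ?I v'\<bar>"
      by (simp add: \<Phi>_def abs_mult flip: right_diff_distrib)
    also have "\<dots> \<le> exp (- \<kappa> * (T - cl t)) * (L / \<kappa> * dist v v' * exp (\<kappa> * (T - cl t)))"
      by (intro mult_left_mono I) simp
    also have "\<dots> = L / \<kappa> * dist v v'"
      by (simp add: exp_minus)
    also have "\<dots> \<le> 1 / 2 * dist v v'"
      using \<kappa> by (intro mult_right_mono) auto
    finally show "dist (apply_bcontfun (Bcontfun (\<Psi> v)) x)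
        (apply_bcontfun (Bcontfun (\<Psi> v')) x) \<le> 1 / 2 * dist v v'"
      unfolding x apply_\<Psi> dist_real_def .
  qed
  obtain v where v: "Bcontfun (\<Psi> v) = v"
    using banach_fix_type[of "1 / 2" "\<lambda>v. Bcontfun (\<Psi> v)"] contr by auto
  have v_eq: "apply_bcontfun v (t, discrete i) = \<Phi> v t i" for t i
    using apply_\<Psi>[of v t i] unfolding v .
  let ?\<phi> = "w v"
  have eq: "?\<phi> t i = exp (\<theta> * g i) + integral {t..T} (\<lambda>s. ham ?\<phi> s i)" if "0 \<le> t" "t \<le> T" for t i
    unfolding w_def[of v t] v_eq \<Phi>_def cl_id[OF that] by (simp add: exp_minus)
  have deriv: "((\<lambda>s. ?\<phi> s i) has_real_derivative - ham ?\<phi> t i) (at t within {0..<T})"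
    if t: "t \<in> {0..<T}" for t i
  proof -
    let ?h = "\<lambda>s. ham ?\<phi> s i"
    \<comment> \<open>Differentiation is in the upper limit of integration, so the integral over
      \<open>{s..T}\<close> is written as a difference of integrals from 0.\<close>
    have "((\<lambda>s. exp (\<theta> * g i) + integral {0..T} ?h - integral {0..s} ?h)
        has_real_derivative - ?h t) (at t within {0..T})"
      using integral_has_real_derivative[OF ham_cont, of t v i] t
      by (auto intro!: derivative_eq_intros)
    then have "((\<lambda>s. exp (\<theta> * g i) + integral {0..T} ?h - integral {0..s} ?h)
        has_real_derivative - ?h t) (at t within {0..<T})"
      by (rule DERIV_subset) auto
    then show ?thesis
    proof (rule has_field_derivative_transform_within[OF _ zero_less_one t])
      fix s assume "s \<in> {0..<T}"
      then show "exp (\<theta> * g i) + integral {0..T} ?h - integral {0..s} ?h = ?\<phi> s i"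
        using Henstock_Kurzweil_Integration.integral_combine[of 0 s T ?h] ham_int eq[of s i] by simp
    qed
  qed
  have "hjb_solution U lam c g T \<theta> ?\<phi>"
    unfolding hjb_solution_def
  proof (intro conjI exI[of _ "\<lambda>t i. - ham ?\<phi> t i"] allI ballI)
    show "continuous_on ({0..T} \<times> UNIV) (\<lambda>(t, i). ?\<phi> t i)"
      by (intro continuous_on_prod_discrete w_cont discrete_topology_class.open_discrete)
    show "bounded ((\<lambda>(t, i). ?\<phi> t i) ` ({0..T} \<times> UNIV))"
      by (intro boundedI[of _ "exp (\<kappa> * T) * norm v"]) (auto intro: w_bound)
    show "continuous_on {0..<T} (\<lambda>t. - ham ?\<phi> t i)" for i
      by (intro continuous_on_minus continuous_on_subset[OF ham_cont]) auto
    show "?\<phi> T i = exp (\<theta> * g i)" for i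
      using eq[of T i] T_pos by simp
    show "- ham ?\<phi> t i + (INF u\<in>mspace (U i). hjb_term lam c \<theta> ?\<phi> t i u) = 0" for t i
      by (simp add: ham_def)
  qed (rule deriv)
  then show ?thesis
    by (rule exI[of _ ?\<phi>])
qed

end

section \<open>The controlled chain\<close>

lemma abs_integral_le:
  fixes f g :: "'a \<Rightarrow> real"
  assumes "integrable N f" "integrable N g" "\<And>x. x \<in> space N \<Longrightarrow> \<bar>f x\<bar> \<le> g x"
  shows "\<bar>\<integral>x. f x \<partial>N\<bar> \<le> (\<integral>x. g x \<partial>N)"
  using assms by (intro order_trans[OF integral_abs_bound integral_mono]) auto

locale controlled_law = controlled_chain U lam M
  for U :: "nat \<Rightarrow> 'u metric" and lam and M +
  fixes v :: "real \<Rightarrow> nat \<Rightarrow> 'u" and s :: real and i\<^sub>0 :: nat and P :: "(real \<Rightarrow> nat) measure"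
  assumes v: "v \<in> markov_controls U" and s: "0 \<le> s"
    and sol: "solves_martingale_problem lam v s i\<^sub>0 P"
begin

lemma sets_P: "sets P = sets path_space"
  using sol by (simp add: solves_martingale_problem_def)

lemma space_P: "space P = cadlag_paths"
  using sets_eq_imp_space_eq[OF sets_P] by simp

sublocale prob_space P
  using sol by (simp add: solves_martingale_problem_def)

lemma measurable_coord: "0 \<le> r \<Longrightarrow> (\<lambda>\<omega>. \<omega> r) \<in> measurable P (count_space UNIV)"
  by (simp add: measurable_cong_sets[OF sets_P refl] measurable_coordinate)

lemma measurable_coord_real:
  fixes f :: "nat \<Rightarrow> real"
  shows "0 \<le> r \<Longrightarrow> (\<lambda>\<omega>. f (\<omega> r)) \<in> borel_measurable P"
  by (rule measurable_compose[OF measurable_coord]) auto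

lemma measurable_generator_path:
  assumes "\<omega> \<in> cadlag_paths"
  shows "(\<lambda>r. generator lam v r f (\<omega> r)) \<in> borel_measurable (restrict_space borel {0..})"
  by (rule measurable_compose_countable[OF measurable_generator[OF v] measurable_path_restrict[OF assms]])

lemma measurable_from_filtration:
  assumes "Z \<in> borel_measurable (path_filtration a)"
  shows "Z \<in> borel_measurable P"
  by (rule measurable_from_subalg[OF subalgebra_path_filtration[OF sets_P] assms])

text \<open>The martingale identity tested against a bounded factor \<open>Z\<close> known at time
  \<open>a\<close>; the integral up to \<open>a\<close> cancels and only the one over
  \<open>{a..b}\<close> remains.\<close>

lemma martingale_step:
  fixes Z :: "(real \<Rightarrow> nat) \<Rightarrow> real" and f :: "nat \<Rightarrow> real"
  assumes f: "\<And>j. \<bar>f j\<bar> \<le> K" and ab: "s \<le> a" "a \<le> b"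
    and Z: "Z \<in> borel_measurable (path_filtration a)" "\<And>\<omega>. \<omega> \<in> cadlag_paths \<Longrightarrow> \<bar>Z \<omega>\<bar> \<le> w"
  defines "I \<equiv> \<lambda>\<omega>. LINT r:{a..b}|lborel. generator lam v r f (\<omega> r)"
  shows "integrable P (\<lambda>\<omega>. Z \<omega> * (f (\<omega> a) + I \<omega>))"
    and "expectation (\<lambda>\<omega>. Z \<omega> * f (\<omega> b)) = expectation (\<lambda>\<omega>. Z \<omega> * (f (\<omega> a) + I \<omega>))"
proof -
  let ?F = "path_filtration a"
  let ?Y = "\<lambda>t \<omega>. f (\<omega> t) - (LINT r:{s..t}|lborel. generator lam v r f (\<omega> r))"
  interpret F: finite_measure_subalgebra P ?F
    by unfold_locales (rule subalgebra_path_filtration[OF sets_P])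
  have "bounded (range f)"
    using f by (intro boundedI[of _ K]) auto
  then have mart: "martingale_from s path_filtration P ?Y"
    using sol by (simp add: solves_martingale_problem_def)
  have Y_int: "integrable P (?Y t)" if "s \<le> t" for t
    using mart that by (simp add: martingale_from_def)
  have cond: "AE \<omega> in P. real_cond_exp P ?F (?Y b) \<omega> = ?Y a \<omega>"
    using mart ab by (simp add: martingale_from_def)
  have ZP: "Z \<in> borel_measurable P"
    by (rule measurable_from_filtration[OF Z(1)])
  have ZY: "integrable P (\<lambda>\<omega>. Z \<omega> * ?Y t \<omega>)" if "s \<le> t" for t
  proof (rule Bochner_Integration.integrable_bound[OF integrable_mult_right[OF integrable_abs[OF Y_int[OF that]], of w]])
    show "(\<lambda>\<omega>. Z \<omega> * ?Y t \<omega>) \<in> borel_measurable P"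
      by (intro borel_measurable_times ZP borel_measurable_integrable Y_int that)
    show "AE \<omega> in P. norm (Z \<omega> * ?Y t \<omega>) \<le> norm (w * \<bar>?Y t \<omega>\<bar>)"
      using Z(2) by (intro AE_I2) (force simp: space_P abs_mult intro!: mult_right_mono)
  qed
  have "expectation (\<lambda>\<omega>. Z \<omega> * ?Y b \<omega>) = expectation (\<lambda>\<omega>. Z \<omega> * real_cond_exp P ?F (?Y b) \<omega>)"
    using ab by (intro F.real_cond_exp_intg(2)[symmetric] ZY Z(1) borel_measurable_integrable Y_int) auto
  also have "\<dots> = expectation (\<lambda>\<omega>. Z \<omega> * ?Y a \<omega>)"
  proof (rule integral_cong_AE)
    show "(\<lambda>\<omega>. Z \<omega> * real_cond_exp P ?F (?Y b) \<omega>) \<in> borel_measurable P"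
      using ZP by measurable
    show "(\<lambda>\<omega>. Z \<omega> * ?Y a \<omega>) \<in> borel_measurable P"
      using ab by (intro borel_measurable_integrable ZY)
    show "AE \<omega> in P. Z \<omega> * real_cond_exp P ?F (?Y b) \<omega> = Z \<omega> * ?Y a \<omega>"
      using cond by eventually_elim simp
  qed
  finally have E: "expectation (\<lambda>\<omega>. Z \<omega> * ?Y b \<omega>) = expectation (\<lambda>\<omega>. Z \<omega> * ?Y a \<omega>)" .
  have split: "?Y b \<omega> - ?Y a \<omega> = f (\<omega> b) - (f (\<omega> a) + I \<omega>)" if "\<omega> \<in> space P" for \<omega>
  proof -
    have "set_integrable lborel {s..b} (\<lambda>r. generator lam v r f (\<omega> r))"
      using that s generator_bound[OF v _ f]
      by (intro set_integrable_bounded_measurable[where K = "2 * M * K"] measurable_generator_path)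
        (auto simp: space_P)
    from set_integral_Icc_split[OF this ab] show ?thesis
      by (simp add: I_def)
  qed
  have Zf: "integrable P (\<lambda>\<omega>. Z \<omega> * f (\<omega> b))"
  proof (rule integrable_const_bound[of _ "w * K"])
    show "(\<lambda>\<omega>. Z \<omega> * f (\<omega> b)) \<in> borel_measurable P"
      using ab s by (intro borel_measurable_times ZP measurable_coord_real) auto
    have "\<bar>Z \<omega>\<bar> * \<bar>f (\<omega> b)\<bar> \<le> w * K" if "\<omega> \<in> cadlag_paths" for \<omega>
      using Z(2)[OF that] f by (intro mult_mono) auto
    then show "AE \<omega> in P. norm (Z \<omega> * f (\<omega> b)) \<le> w * K"
      by (intro AE_I2) (simp add: space_P abs_mult)
  qed
  \<comment> \<open>Expressing the generator integral through the martingale makes its measurability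
    and integrability in \<open>\<omega>\<close> a consequence of those of
    \<open>?Y\<close>.\<close>
  have eq: "Z \<omega> * (f (\<omega> a) + I \<omega>) = Z \<omega> * f (\<omega> b) - (Z \<omega> * ?Y b \<omega> - Z \<omega> * ?Y a \<omega>)"
    if "\<omega> \<in> space P" for \<omega>
    using split[OF that] by (simp flip: right_diff_distrib)
  have int: "integrable P (\<lambda>\<omega>. Z \<omega> * f (\<omega> b) - (Z \<omega> * ?Y b \<omega> - Z \<omega> * ?Y a \<omega>))"
    using ab by (intro Bochner_Integration.integrable_diff Zf ZY) auto
  show "integrable P (\<lambda>\<omega>. Z \<omega> * (f (\<omega> a) + I \<omega>))"
    using int by (rule Bochner_Integration.integrable_cong[THEN iffD1, rotated 2]) (simp_all add: eq)
  have "expectation (\<lambda>\<omega>. Z \<omega> * (f (\<omega> a) + I \<omega>)) =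
      expectation (\<lambda>\<omega>. Z \<omega> * f (\<omega> b) - (Z \<omega> * ?Y b \<omega> - Z \<omega> * ?Y a \<omega>))"
    by (rule Bochner_Integration.integral_cong) (simp_all only: eq)
  also have "\<dots> = expectation (\<lambda>\<omega>. Z \<omega> * f (\<omega> b)) -
      (expectation (\<lambda>\<omega>. Z \<omega> * ?Y b \<omega>) - expectation (\<lambda>\<omega>. Z \<omega> * ?Y a \<omega>))"
    using ab
    by (subst Bochner_Integration.integral_diff[OF Zf Bochner_Integration.integrable_diff[OF ZY ZY]],
        simp, simp, subst Bochner_Integration.integral_diff[OF ZY ZY]) auto
  finally show "expectation (\<lambda>\<omega>. Z \<omega> * f (\<omega> b)) = expectation (\<lambda>\<omega>. Z \<omega> * (f (\<omega> a) + I \<omega>))"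
    using E by simp
qed

text \<open>Applied to the indicator of \<open>j\<close>, the generator at \<open>k\<close> is the
  single rate from \<open>k\<close> to \<open>j\<close>, which is negative at most on the diagonal.
  This bounds the speed at which the chain can leave \<open>j\<close>.\<close>

lemma generator_indicator_ge:
  assumes "0 \<le> r"
  shows "- M \<le> generator lam v r (indicator {j}) k"
proof -
  have u: "v r k \<in> mspace (U k)"
    by (rule markov_controls_action[OF v assms])
  have "(\<lambda>l. if l = j then rate lam k j (v r k) else 0) sums rate lam k j (v r k)"
    using sums_single[of j "\<lambda>l. rate lam k j (v r k)"] by simp
  then have "(\<lambda>l. rate lam k l (v r k) * indicator {j} l) sums rate lam k j (v r k)"
    by (rule sums_cong[THEN iffD1, rotated]) (simp add: indicator_def)
  then have "generator lam v r (indicator {j}) k = rate lam k j (v r k)"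
    by (simp add: generator_def sums_iff)
  moreover have "- M \<le> rate lam k j (v r k)"
    using A2[OF u] lam_nonneg[of k j, OF _ u] M_nonneg by (cases "j = k") (auto simp: rate_def)
  ultimately show ?thesis
    by simp
qed

lemma coord_event: "0 \<le> r \<Longrightarrow> {\<omega> \<in> space P. \<omega> r = j} \<in> events"
proof -
  assume "0 \<le> r"
  from measurable_sets[OF measurable_coord[OF this], of "{j}"]
  have "(\<lambda>\<omega>. \<omega> r) -` {j} \<inter> space P \<in> events"
    by simp
  moreover have "(\<lambda>\<omega>. \<omega> r) -` {j} \<inter> space P = {\<omega> \<in> space P. \<omega> r = j}"
    by auto
  ultimately show ?thesis
    by simp
qed

lemma jump_event:
  assumes "0 \<le> a" "0 \<le> r"
  shows "{\<omega> \<in> space P. \<omega> r \<noteq> \<omega> a} \<in> events"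
proof -
  have "{\<omega> \<in> space P. \<omega> r \<noteq> \<omega> a} =
      space P - (\<Union>j. {\<omega> \<in> space P. \<omega> r = j} \<inter> {\<omega> \<in> space P. \<omega> a = j})"
    by auto
  also have "\<dots> \<in> events"
    using coord_event assms by (intro sets.compl_sets sets.countable_UN) auto
  finally show ?thesis .
qed

text \<open>With \<open>f\<close> and \<open>Z\<close> both the indicator of \<open>j\<close>, the
  martingale identity bounds the probability of being in \<open>j\<close> at both times below by
  \<open>1 - M * (r - a)\<close> times that of being there at time \<open>a\<close>. Summing over
  \<open>j\<close> and taking complements gives the claim.\<close>

lemma prob_jump_le:
  assumes ar: "s \<le> a" "a \<le> r"
  shows "prob {\<omega> \<in> space P. \<omega> r \<noteq> \<omega> a} \<le> M * (r - a)"
proof -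
  let ?A = "\<lambda>j. {\<omega> \<in> space P. \<omega> a = j}" and ?B = "\<lambda>j. {\<omega> \<in> space P. \<omega> a = j \<and> \<omega> r = j}"
  have a: "0 \<le> a" and r: "0 \<le> r"
    using s ar by auto
  have B: "?B j = {\<omega> \<in> space P. \<omega> a = j} \<inter> {\<omega> \<in> space P. \<omega> r = j}" for j
    by auto
  have B_ev: "?B j \<in> events" for j
    unfolding B using coord_event[OF a] coord_event[OF r] by (rule sets.Int)
  have le: "(1 - M * (r - a)) * prob (?A j) \<le> prob (?B j)" for j
  proof -
    let ?Z = "\<lambda>\<omega>. indicator {j} (\<omega> a) :: real"
    let ?f = "indicator {j} :: nat \<Rightarrow> real"
    let ?I = "\<lambda>\<omega>. LINT q:{a..r}|lborel. generator lam v q ?f (\<omega> q)"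
    have f: "\<bar>?f k\<bar> \<le> 1" for k
      by (simp add: indicator_def)
    have Z: "?Z \<in> borel_measurable (path_filtration a)"
      by (rule measurable_compose[OF measurable_coordinate_filtration[OF a order_refl]]) simp
    have Z_le: "\<bar>?Z \<omega>\<bar> \<le> 1" for \<omega>
      by (simp add: indicator_def)
    have step: "integrable P (\<lambda>\<omega>. ?Z \<omega> * (?f (\<omega> a) + ?I \<omega>))"
      by (rule martingale_step(1)[of ?f 1 a r ?Z 1]) (use f ar Z Z_le in auto)
    have step2: "expectation (\<lambda>\<omega>. ?Z \<omega> * ?f (\<omega> r)) = expectation (\<lambda>\<omega>. ?Z \<omega> * (?f (\<omega> a) + ?I \<omega>))"
      by (rule martingale_step(2)[of ?f 1 a r ?Z 1]) (use f ar Z Z_le in auto)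
    have "expectation (\<lambda>\<omega>. (1 - M * (r - a)) * ?Z \<omega>) \<le> expectation (\<lambda>\<omega>. ?Z \<omega> * (?f (\<omega> a) + ?I \<omega>))"
    proof (rule integral_mono[OF _ step])
      show "integrable P (\<lambda>\<omega>. (1 - M * (r - a)) * ?Z \<omega>)"
        using measurable_from_filtration[OF Z] Z_le
        by (intro integrable_mult_right integrable_const_bound[of _ 1]) auto
      fix \<omega> assume \<omega>: "\<omega> \<in> space P"
      have "(LINT q:{a..r}|lborel. - M) \<le> ?I \<omega>"
      proof (rule set_integral_mono)
        show "set_integrable lborel {a..r} (\<lambda>q. generator lam v q ?f (\<omega> q))"
          using \<omega> a generator_bound[OF v _ f]
          by (intro set_integrable_bounded_measurable[where K = "2 * M * 1"] measurable_generator_path)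
            (auto simp: space_P)
      qed (use a generator_indicator_ge in \<open>auto intro!: borel_integrable_atLeastAtMost'\<close>)
      then have "- M * (r - a) \<le> ?I \<omega>"
        using ar by (simp add: set_lebesgue_integral_def mult.commute)
      then show "(1 - M * (r - a)) * ?Z \<omega> \<le> ?Z \<omega> * (?f (\<omega> a) + ?I \<omega>)"
        by (simp add: indicator_def)
    qed
    also have "\<dots> = expectation (\<lambda>\<omega>. ?Z \<omega> * ?f (\<omega> r))"
      using step2 by simp
    also have "\<dots> = expectation (indicator (?B j))"
      by (rule Bochner_Integration.integral_cong) (auto simp: indicator_def)
    also have "expectation (\<lambda>\<omega>. (1 - M * (r - a)) * ?Z \<omega>) = (1 - M * (r - a)) * expectation (indicator (?A j))"
      by (subst integral_mult_right_zero[symmetric], rule Bochner_Integration.integral_cong)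
        (auto simp: indicator_def)
    finally show ?thesis
      using coord_event[OF a] B_ev by simp
  qed
  have "(\<lambda>j. prob (?A j)) sums prob (\<Union>j. ?A j)"
    using coord_event[OF a] by (intro finite_measure_UNION) (auto simp: disjoint_family_on_def)
  moreover have "(\<Union>j. ?A j) = space P"
    by auto
  ultimately have sA: "(\<lambda>j. (1 - M * (r - a)) * prob (?A j)) sums (1 - M * (r - a))"
    using sums_mult[of "\<lambda>j. prob (?A j)" 1 "1 - M * (r - a)"] prob_space by simp
  have sB: "(\<lambda>j. prob (?B j)) sums prob (\<Union>j. ?B j)"
    using B_ev by (intro finite_measure_UNION) (auto simp: disjoint_family_on_def)
  have "(\<Union>j. ?B j) = space P - {\<omega> \<in> space P. \<omega> r \<noteq> \<omega> a}"
    by auto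
  then have "1 - M * (r - a) \<le> prob (space P - {\<omega> \<in> space P. \<omega> r \<noteq> \<omega> a})"
    using sums_le[OF le sA sB] by simp
  then show ?thesis
    using prob_compl[OF jump_event[OF a r]] by simp
qed

lemma measurable_neq_nat:
  fixes X Y :: "'a \<Rightarrow> nat"
  assumes [measurable]: "X \<in> measurable N (count_space UNIV)" "Y \<in> measurable N (count_space UNIV)"
  shows "(\<lambda>z. of_bool (X z \<noteq> Y z) :: real) \<in> borel_measurable N"
proof -
  have [measurable]: "(\<lambda>z. real (X z)) \<in> borel_measurable N" "(\<lambda>z. real (Y z)) \<in> borel_measurable N"
    by (rule measurable_compose[OF assms(1)], simp, rule measurable_compose[OF assms(2)], simp)
  have "(\<lambda>z. if real (X z) = real (Y z) then 0 else 1 :: real) \<in> borel_measurable N"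
    by measurable
  moreover have "(\<lambda>z. of_bool (X z \<noteq> Y z)) = (\<lambda>z. if real (X z) = real (Y z) then 0 else 1 :: real)"
    by auto
  ultimately show ?thesis
    by simp
qed

text \<open>By Fubini the mean time spent away from the initial state is the integral over
  \<open>r\<close> of the probability that \<open>\<omega> r\<close> differs from
  \<open>\<omega> a\<close>, which is at most \<open>M * (b - a)\<close> throughout. The second
  factor \<open>b - a\<close> is the length of the interval.\<close>

lemma
  assumes ab: "s \<le> a" "a \<le> b"
  shows integrable_jump_time: "integrable P (\<lambda>\<omega>. LINT r:{a..b}|lborel. of_bool (\<omega> r \<noteq> \<omega> a) :: real)"
    and expectation_jump_time_le:
      "expectation (\<lambda>\<omega>. LINT r:{a..b}|lborel. of_bool (\<omega> r \<noteq> \<omega> a) :: real) \<le> M * (b - a)\<^sup>2"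
proof -
  have a: "0 \<le> a"
    using s ab by simp
  have sf: "sigma_finite_measure P"
    by unfold_locales
  interpret pair_sigma_finite lborel P
    by unfold_locales
  \<comment> \<open>\<open>max a r\<close> agrees with \<open>r\<close> on \<open>{a..b}\<close> and
    gives a version that is jointly measurable for all real \<open>r\<close>.\<close>
  define h where "h = (\<lambda>r (\<omega> :: real \<Rightarrow> nat). of_bool (\<omega> (max a r) \<noteq> \<omega> a) :: real)"
  define H where "H = (\<lambda>r \<omega>. indicator {a..b} r * h r \<omega>)"
  have cong: "sets (lborel \<Otimes>\<^sub>M P) = sets (borel \<Otimes>\<^sub>M P)"
    by (rule sets_pair_measure_cong) auto
  have "(\<lambda>z. snd z a) \<in> measurable (borel \<Otimes>\<^sub>M P) (count_space UNIV)"
    by (rule measurable_compose[OF measurable_snd measurable_coord[OF a]])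
  moreover have "(\<lambda>z. snd z (max a (fst z))) \<in> measurable (borel \<Otimes>\<^sub>M P) (count_space UNIV)"
    using measurable_jointly_coordinate[OF sets_P a] by (simp add: case_prod_unfold)
  ultimately have "(\<lambda>z. h (fst z) (snd z)) \<in> borel_measurable (borel \<Otimes>\<^sub>M P)"
    unfolding h_def by (rule measurable_neq_nat[rotated])
  then have h_meas: "case_prod h \<in> borel_measurable (lborel \<Otimes>\<^sub>M P)"
    using measurable_cong_sets[OF cong refl] by (auto simp: case_prod_unfold)
  have "emeasure (lborel \<Otimes>\<^sub>M P) ({a..b} \<times> space P) = ennreal (b - a)"
    using ab sigma_finite_measure.emeasure_pair_measure_Times[OF sf, of "{a..b}" lborel "space P"]
    by (simp add: emeasure_space_1)
  then have "integrable (lborel \<Otimes>\<^sub>M P) (\<lambda>z. indicator ({a..b} \<times> space P) z *\<^sub>R case_prod h z)"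
    using h_meas by (intro integrableI_bounded_set_indicator[where B = 1]) (auto simp: h_def)
  then have "integrable (lborel \<Otimes>\<^sub>M P) (case_prod H)"
    by (rule Bochner_Integration.integrable_cong[THEN iffD1, rotated 2])
      (auto simp: H_def indicator_def space_pair_measure)
  note int = this
  have inner: "(\<integral>r. H r \<omega> \<partial>lborel) = (LINT r:{a..b}|lborel. of_bool (\<omega> r \<noteq> \<omega> a))" for \<omega>
    unfolding set_lebesgue_integral_def
    by (rule Bochner_Integration.integral_cong) (auto simp: H_def h_def indicator_def)
  show "integrable P (\<lambda>\<omega>. LINT r:{a..b}|lborel. of_bool (\<omega> r \<noteq> \<omega> a) :: real)"
    using integrable_snd[OF int] by (simp add: inner)
  have "expectation (\<lambda>\<omega>. LINT r:{a..b}|lborel. of_bool (\<omega> r \<noteq> \<omega> a) :: real) =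
      (\<integral>r. expectation (H r) \<partial>lborel)"
    using Fubini_integral[OF int] by (simp add: inner)
  also have "\<dots> \<le> (\<integral>r. indicator {a..b} r * (M * (b - a)) \<partial>lborel)"
  proof (rule integral_mono)
    show "integrable lborel (\<lambda>r. expectation (H r))"
      using integrable_fst[OF int] by simp
    show "integrable lborel (\<lambda>r. indicator {a..b} r * (M * (b - a)))"
      using borel_integrable_atLeastAtMost'[of a b "\<lambda>_. M * (b - a)"] by (simp add: set_integrable_def)
    fix r
    show "expectation (H r) \<le> indicator {a..b} r * (M * (b - a))"
    proof (cases "r \<in> {a..b}")
      case True
      then have r: "a \<le> r" "r \<le> b" by auto
      have ev: "{\<omega> \<in> space P. \<omega> r \<noteq> \<omega> a} \<in> events"
        using a r by (intro jump_event) auto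
      have "expectation (H r) = expectation (indicator {\<omega> \<in> space P. \<omega> r \<noteq> \<omega> a})"
        by (rule Bochner_Integration.integral_cong) (use r in \<open>auto simp: H_def h_def indicator_def max_def\<close>)
      also have "\<dots> \<le> M * (r - a)"
        using ev prob_jump_le[OF ab(1) r(1)] by simp
      also have "\<dots> \<le> M * (b - a)"
        using r M_nonneg by (intro mult_left_mono) auto
      finally show ?thesis
        using True by simp
    qed (simp add: H_def)
  qed
  also have "\<dots> = M * (b - a)\<^sup>2"
    using ab by (simp add: power2_eq_square)
  finally show "expectation (\<lambda>\<omega>. LINT r:{a..b}|lborel. of_bool (\<omega> r \<noteq> \<omega> a) :: real) \<le> M * (b - a)\<^sup>2" .
qed

text \<open>Freezing the state at time \<open>a\<close> inside the generator changes the integrand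
  only while the chain is away from that state, and then by at most twice the generator bound
  \<open>2 * M * K\<close>. The expected time away is quadratic in the step.\<close>

lemma one_step:
  fixes Z :: "(real \<Rightarrow> nat) \<Rightarrow> real" and f :: "nat \<Rightarrow> real"
  assumes f: "\<And>j. \<bar>f j\<bar> \<le> K" and ab: "s \<le> a" "a \<le> b"
    and Z: "Z \<in> borel_measurable (path_filtration a)" "\<And>\<omega>. \<omega> \<in> cadlag_paths \<Longrightarrow> \<bar>Z \<omega>\<bar> \<le> w"
  shows "\<bar>expectation (\<lambda>\<omega>. Z \<omega> * f (\<omega> b)) -
      expectation (\<lambda>\<omega>. Z \<omega> * (f (\<omega> a) + (LINT r:{a..b}|lborel. generator lam v r f (\<omega> a))))\<bar>
    \<le> w * (4 * M * K) * (M * (b - a)\<^sup>2)"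
proof -
  let ?I = "\<lambda>\<omega>. LINT r:{a..b}|lborel. generator lam v r f (\<omega> r)"
  let ?J = "\<lambda>j. LINT r:{a..b}|lborel. generator lam v r f j"
  let ?N = "\<lambda>\<omega>. LINT r:{a..b}|lborel. of_bool (\<omega> r \<noteq> \<omega> a) :: real"
  have step: "integrable P (\<lambda>\<omega>. Z \<omega> * (f (\<omega> a) + ?I \<omega>))"
    by (rule martingale_step(1)[of f K a b Z w]) (use f ab Z in auto)
  have step2: "expectation (\<lambda>\<omega>. Z \<omega> * f (\<omega> b)) = expectation (\<lambda>\<omega>. Z \<omega> * (f (\<omega> a) + ?I \<omega>))"
    by (rule martingale_step(2)[of f K a b Z w]) (use f ab Z in auto)
  have a: "0 \<le> a" and K: "0 \<le> K"
    using s ab f[of 0] by auto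
  have gb: "\<bar>generator lam v r f j\<bar> \<le> 2 * M * K" if "a \<le> r" for r j
    using generator_bound[OF v _ f] a that by simp
  have int: "integrable P (\<lambda>\<omega>. Z \<omega> * (f (\<omega> a) + ?J (\<omega> a)))"
  proof (rule integrable_const_bound[of _ "w * (K + 2 * M * K * (b - a))"])
    show "(\<lambda>\<omega>. Z \<omega> * (f (\<omega> a) + ?J (\<omega> a))) \<in> borel_measurable P"
      by (intro borel_measurable_times measurable_from_filtration[OF Z(1)] borel_measurable_add
          measurable_coord_real[OF a])
    have "\<bar>Z \<omega>\<bar> * \<bar>f (\<omega> a) + ?J (\<omega> a)\<bar> \<le> w * (K + 2 * M * K * (b - a))" if "\<omega> \<in> cadlag_paths" for \<omega>
    proof (rule mult_mono)
      have "\<bar>?J (\<omega> a)\<bar> \<le> 2 * M * K * (b - a)"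
        using gb ab K M_nonneg by (intro abs_set_integral_le) auto
      then show "\<bar>f (\<omega> a) + ?J (\<omega> a)\<bar> \<le> K + 2 * M * K * (b - a)"
        using f[of "\<omega> a"] by linarith
      show "\<bar>Z \<omega>\<bar> \<le> w" "0 \<le> w"
        using Z(2)[OF that] by auto
    qed simp
    then show "AE \<omega> in P. norm (Z \<omega> * (f (\<omega> a) + ?J (\<omega> a))) \<le> w * (K + 2 * M * K * (b - a))"
      by (intro AE_I2) (simp add: space_P abs_mult)
  qed
  have "\<bar>expectation (\<lambda>\<omega>. Z \<omega> * f (\<omega> b)) - expectation (\<lambda>\<omega>. Z \<omega> * (f (\<omega> a) + ?J (\<omega> a)))\<bar> =
      \<bar>expectation (\<lambda>\<omega>. Z \<omega> * (f (\<omega> a) + ?I \<omega>) - Z \<omega> * (f (\<omega> a) + ?J (\<omega> a)))\<bar>"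
    unfolding Bochner_Integration.integral_diff[OF step int] step2 ..
  also have "\<dots> \<le> expectation (\<lambda>\<omega>. w * (4 * M * K) * ?N \<omega>)"
  proof (rule abs_integral_le)
    show "integrable P (\<lambda>\<omega>. Z \<omega> * (f (\<omega> a) + ?I \<omega>) - Z \<omega> * (f (\<omega> a) + ?J (\<omega> a)))"
      by (intro Bochner_Integration.integrable_diff step int)
    show "integrable P (\<lambda>\<omega>. w * (4 * M * K) * ?N \<omega>)"
      by (intro integrable_mult_right integrable_jump_time ab)
    fix \<omega> assume "\<omega> \<in> space P"
    then have \<omega>: "\<omega> \<in> cadlag_paths"
      by (simp add: space_P)
    have w: "\<bar>Z \<omega>\<bar> \<le> w"
      by (rule Z(2)[OF \<omega>])
    have i1: "set_integrable lborel {a..b} (\<lambda>r. generator lam v r f (\<omega> r))"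
      using gb by (intro set_integrable_bounded_measurable[where K = "2 * M * K"] measurable_generator_path \<omega> a) auto
    have i2: "set_integrable lborel {a..b} (\<lambda>r. generator lam v r f (\<omega> a))"
      using gb by (intro set_integrable_bounded_measurable[where K = "2 * M * K"] measurable_generator v a) auto
    have i3: "set_integrable lborel {a..b} (\<lambda>r. 4 * M * K * of_bool (\<omega> r \<noteq> \<omega> a))"
    proof (intro set_integrable_mult_right set_integrable_bounded_measurable[where K = 1] a)
      show "(\<lambda>r. of_bool (\<omega> r \<noteq> \<omega> a) :: real) \<in> borel_measurable (restrict_space borel {0..})"
        by (rule measurable_neq_nat[OF measurable_path_restrict[OF \<omega>]]) simp
    qed simp
    have "\<bar>?I \<omega> - ?J (\<omega> a)\<bar> = \<bar>LINT r:{a..b}|lborel. generator lam v r f (\<omega> r) - generator lam v r f (\<omega> a)\<bar>"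
      using i1 i2 by simp
    also have "\<dots> \<le> (LINT r:{a..b}|lborel. \<bar>generator lam v r f (\<omega> r) - generator lam v r f (\<omega> a)\<bar>)"
      using set_integral_norm_bound[OF set_integral_diff(1)[OF i1 i2]] by simp
    also have "\<dots> \<le> (LINT r:{a..b}|lborel. 4 * M * K * of_bool (\<omega> r \<noteq> \<omega> a))"
    proof (rule set_integral_mono[OF set_integrable_abs[OF set_integral_diff(1)[OF i1 i2]] i3])
      fix r assume "r \<in> {a..b}"
      then show "\<bar>generator lam v r f (\<omega> r) - generator lam v r f (\<omega> a)\<bar> \<le> 4 * M * K * of_bool (\<omega> r \<noteq> \<omega> a)"
        using gb[of r "\<omega> r"] gb[of r "\<omega> a"] by (cases "\<omega> r = \<omega> a") auto
    qed
    also have "\<dots> = 4 * M * K * ?N \<omega>"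
      by simp
    finally have "\<bar>Z \<omega>\<bar> * \<bar>?I \<omega> - ?J (\<omega> a)\<bar> \<le> w * (4 * M * K * ?N \<omega>)"
      using w by (intro mult_mono) auto
    moreover have "Z \<omega> * (f (\<omega> a) + ?I \<omega>) - Z \<omega> * (f (\<omega> a) + ?J (\<omega> a)) = Z \<omega> * (?I \<omega> - ?J (\<omega> a))"
      by (simp only: right_diff_distrib[symmetric] add_diff_cancel_left)
    ultimately show "\<bar>Z \<omega> * (f (\<omega> a) + ?I \<omega>) - Z \<omega> * (f (\<omega> a) + ?J (\<omega> a))\<bar> \<le> w * (4 * M * K) * ?N \<omega>"
      by (simp only: abs_mult mult.assoc)
  qed
  also have "\<dots> = w * (4 * M * K) * expectation ?N"
    by simp
  also have "\<dots> \<le> w * (4 * M * K) * (M * (b - a)\<^sup>2)"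
  proof (rule mult_left_mono[OF expectation_jump_time_le[OF ab]])
    obtain \<omega> where "\<omega> \<in> space P"
      using not_empty by auto
    then have "0 \<le> w"
      using Z(2)[of \<omega>] by (simp add: space_P)
    then show "0 \<le> w * (4 * M * K)"
      using M_nonneg K by simp
  qed
  finally show ?thesis .
qed

end

section \<open>Verification\<close>

lemma exp_diff_one_le:
  fixes y :: real
  assumes "0 \<le> y"
  shows "exp y - 1 \<le> y * exp y"
proof -
  have "exp y * (1 - y) \<le> exp y * exp (- y)"
    using exp_ge_add_one_self[of "- y"] by (intro mult_left_mono) auto
  then show ?thesis
    by (simp add: exp_minus algebra_simps)
qed

lemma exp_remainder_le:
  fixes y :: real
  assumes "0 \<le> y"
  shows "exp y - 1 - y \<le> y\<^sup>2 * exp y"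
proof -
  have "exp y * (1 - y) \<le> 1"
    using exp_diff_one_le[OF assms] by (simp add: algebra_simps)
  then have "exp y - 1 - y \<le> y * (exp y - 1)"
    by (simp add: algebra_simps)
  also have "\<dots> \<le> y * (y * exp y)"
    using assms exp_diff_one_le by (intro mult_left_mono) auto
  finally show ?thesis
    by (simp add: power2_eq_square)
qed

text \<open>Time enters both directly and through the action. With the direct time replaced by a
  grid point the map is a continuous function of the measurable action; the grid then tends to
  \<open>r\<close> with the action held at \<open>v r i\<close>, and continuity of \<open>c\<close>
  in time gives the limit.\<close>

lemma (in control_problem) measurable_running_cost:
  assumes v: "v \<in> markov_controls U"
  shows "(\<lambda>r. c r i (v r i)) \<in> borel_measurable (restrict_space borel {0..})"
proof (rule borel_measurable_LIMSEQ_real)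
  let ?q = "\<lambda>k n. real k / real (Suc n)"
  have cu: "(\<lambda>r. c (?q k n) i (v r i)) \<in> borel_measurable (restrict_space borel {0..})" for k n
    using v continuous_map_slice[OF c_cont[of i], of "?q k n"]
    by (intro measurable_compose[OF _ borel_measurable_action_borel[of "U i"]])
      (auto simp: markov_controls_def)
  show "(\<lambda>r. c (?q (nat \<lfloor>r * real (Suc n)\<rfloor>) n) i (v r i)) \<in> borel_measurable (restrict_space borel {0..})" for n
  proof (rule measurable_compose_countable[OF cu])
    show "(\<lambda>r. nat \<lfloor>r * real (Suc n)\<rfloor>) \<in> measurable (restrict_space borel {0..}) (count_space UNIV)"
      by (intro measurable_restrict_space1) measurable
  qed
  fix r :: real assume "r \<in> space (restrict_space borel {0..})"
  then have r: "0 \<le> r"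
    by (simp add: space_restrict_space)
  have "(\<lambda>n. ?q (nat \<lfloor>r * real (Suc n)\<rfloor>) n) \<longlonglongrightarrow> r"
  proof (rule tendsto_sandwich[of "\<lambda>n. r - 1 / real (Suc n)" _ _ "\<lambda>_. r"])
    have fl: "real (nat \<lfloor>r * real (Suc n)\<rfloor>) = of_int \<lfloor>r * real (Suc n)\<rfloor>" for n
      using r by (simp add: of_nat_nat)
    have "r - 1 / real (Suc n) \<le> of_int \<lfloor>r * real (Suc n)\<rfloor> / real (Suc n)" for n
    proof -
      have "r * real (Suc n) - 1 \<le> of_int \<lfloor>r * real (Suc n)\<rfloor>"
        by linarith
      from divide_right_mono[OF this, of "real (Suc n)"] show ?thesis
        by (simp add: diff_divide_distrib del: of_nat_Suc)
    qed
    then show "eventually (\<lambda>n. r - 1 / real (Suc n) \<le> ?q (nat \<lfloor>r * real (Suc n)\<rfloor>) n) sequentially"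
      unfolding fl by (intro always_eventually allI)
    show "eventually (\<lambda>n. ?q (nat \<lfloor>r * real (Suc n)\<rfloor>) n \<le> r) sequentially"
      unfolding fl by (intro always_eventually allI) (simp add: field_simps del: of_nat_Suc)
    show "(\<lambda>n. r - 1 / real (Suc n)) \<longlonglongrightarrow> r"
      using tendsto_diff[OF tendsto_const[of r] LIMSEQ_inverse_real_of_nat]
      by (simp add: inverse_eq_divide)
  qed simp
  moreover have "continuous_on {0..} (\<lambda>t. c t i (v r i))"
    using markov_controls_action[OF v r, of i] by (intro continuous_on_slice[OF c_cont]) simp
  ultimately show "(\<lambda>n. c (?q (nat \<lfloor>r * real (Suc n)\<rfloor>) n) i (v r i)) \<longlonglongrightarrow> c r i (v r i)"
    using r by (elim continuous_on_tendsto_compose) auto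
qed

text \<open>The hypotheses on \<open>\<phi>\<close> are the facts extracted by
  \<open>hjb_solutionE\<close>, so that every solution can be inserted; uniqueness rests on this
  generality.\<close>

locale verification = control_problem U lam M c g T \<theta> B + controlled_law U lam M v s i\<^sub>0 P
  for U :: "nat \<Rightarrow> 'u metric" and lam M c g T \<theta> B v s i\<^sub>0 P +
  fixes \<phi> :: "real \<Rightarrow> nat \<Rightarrow> real" and K :: real
  assumes s_le: "s \<le> T"
    and \<phi>_bound: "\<And>t j. 0 \<le> t \<Longrightarrow> t \<le> T \<Longrightarrow> \<bar>\<phi> t j\<bar> \<le> K"
    and \<phi>_cont: "\<And>j. continuous_on {0..T} (\<lambda>t. \<phi> t j)"
    and \<phi>_int: "\<And>a b i. 0 \<le> a \<Longrightarrow> a \<le> b \<Longrightarrow> b \<le> T \<Longrightarrow>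
                  \<phi> a i - \<phi> b i = (LINT r:{a..b}|lborel. ham \<phi> r i)"
    and \<phi>_T: "\<And>i. \<phi> T i = exp (\<theta> * g i)"
begin

definition cost :: "real \<Rightarrow> real \<Rightarrow> nat \<Rightarrow> real" where
  "cost a b x = (LINT r:{a..b}|lborel. c r x (v r x))"

lemma action: "0 \<le> r \<Longrightarrow> v r x \<in> mspace (U x)"
  by (rule markov_controls_action[OF v])

lemma K_nonneg: "0 \<le> K"
  using \<phi>_bound[of T 0] T_pos by simp

lemma c_abs: "0 \<le> r \<Longrightarrow> \<bar>c r x (v r x)\<bar> \<le> B"
  using c_nonneg[of r, OF _ action] c_le[of r, OF _ action] by simp

lemma cost_integrable: "0 \<le> a \<Longrightarrow> set_integrable lborel {a..b} (\<lambda>r. c r x (v r x))"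
  using c_abs by (intro set_integrable_bounded_measurable[where K = B] measurable_running_cost v) auto

lemma cost_bounds:
  assumes "0 \<le> a" "a \<le> b"
  shows "0 \<le> cost a b x" "cost a b x \<le> B * (b - a)"
proof -
  show "0 \<le> cost a b x"
    unfolding cost_def set_lebesgue_integral_def using assms c_nonneg action
    by (intro Bochner_Integration.integral_nonneg) (auto simp: indicator_def)
  have "\<bar>cost a b x\<bar> \<le> B * (b - a)"
    unfolding cost_def using assms c_abs B_nonneg by (intro abs_set_integral_le) auto
  then show "cost a b x \<le> B * (b - a)"
    by simp
qed

lemma \<phi>_lipschitz:
  assumes "0 \<le> a" "a \<le> b" "b \<le> T"
  shows "\<bar>\<phi> b j - \<phi> a j\<bar> \<le> L * K * (b - a)"
proof -
  have "\<bar>LINT r:{a..b}|lborel. ham \<phi> r j\<bar> \<le> L * K * (b - a)"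
    using assms ham_bound[of _ \<phi> K j] \<phi>_bound L_nonneg K_nonneg by (intro abs_set_integral_le) auto
  then show ?thesis
    using \<phi>_int[OF assms, of j] by linarith
qed

text \<open>Freezing \<open>\<phi>\<close> at the right endpoint and linearising the exponential both cost \<open>O((b - a)\<^sup>2)\<close>;
  what remains is the integrated gap between the controlled and the minimised Hamiltonian.\<close>

lemma local_defect:
  assumes ab: "0 \<le> a" "a \<le> b" "b \<le> T"
  shows "\<bar>exp (\<theta> * cost a b x) * (\<phi> b x + (LINT r:{a..b}|lborel. generator lam v r (\<phi> b) x)) - \<phi> a x
      - (LINT r:{a..b}|lborel. hjb_term lam c \<theta> \<phi> r x (v r x) - ham \<phi> r x)\<bar>
    \<le> L\<^sup>2 * K * (2 * exp (L * T) + 1) * (b - a)\<^sup>2"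
proof -
  define h where "h = b - a"
  define y where "y = \<theta> * cost a b x"
  define \<Gamma> where "\<Gamma> = (LINT r:{a..b}|lborel. generator lam v r (\<phi> b) x)"
  define E where "E = exp (L * T)"
  let ?f = "\<lambda>r. hjb_term lam c \<theta> (\<lambda>_. \<phi> b) r x (v r x)"
  let ?p = "\<lambda>r. hjb_term lam c \<theta> \<phi> r x (v r x)"
  have h: "0 \<le> h" "h \<le> T"
    using ab by (auto simp: h_def)
  have fb: "\<bar>\<phi> b j\<bar> \<le> K" for j
    using \<phi>_bound[of b j] ab by simp
  have y0: "0 \<le> y"
    using cost_bounds(1)[OF ab(1,2)] \<theta>_pos by (simp add: y_def)
  have "y \<le> \<theta> * (B * h)"
    unfolding y_def h_def using cost_bounds(2)[OF ab(1,2)] \<theta>_pos by (intro mult_left_mono) auto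
  also have "\<dots> \<le> L * h"
    using M_nonneg h(1) by (simp add: L_def algebra_simps)
  finally have yL: "y \<le> L * h" .
  also have "\<dots> \<le> L * T"
    using h L_nonneg by (intro mult_left_mono)
  finally have eyE: "exp y \<le> E"
    by (simp add: E_def)
  have gb: "\<bar>generator lam v r (\<phi> b) x\<bar> \<le> 2 * M * K" if "0 \<le> r" for r
    by (rule generator_bound[OF v that fb])
  have \<Gamma>: "\<bar>\<Gamma>\<bar> \<le> L * K * h"
  proof -
    have "\<bar>\<Gamma>\<bar> \<le> 2 * M * K * h"
      unfolding \<Gamma>_def h_def using gb ab M_nonneg K_nonneg by (intro abs_set_integral_le) auto
    also have "\<dots> \<le> L * K * h"
      using h K_nonneg B_nonneg \<theta>_pos by (intro mult_right_mono) (auto simp: L_def)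
    finally show ?thesis .
  qed
  have int_g: "set_integrable lborel {a..b} (\<lambda>r. generator lam v r (\<phi> b) x)"
    using gb ab by (intro set_integrable_bounded_measurable[where K = "2 * M * K"] measurable_generator v) auto
  have int_c: "set_integrable lborel {a..b} (\<lambda>r. \<theta> * \<phi> b x * c r x (v r x))"
    using ab cost_integrable by (intro set_integrable_mult_right) auto
  have f_eq: "?f = (\<lambda>r. \<theta> * \<phi> b x * c r x (v r x) + generator lam v r (\<phi> b) x)"
    by (simp add: hjb_term_def generator_def mult_ac)
  have int_f: "set_integrable lborel {a..b} ?f"
    unfolding f_eq using int_c int_g by (rule set_integral_add(1))
  have f_int: "(LINT r:{a..b}|lborel. ?f r) = y * \<phi> b x + \<Gamma>"
    unfolding f_eq set_integral_add(2)[OF int_c int_g] by (simp add: y_def \<Gamma>_def cost_def)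
  \<comment> \<open>Over the step \<open>\<phi>\<close> moves by at most \<open>L * K * h\<close>,
    and \<open>hjb_term\<close> is Lipschitz in the function with constant \<open>L\<close>.\<close>
  have diff: "\<bar>?f r - ?p r\<bar> \<le> L * (L * K * h)" if "a \<le> r" "r \<le> b" for r
  proof (rule hjb_diff[of "v r x" x r "\<lambda>_. \<phi> b" K \<phi> K])
    show "\<bar>\<phi> b j - \<phi> r j\<bar> \<le> L * K * h" for j
    proof -
      have "\<bar>\<phi> b j - \<phi> r j\<bar> \<le> L * K * (b - r)"
        using that ab by (intro \<phi>_lipschitz) auto
      also have "\<dots> \<le> L * K * h"
        using that L_nonneg K_nonneg by (intro mult_left_mono) (auto simp: h_def)
      finally show ?thesis .
    qed
  qed (use that ab action fb \<phi>_bound in auto)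
  \<comment> \<open>\<open>\<phi>\<close> is known to be continuous only on \<open>{0..T}\<close>,
    so measurability is established on that interval instead of the half-line.\<close>
  have p_meas: "?p \<in> borel_measurable (restrict_space borel {0..T})"
  proof -
    have res: "restrict_space (restrict_space borel {0..}) {0..T} = (restrict_space borel {0..T} :: real measure)"
      by (subst restrict_restrict_space) (auto simp: Int_absorb1 intro!: arg_cong[where f = "restrict_space borel"])
    have "(\<lambda>r. c r x (v r x)) \<in> borel_measurable (restrict_space borel {0..T})"
      using measurable_restrict_space1[OF measurable_running_cost[OF v, of x], of "{0..T}"] by (simp add: res)
    moreover have "(\<lambda>r. rate lam x j (v r x)) \<in> borel_measurable (restrict_space borel {0..T})" for j
    proof -
      have "(\<lambda>r. rate lam x j (v r x)) \<in> borel_measurable (restrict_space borel {0..})"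
        using v by (intro measurable_compose[OF _ borel_measurable_action_borel[OF continuous_map_rate]])
          (simp add: markov_controls_def)
      from measurable_restrict_space1[OF this, of "{0..T}"] show ?thesis
        by (simp add: res)
    qed
    moreover have "(\<lambda>r. \<phi> r j) \<in> borel_measurable (restrict_space borel {0..T})" for j
      by (rule borel_measurable_continuous_on_restrict[OF \<phi>_cont])
    ultimately show ?thesis
      unfolding hjb_term_def
      by (intro borel_measurable_add borel_measurable_times borel_measurable_suminf) auto
  qed
  have int_p: "set_integrable lborel {a..b} ?p"
  proof -
    have "(\<lambda>r. indicator {0..T} r *\<^sub>R ?p r) \<in> borel_measurable lborel"
      using p_meas by (simp add: borel_measurable_restrict_space_iff)
    moreover have "\<bar>?p r\<bar> \<le> L * K" if "0 \<le> r" "r \<le> T" for r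
      using hjb_bound[of "v r x" x r \<phi> K] action \<phi>_bound that by simp
    ultimately have "integrable lborel (\<lambda>r. indicator {a..b} r *\<^sub>R (indicator {0..T} r *\<^sub>R ?p r))"
      using ab by (intro integrableI_bounded_set_indicator[where B = "L * K"])
        (auto simp: indicator_def emeasure_lborel_Icc_eq)
    moreover have "(\<lambda>r. indicator {a..b} r *\<^sub>R (indicator {0..T} r *\<^sub>R ?p r)) =
        (\<lambda>r. indicator {a..b} r *\<^sub>R ?p r)"
      using ab by (auto simp: indicator_def)
    ultimately show ?thesis
      by (simp add: set_integrable_def)
  qed
  have int_ham: "set_integrable lborel {a..b} (\<lambda>r. ham \<phi> r x)"
    using ab \<phi>_bound
    by (intro borel_integrable_atLeastAtMost' continuous_on_ham[of _ _ K] continuous_on_subset[OF \<phi>_cont]) auto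
  have "(LINT r:{a..b}|lborel. ?f r - ?p r) = (LINT r:{a..b}|lborel. ?f r) - (LINT r:{a..b}|lborel. ?p r)"
    using int_f int_p by (rule set_integral_diff(2))
  moreover have "\<bar>LINT r:{a..b}|lborel. ?f r - ?p r\<bar> \<le> L * (L * K * h) * h"
    unfolding h_def using diff ab L_nonneg K_nonneg h(1)
    by (intro abs_set_integral_le) (auto simp: h_def)
  ultimately have d1: "\<bar>y * \<phi> b x + \<Gamma> - (LINT r:{a..b}|lborel. ?p r)\<bar> \<le> L\<^sup>2 * K * h\<^sup>2"
    by (simp add: f_int power2_eq_square mult_ac)
  have "exp y - 1 - y \<le> y\<^sup>2 * exp y"
    by (rule exp_remainder_le[OF y0])
  also have "\<dots> \<le> (L * h)\<^sup>2 * E"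
    using y0 yL eyE by (intro mult_mono power_mono) auto
  finally have "\<bar>exp y - 1 - y\<bar> \<le> (L * h)\<^sup>2 * E"
    using exp_ge_add_one_self[of y] by linarith
  then have "\<bar>exp y - 1 - y\<bar> * \<bar>\<phi> b x\<bar> \<le> (L * h)\<^sup>2 * E * K"
    using fb by (intro mult_mono) (auto simp: E_def)
  then have d2: "\<bar>(exp y - 1 - y) * \<phi> b x\<bar> \<le> L\<^sup>2 * K * E * h\<^sup>2"
    by (simp add: abs_mult power_mult_distrib mult_ac)
  have "exp y - 1 \<le> y * exp y"
    by (rule exp_diff_one_le[OF y0])
  also have "\<dots> \<le> L * h * E"
    using y0 yL eyE by (intro mult_mono) auto
  finally have "\<bar>exp y - 1\<bar> * \<bar>\<Gamma>\<bar> \<le> L * h * E * (L * K * h)"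
    using \<Gamma> y0 L_nonneg h by (intro mult_mono) (auto simp: E_def)
  then have d3: "\<bar>(exp y - 1) * \<Gamma>\<bar> \<le> L\<^sup>2 * K * E * h\<^sup>2"
    by (simp add: abs_mult power2_eq_square mult_ac)
  \<comment> \<open>Three errors: the second-order remainder of the exponential, its first-order
    change multiplied by the generator integral, and the freezing of \<open>\<phi>\<close>. They
    contribute \<open>E\<close>, \<open>E\<close> and 1 to the factor
    \<open>2 * E + 1\<close>.\<close>
  have split: "exp y * (\<phi> b x + \<Gamma>) - \<phi> a x - (LINT r:{a..b}|lborel. ?p r - ham \<phi> r x) =
      (exp y - 1 - y) * \<phi> b x + (exp y - 1) * \<Gamma> + (y * \<phi> b x + \<Gamma> - (LINT r:{a..b}|lborel. ?p r))"
    using \<phi>_int[OF ab, of x] unfolding set_integral_diff(2)[OF int_p int_ham]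
    by (simp add: algebra_simps)
  have "\<bar>exp y * (\<phi> b x + \<Gamma>) - \<phi> a x - (LINT r:{a..b}|lborel. ?p r - ham \<phi> r x)\<bar> \<le>
      L\<^sup>2 * K * E * h\<^sup>2 + L\<^sup>2 * K * E * h\<^sup>2 + L\<^sup>2 * K * h\<^sup>2"
    unfolding split using d1 d2 d3 by linarith
  also have "\<dots> = L\<^sup>2 * K * (2 * E + 1) * h\<^sup>2"
    by (simp add: algebra_simps)
  finally show ?thesis
    by (simp add: y_def \<Gamma>_def E_def h_def)
qed

section \<open>One-step estimates and their sum along a uniform grid\<close>

definition mesh :: "nat \<Rightarrow> real" where
  "mesh n = (T - s) / real (Suc n)"

definition grid :: "nat \<Rightarrow> nat \<Rightarrow> real" where
  "grid n k = s + real k * mesh n"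

definition grid_cost :: "nat \<Rightarrow> nat \<Rightarrow> (real \<Rightarrow> nat) \<Rightarrow> real" where
  "grid_cost n k \<omega> = (\<Sum>l<k. cost (grid n l) (grid n (Suc l)) (\<omega> (grid n l)))"

definition weight :: "nat \<Rightarrow> nat \<Rightarrow> (real \<Rightarrow> nat) \<Rightarrow> real" where
  "weight n k \<omega> = exp (\<theta> * grid_cost n k \<omega>)"

definition mean :: "nat \<Rightarrow> nat \<Rightarrow> real" where
  "mean n k = expectation (\<lambda>\<omega>. weight n k \<omega> * \<phi> (grid n k) (\<omega> (grid n k)))"

lemma mesh_nonneg: "0 \<le> mesh n"
  using s_le by (simp add: mesh_def)

lemma grid_0 [simp]: "grid n 0 = s"
  by (simp add: grid_def)

lemma grid_last [simp]: "grid n (Suc n) = T"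
  by (simp add: grid_def mesh_def del: of_nat_Suc)

lemma grid_Suc: "grid n (Suc k) = grid n k + mesh n"
  by (simp add: grid_def algebra_simps)

lemma grid_mono: "k \<le> l \<Longrightarrow> grid n k \<le> grid n l"
  using mesh_nonneg by (simp add: grid_def mult_right_mono)

lemma grid_bounds:
  assumes "k \<le> Suc n"
  shows "s \<le> grid n k" "grid n k \<le> T" "0 \<le> grid n k"
  using grid_mono[of 0 k n] grid_mono[OF assms, of n] s by simp_all

lemma grid_cost_bounds:
  assumes "k \<le> Suc n"
  shows "0 \<le> grid_cost n k \<omega>" "grid_cost n k \<omega> \<le> B * (grid n k - s)"
proof -
  have c: "0 \<le> cost (grid n l) (grid n (Suc l)) x" "cost (grid n l) (grid n (Suc l)) x \<le> B * mesh n"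
    if "l < k" for l x
    using cost_bounds[of "grid n l" "grid n (Suc l)" x] grid_bounds(3)[of l n] that assms mesh_nonneg[of n]
    by (auto simp: grid_Suc)
  show "0 \<le> grid_cost n k \<omega>"
    unfolding grid_cost_def using c by (intro sum_nonneg) auto
  have "grid_cost n k \<omega> \<le> (\<Sum>l<k. B * mesh n)"
    unfolding grid_cost_def using c by (intro sum_mono) auto
  then show "grid_cost n k \<omega> \<le> B * (grid n k - s)"
    by (simp add: grid_def mult_ac)
qed

lemma weight_bounds:
  assumes "k \<le> Suc n"
  shows "0 < weight n k \<omega>" "weight n k \<omega> \<le> exp (L * T)"
proof -
  have "\<theta> * grid_cost n k \<omega> \<le> \<theta> * (B * (grid n k - s))"
    using grid_cost_bounds(2)[OF assms] \<theta>_pos by (intro mult_left_mono) auto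
  also have "\<dots> \<le> \<theta> * (B * T)"
    using grid_bounds[OF assms] s B_nonneg \<theta>_pos by (intro mult_left_mono) auto
  also have "\<dots> \<le> L * T"
    using M_nonneg T_pos by (simp add: L_def algebra_simps)
  finally show "weight n k \<omega> \<le> exp (L * T)"
    by (simp add: weight_def)
qed (simp add: weight_def)

text \<open>\<open>weight n k\<close> reads the path only at grid times with index below
  \<open>k\<close>. Hence \<open>weight n (Suc k)\<close> is already known at time
  \<open>grid n k\<close>, one step ahead of its index.\<close>

lemma weight_measurable:
  assumes "0 \<le> a" "\<And>l. l < k \<Longrightarrow> 0 \<le> grid n l \<and> grid n l \<le> a"
  shows "weight n k \<in> borel_measurable (path_filtration a)"
proof -
  have "(\<lambda>\<omega>. cost (grid n l) (grid n (Suc l)) (\<omega> (grid n l))) \<in> borel_measurable (path_filtration a)"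
    if "l < k" for l
    using assms(2)[OF that]
    by (intro measurable_compose[OF measurable_coordinate_filtration]) auto
  then have [measurable]: "grid_cost n k \<in> borel_measurable (path_filtration a)"
    unfolding grid_cost_def[abs_def] by (intro borel_measurable_sum) auto
  show ?thesis
    unfolding weight_def[abs_def] by measurable
qed

lemma integrable_mult_coord:
  fixes F :: "nat \<Rightarrow> real"
  assumes "Z \<in> borel_measurable (path_filtration a)" "\<And>\<omega>. \<bar>Z \<omega>\<bar> \<le> w"
    and "0 \<le> b" "\<And>j. \<bar>F j\<bar> \<le> k"
  shows "integrable P (\<lambda>\<omega>. Z \<omega> * F (\<omega> b))"
proof (rule integrable_const_bound[of _ "w * k"])
  have "\<bar>Z \<omega>\<bar> * \<bar>F (\<omega> b)\<bar> \<le> w * k" for \<omega>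
    using assms(2)[of \<omega>] assms(4) by (intro mult_mono) auto
  then show "AE \<omega> in P. norm (Z \<omega> * F (\<omega> b)) \<le> w * k"
    by (simp add: abs_mult)
  show "(\<lambda>\<omega>. Z \<omega> * F (\<omega> b)) \<in> borel_measurable P"
    by (intro borel_measurable_times measurable_from_filtration[OF assms(1)] measurable_coord_real assms(3))
qed

text \<open>Up to the error of freezing the state, this is the conditional mean change of the
  weighted \<open>\<phi>\<close> over a step started in \<open>x\<close>, per unit of weight
  accumulated so far.\<close>

definition defect :: "real \<Rightarrow> real \<Rightarrow> nat \<Rightarrow> real" where
  "defect a b x = exp (\<theta> * cost a b x) *
     (\<phi> b x + (LINT r:{a..b}|lborel. generator lam v r (\<phi> b) x)) - \<phi> a x"

definition gap :: "real \<Rightarrow> real \<Rightarrow> nat \<Rightarrow> real" where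
  "gap a b x = (LINT r:{a..b}|lborel. hjb_term lam c \<theta> \<phi> r x (v r x) - ham \<phi> r x)"

definition K\<^sub>1 :: real where "K\<^sub>1 = L\<^sup>2 * K * (2 * exp (L * T) + 1)"

text \<open>The first summand comes from \<open>one_step\<close>, the second from
  \<open>local_defect\<close>; in both, \<open>exp (L * T)\<close> bounds the weight.\<close>

definition K\<^sub>2 :: real where "K\<^sub>2 = exp (L * T) * (4 * M * K) * M + exp (L * T) * K\<^sub>1"

lemma K\<^sub>1_nonneg: "0 \<le> K\<^sub>1"
  using K_nonneg by (simp add: K\<^sub>1_def)

lemma mean_step:
  assumes k: "k \<le> n"
  defines "a \<equiv> grid n k" and "b \<equiv> grid n (Suc k)"
  shows "\<bar>mean n (Suc k) - mean n k - expectation (\<lambda>\<omega>. weight n k \<omega> * defect a b (\<omega> a))\<bar>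
      \<le> exp (L * T) * (4 * M * K) * (M * (mesh n)\<^sup>2)"
    and "integrable P (\<lambda>\<omega>. weight n k \<omega> * defect a b (\<omega> a))"
proof -
  have ab: "s \<le> a" "0 \<le> a" "a \<le> b" "b \<le> T" "b - a = mesh n" "a \<le> T"
    using grid_bounds[of k n] grid_bounds[of "Suc k" n] k mesh_nonneg[of n]
    by (auto simp: a_def b_def grid_Suc)
  let ?J = "\<lambda>x. \<phi> b x + (LINT r:{a..b}|lborel. generator lam v r (\<phi> b) x)"
  have fb: "\<bar>\<phi> b j\<bar> \<le> K" and fa: "\<bar>\<phi> a j\<bar> \<le> K" for j
    using \<phi>_bound ab by auto
  have W: "weight n k \<in> borel_measurable (path_filtration a)"
    using k ab(2) by (intro weight_measurable) (auto simp: a_def grid_mono grid_bounds(3))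
  have W': "weight n (Suc k) \<in> borel_measurable (path_filtration a)"
    using k ab(2) by (intro weight_measurable) (auto simp: a_def grid_mono grid_bounds(3))
  have Wb: "\<bar>weight n k \<omega>\<bar> \<le> exp (L * T)" "\<bar>weight n (Suc k) \<omega>\<bar> \<le> exp (L * T)" for \<omega>
    using weight_bounds[of k n \<omega>] weight_bounds[of "Suc k" n \<omega>] k by auto
  have Jb: "\<bar>?J x\<bar> \<le> K + 2 * M * K * (b - a)" for x
  proof -
    have "\<bar>LINT r:{a..b}|lborel. generator lam v r (\<phi> b) x\<bar> \<le> 2 * M * K * (b - a)"
      using ab generator_bound[OF v _ fb] M_nonneg K_nonneg by (intro abs_set_integral_le) auto
    then show ?thesis
      using fb[of x] by linarith
  qed
  have W_Suc: "weight n (Suc k) \<omega> = weight n k \<omega> * exp (\<theta> * cost a b (\<omega> a))" for \<omega>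
    by (simp add: weight_def grid_cost_def a_def b_def distrib_left exp_add)
  have int1: "integrable P (\<lambda>\<omega>. weight n (Suc k) \<omega> * ?J (\<omega> a))"
    by (rule integrable_mult_coord[OF W' Wb(2) ab(2) Jb])
  have int2: "integrable P (\<lambda>\<omega>. weight n k \<omega> * \<phi> a (\<omega> a))"
    by (rule integrable_mult_coord[OF W Wb(1) ab(2) fa])
  have eq: "(\<lambda>\<omega>. weight n k \<omega> * defect a b (\<omega> a)) =
      (\<lambda>\<omega>. weight n (Suc k) \<omega> * ?J (\<omega> a) - weight n k \<omega> * \<phi> a (\<omega> a))"
    unfolding W_Suc defect_def by (simp add: algebra_simps)
  show "integrable P (\<lambda>\<omega>. weight n k \<omega> * defect a b (\<omega> a))"
    unfolding eq by (rule Bochner_Integration.integrable_diff[OF int1 int2])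
  have "expectation (\<lambda>\<omega>. weight n k \<omega> * defect a b (\<omega> a)) =
      expectation (\<lambda>\<omega>. weight n (Suc k) \<omega> * ?J (\<omega> a)) - mean n k"
    unfolding eq Bochner_Integration.integral_diff[OF int1 int2] by (simp add: mean_def a_def)
  moreover have "\<bar>mean n (Suc k) - expectation (\<lambda>\<omega>. weight n (Suc k) \<omega> * ?J (\<omega> a))\<bar>
      \<le> exp (L * T) * (4 * M * K) * (M * (b - a)\<^sup>2)"
    using one_step[of "\<phi> b" K a b "weight n (Suc k)" "exp (L * T)", OF fb ab(1,3) W' Wb(2)]
    by (simp add: mean_def b_def)
  ultimately show "\<bar>mean n (Suc k) - mean n k - expectation (\<lambda>\<omega>. weight n k \<omega> * defect a b (\<omega> a))\<bar>
      \<le> exp (L * T) * (4 * M * K) * (M * (mesh n)\<^sup>2)"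
    using ab(5) by simp
qed

lemma mean_step_ge:
  assumes k: "k \<le> n" and d: "\<And>x. - (K\<^sub>1 * (mesh n)\<^sup>2) \<le> defect (grid n k) (grid n (Suc k)) x"
  shows "mean n k - K\<^sub>2 * (mesh n)\<^sup>2 \<le> mean n (Suc k)"
proof -
  let ?D = "\<lambda>\<omega>. weight n k \<omega> * defect (grid n k) (grid n (Suc k)) (\<omega> (grid n k))"
  have "- (exp (L * T) * (K\<^sub>1 * (mesh n)\<^sup>2)) \<le> ?D \<omega>" for \<omega>
  proof -
    have "weight n k \<omega> * (- (K\<^sub>1 * (mesh n)\<^sup>2)) \<le> ?D \<omega>"
      using weight_bounds(1)[of k n \<omega>] k d by (intro mult_left_mono) auto
    moreover have "weight n k \<omega> * (K\<^sub>1 * (mesh n)\<^sup>2) \<le> exp (L * T) * (K\<^sub>1 * (mesh n)\<^sup>2)"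
      using weight_bounds(2)[of k n \<omega>] k K\<^sub>1_nonneg by (intro mult_right_mono) auto
    ultimately show ?thesis
      by linarith
  qed
  then have "- (exp (L * T) * (K\<^sub>1 * (mesh n)\<^sup>2)) \<le> expectation ?D"
    by (intro integral_ge_const mean_step(2)[OF k]) auto
  then show ?thesis
    using mean_step(1)[OF k] by (simp add: K\<^sub>2_def algebra_simps abs_le_iff)
qed

lemma mean_step_le:
  assumes k: "k \<le> n" and d: "\<And>x. defect (grid n k) (grid n (Suc k)) x \<le> K\<^sub>1 * (mesh n)\<^sup>2"
  shows "mean n (Suc k) \<le> mean n k + K\<^sub>2 * (mesh n)\<^sup>2"
proof -
  let ?D = "\<lambda>\<omega>. weight n k \<omega> * defect (grid n k) (grid n (Suc k)) (\<omega> (grid n k))"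
  have "?D \<omega> \<le> exp (L * T) * (K\<^sub>1 * (mesh n)\<^sup>2)" for \<omega>
  proof -
    have "?D \<omega> \<le> weight n k \<omega> * (K\<^sub>1 * (mesh n)\<^sup>2)"
      using weight_bounds(1)[of k n \<omega>] k d by (intro mult_left_mono) auto
    moreover have "weight n k \<omega> * (K\<^sub>1 * (mesh n)\<^sup>2) \<le> exp (L * T) * (K\<^sub>1 * (mesh n)\<^sup>2)"
      using weight_bounds(2)[of k n \<omega>] k K\<^sub>1_nonneg by (intro mult_right_mono) auto
    ultimately show ?thesis
      by linarith
  qed
  then have "expectation ?D \<le> exp (L * T) * (K\<^sub>1 * (mesh n)\<^sup>2)"
    by (intro integral_le_const mean_step(2)[OF k]) auto
  then show ?thesis
    using mean_step(1)[OF k] by (simp add: K\<^sub>2_def algebra_simps abs_le_iff)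
qed

lemma defect_near_gap:
  assumes "k \<le> n"
  shows "\<bar>defect (grid n k) (grid n (Suc k)) x - gap (grid n k) (grid n (Suc k)) x\<bar> \<le> K\<^sub>1 * (mesh n)\<^sup>2"
  using local_defect[of "grid n k" "grid n (Suc k)" x] grid_bounds[of k n] grid_bounds[of "Suc k" n]
    grid_mono[of k "Suc k" n] assms
  by (simp add: defect_def gap_def K\<^sub>1_def grid_Suc)

lemma gap_nonneg:
  assumes "0 \<le> a" "b \<le> T"
  shows "0 \<le> gap a b x"
  unfolding gap_def set_lebesgue_integral_def
  using assms ham_le[of "v r x" x r \<phi> K for r, OF action] \<phi>_bound
  by (intro Bochner_Integration.integral_nonneg) (auto simp: indicator_def)

lemma gap_eq_0:
  assumes "0 \<le> a" "b \<le> T"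
    and opt: "\<And>r. 0 \<le> r \<Longrightarrow> r < T \<Longrightarrow> ham \<phi> r x = hjb_term lam c \<theta> \<phi> r x (v r x)"
  shows "gap a b x = 0"
proof -
  \<comment> \<open>Optimality is assumed only before \<open>T\<close>; the single time
    \<open>T\<close> is a null set.\<close>
  have "gap a b x = (\<integral>r. 0 \<partial>(lborel :: real measure))"
    unfolding gap_def set_lebesgue_integral_def
    using assms by (intro integral_discrete_difference[where X = "{T}"]) (auto simp: indicator_def)
  then show ?thesis
    by simp
qed

lemma mean_0: "mean n 0 = \<phi> s i\<^sub>0"
proof -
  have "AE \<omega> in P. \<omega> s = i\<^sub>0"
    using sol by (simp add: solves_martingale_problem_def)
  then have "expectation (\<lambda>\<omega>. \<phi> s (\<omega> s)) = expectation (\<lambda>\<omega>. \<phi> s i\<^sub>0)"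
    using s by (intro integral_cong_AE measurable_coord_real) auto
  then show ?thesis
    by (simp add: mean_def weight_def grid_cost_def prob_space)
qed

lemma mesh_sum: "real (Suc n) * (K\<^sub>2 * (mesh n)\<^sup>2) = K\<^sub>2 * (T - s)\<^sup>2 / real (Suc n)"
  by (simp add: mesh_def power2_eq_square field_simps del: of_nat_Suc)

text \<open>The gap is nonnegative, so each of the \<open>Suc n\<close> steps loses at most
  \<open>K\<^sub>2 * (mesh n)\<^sup>2\<close>, and the total loss is of order
  \<open>1 / Suc n\<close>. For a minimising control the gap vanishes and the same sum bounds the
  gain.\<close>

lemma mean_last_ge: "\<phi> s i\<^sub>0 - K\<^sub>2 * (T - s)\<^sup>2 / real (Suc n) \<le> mean n (Suc n)"
proof -
  have "\<phi> s i\<^sub>0 - real k * (K\<^sub>2 * (mesh n)\<^sup>2) \<le> mean n k" if "k \<le> Suc n" for k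
    using that
  proof (induction k)
    case (Suc k)
    then have k: "k \<le> n"
      by simp
    have "- (K\<^sub>1 * (mesh n)\<^sup>2) \<le> defect (grid n k) (grid n (Suc k)) x" for x
      using defect_near_gap[OF k, of x] gap_nonneg[of "grid n k" "grid n (Suc k)" x]
        grid_bounds[of k n] grid_bounds[of "Suc k" n] k by simp
    from mean_step_ge[OF k this] show ?case
      using Suc by (simp add: algebra_simps)
  qed (simp add: mean_0)
  from this[of "Suc n"] show ?thesis
    by (simp only: mesh_sum order_refl)
qed

lemma mean_last_le:
  assumes opt: "\<And>r x. 0 \<le> r \<Longrightarrow> r < T \<Longrightarrow> ham \<phi> r x = hjb_term lam c \<theta> \<phi> r x (v r x)"
  shows "mean n (Suc n) \<le> \<phi> s i\<^sub>0 + K\<^sub>2 * (T - s)\<^sup>2 / real (Suc n)"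
proof -
  have "mean n k \<le> \<phi> s i\<^sub>0 + real k * (K\<^sub>2 * (mesh n)\<^sup>2)" if "k \<le> Suc n" for k
    using that
  proof (induction k)
    case (Suc k)
    then have k: "k \<le> n"
      by simp
    have "defect (grid n k) (grid n (Suc k)) x \<le> K\<^sub>1 * (mesh n)\<^sup>2" for x
      using defect_near_gap[OF k, of x] gap_eq_0[of "grid n k" "grid n (Suc k)" x, OF _ _ opt]
        grid_bounds[of k n] grid_bounds[of "Suc k" n] k by simp
    from mean_step_le[OF k this] show ?case
      using Suc by (simp add: algebra_simps)
  qed (simp add: mean_0)
  from this[of "Suc n"] show ?thesis
    by (simp only: mesh_sum order_refl)
qed

section \<open>Convergence of the discretised cost to the cost of the path\<close>

definition path_cost :: "(real \<Rightarrow> nat) \<Rightarrow> real" where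
  "path_cost \<omega> = (LINT r:{s..T}|lborel. c r (\<omega> r) (v r (left_lim \<omega> r)))"

lemma path_cost_eq:
  assumes \<omega>: "\<omega> \<in> cadlag_paths"
  shows "path_cost \<omega> = (LINT r:{s..T}|lborel. c r (\<omega> r) (v r (\<omega> r)))"
  unfolding path_cost_def set_lebesgue_integral_def
proof (rule integral_discrete_difference)
  show "countable (insert 0 {t. 0 < t \<and> left_lim \<omega> t \<noteq> \<omega> t})"
    using countable_jump_times[OF \<omega>] by simp
  fix r assume r: "r \<notin> insert 0 {t. 0 < t \<and> left_lim \<omega> t \<noteq> \<omega> t}"
  show "indicator {s..T} r *\<^sub>R c r (\<omega> r) (v r (left_lim \<omega> r)) = indicator {s..T} r *\<^sub>R c r (\<omega> r) (v r (\<omega> r))"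
    using r s by (cases "r \<in> {s..T}") auto
qed auto

text \<open>The last grid time not after \<open>r\<close>, for \<open>r\<close> between
  \<open>s\<close> and \<open>T\<close>.\<close>

definition floor_grid :: "nat \<Rightarrow> real \<Rightarrow> real" where
  "floor_grid n r = grid n (nat \<lfloor>(r - s) / mesh n\<rfloor>)"

lemma floor_grid_eq:
  assumes "grid n k \<le> r" "r < grid n (Suc k)"
  shows "floor_grid n r = grid n k"
proof -
  have m: "0 < mesh n"
    using assms by (simp add: grid_Suc)
  have "real k \<le> (r - s) / mesh n" "(r - s) / mesh n < real k + 1"
    using assms m by (auto simp: grid_def field_simps)
  then have "\<lfloor>(r - s) / mesh n\<rfloor> = int k"
    by (intro floor_unique) auto
  then show ?thesis
    by (simp add: floor_grid_def)
qed

lemma floor_grid_bounds: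
  assumes "s \<le> r" "r \<le> T"
  shows "r - mesh n \<le> floor_grid n r" "floor_grid n r \<le> r"
proof -
  have "r - mesh n \<le> floor_grid n r \<and> floor_grid n r \<le> r"
  \<comment> \<open>The mesh vanishes exactly when \<open>s = T\<close>, and then all grid points
    coincide.\<close>
  proof (cases "mesh n = 0")
    case True
    then have "r = s"
      using assms by (simp add: mesh_def)
    moreover have "floor_grid n r = s"
      using True by (simp add: floor_grid_def grid_def)
    ultimately show ?thesis
      using True by linarith
  next
    case False
    then have m: "0 < mesh n"
      using mesh_nonneg[of n] by simp
    let ?q = "(r - s) / mesh n"
    have "0 \<le> ?q"
      using assms m by simp
    then have fl: "real (nat \<lfloor>?q\<rfloor>) = of_int \<lfloor>?q\<rfloor>"
      by (simp add: of_nat_nat)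
    have "of_int \<lfloor>?q\<rfloor> * mesh n \<le> ?q * mesh n" "(?q - 1) * mesh n \<le> of_int \<lfloor>?q\<rfloor> * mesh n"
      using m by (intro mult_right_mono; linarith)+
    moreover have "?q * mesh n = r - s"
      using m by simp
    ultimately have "of_int \<lfloor>?q\<rfloor> * mesh n \<le> r - s" "r - s - mesh n \<le> of_int \<lfloor>?q\<rfloor> * mesh n"
      by (simp_all only: left_diff_distrib mult_1)
    then show ?thesis
      unfolding floor_grid_def grid_def fl by linarith
  qed
  then show "r - mesh n \<le> floor_grid n r" "floor_grid n r \<le> r"
    by auto
qed

lemma floor_grid_cost_measurable:
  "(\<lambda>r. c r (\<omega> (floor_grid n r)) (v r (\<omega> (floor_grid n r)))) \<in> borel_measurable (restrict_space borel {0..})"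
proof (rule measurable_compose_countable[OF measurable_running_cost[OF v]])
  have "(\<lambda>r. nat \<lfloor>(r - s) / mesh n\<rfloor>) \<in> measurable (restrict_space borel {0..}) (count_space UNIV)"
    by (intro measurable_restrict_space1) measurable
  then show "(\<lambda>r. \<omega> (floor_grid n r)) \<in> measurable (restrict_space borel {0..}) (count_space UNIV)"
    unfolding floor_grid_def by (rule measurable_compose) simp
qed

lemma grid_cost_eq_integral:
  assumes "k \<le> Suc n"
  shows "grid_cost n k \<omega> =
    (LINT r:{s..grid n k}|lborel. c r (\<omega> (floor_grid n r)) (v r (\<omega> (floor_grid n r))))"
  using assms
proof (induction k)
  case 0
  have "(LINT r:{s..s}|lborel. c r (\<omega> (floor_grid n r)) (v r (\<omega> (floor_grid n r)))) = (\<integral>r. 0 \<partial>(lborel :: real measure))"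
    unfolding set_lebesgue_integral_def
    by (intro integral_discrete_difference[where X = "{s}"]) (auto simp: indicator_def)
  then show ?case
    by (simp add: grid_cost_def)
next
  case (Suc k)
  let ?F = "\<lambda>r. c r (\<omega> (floor_grid n r)) (v r (\<omega> (floor_grid n r)))"
  have int: "set_integrable lborel {s..grid n (Suc k)} ?F"
    using s c_abs by (intro set_integrable_bounded_measurable[where K = B] floor_grid_cost_measurable) auto
  \<comment> \<open>\<open>floor_grid\<close> is constant on the cell except at its right endpoint,
    which belongs to the next cell and has measure zero.\<close>
  have "(LINT r:{grid n k..grid n (Suc k)}|lborel. ?F r) = cost (grid n k) (grid n (Suc k)) (\<omega> (grid n k))"
    unfolding cost_def set_lebesgue_integral_def
    by (rule integral_discrete_difference[where X = "{grid n (Suc k)}"])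
      (auto simp: indicator_def floor_grid_eq)
  moreover have "s \<le> grid n k" "grid n k \<le> grid n (Suc k)"
    using grid_mono[of 0 k n] grid_mono[of k "Suc k" n] by auto
  ultimately show ?case
    using Suc set_integral_Icc_split[OF int] by (simp add: grid_cost_def)
qed

lemma mesh_tendsto: "mesh \<longlonglongrightarrow> 0"
  using tendsto_mult_right_zero[OF LIMSEQ_inverse_real_of_nat, of "T - s"]
  by (simp add: mesh_def[abs_def] divide_inverse)

text \<open>At a time \<open>r > 0\<close> that is not a jump time the path is constant on some
  interval ending at \<open>r\<close> and including it; once the mesh is shorter,
  \<open>floor_grid n r\<close> lies in that interval and the integrands agree. Jump times are null,
  and \<open>B\<close> dominates.\<close>

lemma grid_cost_tendsto:
  assumes \<omega>: "\<omega> \<in> cadlag_paths"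
  shows "(\<lambda>n. grid_cost n (Suc n) \<omega>) \<longlonglongrightarrow> path_cost \<omega>"
proof -
  let ?F = "\<lambda>n r. c r (\<omega> (floor_grid n r)) (v r (\<omega> (floor_grid n r)))"
  let ?f = "\<lambda>r. c r (\<omega> r) (v r (\<omega> r))"
  let ?X = "insert 0 {t. 0 < t \<and> left_lim \<omega> t \<noteq> \<omega> t}"
  have "(\<lambda>n. \<integral>r. indicator {s..T} r *\<^sub>R ?F n r \<partial>lborel) \<longlonglongrightarrow> (\<integral>r. indicator {s..T} r *\<^sub>R ?f r \<partial>lborel)"
  proof (rule integral_dominated_convergence[where w = "\<lambda>r. indicator {s..T} r *\<^sub>R B"])
    have f_meas: "?f \<in> borel_measurable (restrict_space borel {0..})"
      by (rule measurable_compose_countable[OF measurable_running_cost[OF v] measurable_path_restrict[OF \<omega>]])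
    have int: "set_integrable lborel {s..T} ?f" "set_integrable lborel {s..T} (?F n)" for n
      using s c_abs f_meas
      by (intro set_integrable_bounded_measurable[where K = B] floor_grid_cost_measurable; auto)+
    show "(\<lambda>r. indicator {s..T} r *\<^sub>R ?f r) \<in> borel_measurable lborel"
      using int(1) unfolding set_integrable_def by (rule borel_measurable_integrable)
    show "(\<lambda>r. indicator {s..T} r *\<^sub>R ?F n r) \<in> borel_measurable lborel" for n
      using int(2) unfolding set_integrable_def by (rule borel_measurable_integrable)
    show "integrable lborel (\<lambda>r. indicator {s..T} r *\<^sub>R B)"
      using borel_integrable_atLeastAtMost'[of s T "\<lambda>_. B"] by (simp add: set_integrable_def)
    show "AE r in lborel. norm (indicator {s..T} r *\<^sub>R ?F n r) \<le> indicator {s..T} r *\<^sub>R B" for n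
      using s c_abs by (intro AE_I2) (auto simp: indicator_def)
    have "AE r in lborel. r \<notin> ?X"
      using countable_jump_times[OF \<omega>] by (intro AE_not_in countable_imp_null_set_lborel) simp
    then show "AE r in lborel. (\<lambda>n. indicator {s..T} r *\<^sub>R ?F n r) \<longlonglongrightarrow> indicator {s..T} r *\<^sub>R ?f r"
    proof eventually_elim
      case (elim r)
      show ?case
      proof (cases "r \<in> {s..T}")
        case True
        then have r: "0 < r" "left_lim \<omega> r = \<omega> r" "s \<le> r" "r \<le> T"
          using elim s by auto
        obtain a where a: "a < r" "\<forall>q. a < q \<longrightarrow> q < r \<longrightarrow> \<omega> q = \<omega> r"
          using eventually_at_left_path[OF \<omega> r(1)] unfolding r(2) eventually_at_left_field by blast
        have "eventually (\<lambda>n. mesh n < r - a) sequentially"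
          using order_tendstoD(2)[OF mesh_tendsto, of "r - a"] a by simp
        then have "eventually (\<lambda>n. ?F n r = ?f r) sequentially"
        proof eventually_elim
          case (elim n)
          then have "a < floor_grid n r" "floor_grid n r \<le> r"
            using floor_grid_bounds[OF r(3,4), of n] by auto
          then have "\<omega> (floor_grid n r) = \<omega> r"
            using a(2) by (cases "floor_grid n r = r") auto
          then show ?case
            by simp
        qed
        then have "(\<lambda>n. ?F n r) \<longlonglongrightarrow> ?f r"
          by (rule tendsto_eventually)
        then show ?thesis
          by (intro tendsto_scaleR tendsto_const)
      qed simp
    qed
  qed
  then show ?thesis
    using grid_cost_eq_integral[OF order_refl] path_cost_eq[OF \<omega>]
    by (simp add: set_lebesgue_integral_def)
qed

lemma
  shows mean_tendsto: "(\<lambda>n. mean n (Suc n)) \<longlonglongrightarrow> expectation (\<lambda>\<omega>. exp (\<theta> * (path_cost \<omega> + g (\<omega> T))))"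
    and integrable_exp_path_cost: "integrable P (\<lambda>\<omega>. exp (\<theta> * (path_cost \<omega> + g (\<omega> T))))"
proof -
  let ?X = "\<lambda>n \<omega>. weight n (Suc n) \<omega> * \<phi> T (\<omega> T)"
  let ?Y = "\<lambda>\<omega>. exp (\<theta> * (path_cost \<omega> + g (\<omega> T)))"
  have lim: "(\<lambda>n. ?X n \<omega>) \<longlonglongrightarrow> ?Y \<omega>" if "\<omega> \<in> space P" for \<omega>
  proof -
    have "(\<lambda>n. exp (\<theta> * grid_cost n (Suc n) \<omega>) * exp (\<theta> * g (\<omega> T))) \<longlonglongrightarrow>
        exp (\<theta> * path_cost \<omega>) * exp (\<theta> * g (\<omega> T))"
      using that by (intro tendsto_intros grid_cost_tendsto) (simp add: space_P)
    then show ?thesis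
      by (simp add: weight_def \<phi>_T distrib_left exp_add)
  qed
  have W: "weight n (Suc n) \<in> borel_measurable (path_filtration T)" for n
    using T_pos by (intro weight_measurable) (auto intro: grid_bounds)
  have Xm: "?X n \<in> borel_measurable P" for n
    using T_pos by (intro borel_measurable_times measurable_from_filtration[OF W] measurable_coord_real) auto
  \<comment> \<open>Measurability in \<open>\<omega>\<close> of the cost along the path is inherited
    from the grid approximations, which read finitely many coordinates.\<close>
  have Ym: "?Y \<in> borel_measurable P"
    by (rule borel_measurable_LIMSEQ_real[OF lim Xm])
  have Xb: "norm (?X n \<omega>) \<le> exp (L * T) * K" for n \<omega>
    unfolding real_norm_def abs_mult using weight_bounds[of "Suc n" n \<omega>] \<phi>_bound[of T] T_pos
    by (intro mult_mono) auto
  have "(\<lambda>n. expectation (?X n)) \<longlonglongrightarrow> expectation ?Y"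
    using lim Xb by (intro integral_dominated_convergence[where w = "\<lambda>_. exp (L * T) * K"] Xm Ym) auto
  then show "(\<lambda>n. mean n (Suc n)) \<longlonglongrightarrow> expectation ?Y"
    by (simp add: mean_def)
  show "integrable P ?Y"
    by (rule integrable_dominated_convergence[where w = "\<lambda>_. exp (L * T) * K" and s = ?X])
      (use lim Xb Xm Ym in auto)
qed

lemma error_tendsto: "(\<lambda>n. K\<^sub>2 * (T - s)\<^sup>2 / real (Suc n)) \<longlonglongrightarrow> 0"
  using tendsto_mult_right_zero[OF LIMSEQ_inverse_real_of_nat, of "K\<^sub>2 * (T - s)\<^sup>2"]
  by (simp add: divide_inverse)

lemma verification_le: "\<phi> s i\<^sub>0 \<le> expectation (\<lambda>\<omega>. exp (\<theta> * (path_cost \<omega> + g (\<omega> T))))"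
proof (rule LIMSEQ_le[OF _ mean_tendsto])
  show "(\<lambda>n. \<phi> s i\<^sub>0 - K\<^sub>2 * (T - s)\<^sup>2 / real (Suc n)) \<longlonglongrightarrow> \<phi> s i\<^sub>0"
    using tendsto_diff[OF tendsto_const error_tendsto, of "\<phi> s i\<^sub>0"] by simp
qed (use mean_last_ge in blast)

lemma verification_eq:
  assumes "\<And>r x. 0 \<le> r \<Longrightarrow> r < T \<Longrightarrow> ham \<phi> r x = hjb_term lam c \<theta> \<phi> r x (v r x)"
  shows "expectation (\<lambda>\<omega>. exp (\<theta> * (path_cost \<omega> + g (\<omega> T)))) = \<phi> s i\<^sub>0"
proof (rule antisym[OF LIMSEQ_le[OF mean_tendsto] verification_le])
  show "(\<lambda>n. \<phi> s i\<^sub>0 + K\<^sub>2 * (T - s)\<^sup>2 / real (Suc n)) \<longlonglongrightarrow> \<phi> s i\<^sub>0"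
    using tendsto_add[OF tendsto_const error_tendsto, of "\<phi> s i\<^sub>0"] by simp
qed (use mean_last_le[OF assms] in blast)

text \<open>Keeps the argument of \<open>ln\<close> positive, so that the logarithm is monotone on
  all costs and the solution itself is positive.\<close>

lemma exp_path_cost_ge_1: "1 \<le> expectation (\<lambda>\<omega>. exp (\<theta> * (path_cost \<omega> + g (\<omega> T))))"
proof (rule integral_ge_const[OF integrable_exp_path_cost])
  have "0 \<le> path_cost \<omega>" if "\<omega> \<in> cadlag_paths" for \<omega>
    unfolding path_cost_eq[OF that] set_lebesgue_integral_def using s c_nonneg action
    by (intro Bochner_Integration.integral_nonneg) (auto simp: indicator_def)
  then show "AE \<omega> in P. 1 \<le> exp (\<theta> * (path_cost \<omega> + g (\<omega> T)))"
    using \<theta>_pos g_nonneg by (intro AE_I2) (simp add: space_P)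
qed

end

theorem theorem2p4:
  fixes U :: "nat \<Rightarrow> 'u metric"
    and lam :: "nat \<Rightarrow> nat \<Rightarrow> 'u \<Rightarrow> real"
    and c :: "real \<Rightarrow> nat \<Rightarrow> 'u \<Rightarrow> real"
    and g :: "nat \<Rightarrow> real"
    and M T \<theta> :: real
    and P :: "(real \<Rightarrow> nat \<Rightarrow> 'u) \<Rightarrow> real \<Rightarrow> nat \<Rightarrow> (real \<Rightarrow> nat) measure"
  assumes U_nonempty: "\<And>i. mspace (U i) \<noteq> {}"
    and U_compact: "\<And>i. compact_space (mtopology_of (U i))"
    and lam_nonneg: "\<And>i j u. i \<noteq> j \<Longrightarrow> u \<in> mspace (U i) \<Longrightarrow> 0 \<le> lam i j u"
    and A1: "\<And>i j. i \<noteq> j \<Longrightarrow> continuous_map (mtopology_of (U i)) euclideanreal (lam i j)"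
    and A2: "\<And>i u. u \<in> mspace (U i) \<Longrightarrow> - rate lam i i u \<le> M"
    and A3: "\<And>i. uniformly_convergent_on (mspace (U i)) (\<lambda>n u. \<Sum>j\<in>{..<n} - {i}. lam i j u)"
    and T_pos: "0 < T"
    and theta: "0 < \<theta>" "\<theta> < 1"
    and c_nonneg: "\<And>t i u. 0 \<le> t \<Longrightarrow> u \<in> mspace (U i) \<Longrightarrow> 0 \<le> c t i u"
    and c_bounded: "\<exists>B. \<forall>t\<ge>0. \<forall>i. \<forall>u\<in>mspace (U i). c t i u \<le> B"
    and c_cont: "\<And>i. continuous_map (prod_topology (top_of_set {0..}) (mtopology_of (U i)))
                   euclideanreal (\<lambda>(t, u). c t i u)"
    and g_nonneg: "\<And>i. 0 \<le> g i"
    and g_bounded: "bounded (range g)"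
    and laws: "\<And>\<u> s i. \<u> \<in> markov_controls U \<Longrightarrow> 0 \<le> s \<Longrightarrow>
                 solves_martingale_problem lam \<u> s i (P \<u> s i)"
  shows "(\<exists>\<phi>. hjb_solution U lam c g T \<theta> \<phi> \<and>
             (\<forall>\<phi>'. hjb_solution U lam c g T \<theta> \<phi>' \<longrightarrow> (\<forall>t\<in>{0..T}. \<forall>i. \<phi>' t i = \<phi> t i)) \<and>
             (\<forall>t\<in>{0..T}. \<forall>i. 0 < \<phi> t i \<and>
                1 / \<theta> * ln (\<phi> t i) = (INF \<u>\<in>markov_controls U. risk_cost P c g T \<theta> \<u> t i))) \<and>
         (\<exists>\<u>\<in>markov_controls U. \<forall>t\<in>{0..<T}. \<forall>i.
             (INF u\<in>mspace (U i). hjb_term lam c \<theta> (exp_value U P c g T \<theta>) t i u)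
               = hjb_term lam c \<theta> (exp_value U P c g T \<theta>) t i (\<u> t i)) \<and>
         (\<forall>\<u>\<in>markov_controls U.
             (\<forall>t\<in>{0..<T}. \<forall>i.
                (INF u\<in>mspace (U i). hjb_term lam c \<theta> (exp_value U P c g T \<theta>) t i u)
                  = hjb_term lam c \<theta> (exp_value U P c g T \<theta>) t i (\<u> t i)) \<longrightarrow>
             (\<forall>t\<in>{0..T}. \<forall>i.
                risk_cost P c g T \<theta> \<u> t i = (INF \<v>\<in>markov_controls U. risk_cost P c g T \<theta> \<v> t i)))"
proof -
  obtain B where B: "\<forall>t\<ge>0. \<forall>i. \<forall>u\<in>mspace (U i). c t i u \<le> B"
    using c_bounded by blast
  interpret control_problem U lam M c g T \<theta> B
    by unfold_locales
      (use U_nonempty U_compact lam_nonneg A1 A2 A3 T_pos theta c_nonneg B c_cont g_nonneg g_bounded in auto)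
  let ?J = "exp_cost P c g T \<theta>" and ?V = "exp_value U P c g T \<theta>" and ?R = "risk_cost P c g T \<theta>"
  \<comment> \<open>Stated for an arbitrary solution, so that any two solutions can be compared
    through the value function.\<close>
  have lower: "\<phi> t i \<le> ?J v t i \<and> 1 \<le> ?J v t i"
    and optimal: "(\<And>r x. 0 \<le> r \<Longrightarrow> r < T \<Longrightarrow> ham \<phi> r x = hjb_term lam c \<theta> \<phi> r x (v r x)) \<Longrightarrow> ?J v t i = \<phi> t i"
    if sol: "hjb_solution U lam c g T \<theta> \<phi>" and v: "v \<in> markov_controls U" and t: "t \<in> {0..T}" for \<phi> v t i
  proof -
    obtain K where K: "\<And>t j. 0 \<le> t \<Longrightarrow> t \<le> T \<Longrightarrow> \<bar>\<phi> t j\<bar> \<le> K"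
      "\<And>j. continuous_on {0..T} (\<lambda>t. \<phi> t j)"
      "\<And>a b i. 0 \<le> a \<Longrightarrow> a \<le> b \<Longrightarrow> b \<le> T \<Longrightarrow> \<phi> a i - \<phi> b i = (LINT r:{a..b}|lborel. ham \<phi> r i)"
      "\<And>i. \<phi> T i = exp (\<theta> * g i)"
      using hjb_solutionE[OF sol] by blast
    interpret verification U lam M c g T \<theta> B v t i "P v t i" \<phi> K
      by unfold_locales (use v t laws K in auto)
    have J: "?J v t i = expectation (\<lambda>\<omega>. exp (\<theta> * (path_cost \<omega> + g (\<omega> T))))"
      by (simp add: exp_cost_def path_cost_def)
    show "\<phi> t i \<le> ?J v t i \<and> 1 \<le> ?J v t i"
      unfolding J using verification_le exp_path_cost_ge_1 by simp
    show "?J v t i = \<phi> t i"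
      if "\<And>r x. 0 \<le> r \<Longrightarrow> r < T \<Longrightarrow> ham \<phi> r x = hjb_term lam c \<theta> \<phi> r x (v r x)"
      unfolding J using that by (rule verification_eq)
  qed
  have selector: "\<exists>v\<in>markov_controls U. \<forall>r\<in>{0..T}. \<forall>x. ham \<phi> r x = hjb_term lam c \<theta> \<phi> r x (v r x)"
    if sol: "hjb_solution U lam c g T \<theta> \<phi>" for \<phi>
  proof -
    obtain K where K: "\<And>t j. 0 \<le> t \<Longrightarrow> t \<le> T \<Longrightarrow> \<bar>\<phi> t j\<bar> \<le> K"
      and cont: "\<And>j. continuous_on {0..T} (\<lambda>t. \<phi> t j)"
      using hjb_solutionE[OF sol] by metis
    have "\<exists>w. w \<in> measurable (restrict_space borel {0..T}) (action_borel (U x)) \<and>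
        (\<forall>r\<in>{0..T}. \<forall>u\<in>mspace (U x). hjb_term lam c \<theta> \<phi> r x (w r) \<le> hjb_term lam c \<theta> \<phi> r x u)" for x
    proof -
      have "continuous_map (prod_topology (top_of_set {0..T}) (mtopology_of (U x))) euclideanreal
          (\<lambda>(r, u). hjb_term lam c \<theta> \<phi> r x u)"
        using K cont by (intro continuous_map_hjb[of _ _ K]) auto
      from measurable_argmin_selection[OF U_compact U_nonempty this] show ?thesis
        by metis
    qed
    then obtain w where w: "\<And>x. w x \<in> measurable (restrict_space borel {0..T}) (action_borel (U x))"
      "\<And>x r u. r \<in> {0..T} \<Longrightarrow> u \<in> mspace (U x) \<Longrightarrow>
         hjb_term lam c \<theta> \<phi> r x (w x r) \<le> hjb_term lam c \<theta> \<phi> r x u"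
      by metis
    have w_in: "w x r \<in> mspace (U x)" if "r \<in> {0..T}" for x r
      using measurable_space[OF w(1), of r x] that by (simp add: space_restrict_space space_action_borel)
    \<comment> \<open>A control must be defined on the whole half-line; stopping the clock at
      \<open>T\<close> extends the selected minimiser measurably.\<close>
    have min_meas: "(\<lambda>r. min r T) \<in> measurable (restrict_space borel {0..}) (restrict_space borel {0..T})"
      using T_pos by (intro measurable_restrict_space2 measurable_restrict_space1)
        (auto simp: space_restrict_space)
    have "(\<lambda>r x. w x (min r T)) \<in> markov_controls U"
      using measurable_compose[OF min_meas w(1)] by (simp add: markov_controls_def)
    moreover have "ham \<phi> r x = hjb_term lam c \<theta> \<phi> r x (w x (min r T))" if "r \<in> {0..T}" for r x
      unfolding ham_def using that w(2)[OF that] w_in[OF that]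
      by (intro cInf_eq_minimum) auto
    ultimately show ?thesis
      by (intro bexI[of _ "\<lambda>r x. w x (min r T)"]) auto
  qed
  obtain \<phi> where sol: "hjb_solution U lam c g T \<theta> \<phi>"
    using hjb_solution_exists by blast
  obtain v where v: "v \<in> markov_controls U"
    and v_opt: "\<And>r x. r \<in> {0..T} \<Longrightarrow> ham \<phi> r x = hjb_term lam c \<theta> \<phi> r x (v r x)"
    using selector[OF sol] by blast
  \<comment> \<open>\<open>\<psi>\<close> bounds every cost from below, and its own minimising
    selector attains the bound. Every solution therefore equals the value function on
    \<open>[0,T]\<close>, which gives uniqueness.\<close>
  have value_eq: "?V t i = \<psi> t i" if \<psi>: "hjb_solution U lam c g T \<theta> \<psi>" and t: "t \<in> {0..T}" for \<psi> t i
  proof -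
    obtain w where w: "w \<in> markov_controls U"
      and w_opt: "\<And>r x. r \<in> {0..T} \<Longrightarrow> ham \<psi> r x = hjb_term lam c \<theta> \<psi> r x (w r x)"
      using selector[OF \<psi>] by blast
    have "?J w t i = \<psi> t i"
      using w_opt by (intro optimal[OF \<psi> w t]) auto
    then show ?thesis
      unfolding exp_value_def using lower[OF \<psi> _ t] w by (intro cInf_eq_minimum image_eqI[of _ _ w]) auto
  qed
  have risk_INF: "(INF \<u>\<in>markov_controls U. ?R \<u> t i) = ?R w t i"
    if w: "w \<in> markov_controls U" and t: "t \<in> {0..T}" and eq: "?J w t i = \<phi> t i" for w t i
  proof (rule cInf_eq_minimum)
    show "?R w t i \<in> (\<lambda>\<u>. ?R \<u> t i) ` markov_controls U"
      using w by blast
    fix z assume "z \<in> (\<lambda>\<u>. ?R \<u> t i) ` markov_controls U"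
    then obtain \<u> where \<u>: "\<u> \<in> markov_controls U" "z = ?R \<u> t i"
      by blast
    \<comment> \<open>All costs are at least 1, so the comparison survives the logarithm.\<close>
    have "ln (?J w t i) \<le> ln (?J \<u> t i)"
      using lower[OF sol w t, of i] lower[OF sol \<u>(1) t, of i] eq by simp
    then show "?R w t i \<le> z"
      unfolding \<u>(2) risk_cost_def using theta by (intro mult_left_mono) auto
  qed
  \<comment> \<open>\<open>hjb_term\<close> at time \<open>t\<close> reads its function only at that
    time, where the value function and \<open>\<phi>\<close> agree. Minimality stated with the value
    function thus becomes minimality for \<open>\<phi>\<close>.\<close>
  have hjb_value: "hjb_term lam c \<theta> ?V t i u = hjb_term lam c \<theta> \<phi> t i u" if "t \<in> {0..<T}" for t i u
    using value_eq[OF sol, of t] that by (simp add: hjb_term_def)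
  have opt: "?J w t i = \<phi> t i"
    if "w \<in> markov_controls U" "t \<in> {0..T}"
      and "\<forall>t\<in>{0..<T}. \<forall>i. (INF u\<in>mspace (U i). hjb_term lam c \<theta> ?V t i u) = hjb_term lam c \<theta> ?V t i (w t i)"
    for w t i
    using that(3) by (intro optimal[OF sol that(1,2)]) (auto simp: ham_def hjb_value)
  have v_J: "?J v t i = \<phi> t i" if "t \<in> {0..T}" for t i
    using v_opt by (intro optimal[OF sol v that]) auto
  show ?thesis
  proof (intro conjI)
    show "\<exists>\<phi>. hjb_solution U lam c g T \<theta> \<phi> \<and>
             (\<forall>\<phi>'. hjb_solution U lam c g T \<theta> \<phi>' \<longrightarrow> (\<forall>t\<in>{0..T}. \<forall>i. \<phi>' t i = \<phi> t i)) \<and>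
             (\<forall>t\<in>{0..T}. \<forall>i. 0 < \<phi> t i \<and>
                1 / \<theta> * ln (\<phi> t i) = (INF \<u>\<in>markov_controls U. ?R \<u> t i))"
    proof (intro exI[of _ \<phi>] conjI allI impI ballI sol)
      fix \<psi> t i assume "hjb_solution U lam c g T \<theta> \<psi>" "t \<in> {0..T}"
      then show "\<psi> t i = \<phi> t i"
        using value_eq sol by metis
    next
      fix t i assume t: "t \<in> {0..T}"
      show "0 < \<phi> t i"
        using lower[OF sol v t, of i] v_J[OF t, of i] by simp
      show "1 / \<theta> * ln (\<phi> t i) = (INF \<u>\<in>markov_controls U. ?R \<u> t i)"
        using risk_INF[OF v t v_J[OF t], of i] v_J[OF t, of i] by (simp add: risk_cost_def)
    qed
    show "\<exists>\<u>\<in>markov_controls U. \<forall>t\<in>{0..<T}. \<forall>i.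
        (INF u\<in>mspace (U i). hjb_term lam c \<theta> ?V t i u) = hjb_term lam c \<theta> ?V t i (\<u> t i)"
      using v v_opt by (intro bexI[of _ v]) (auto simp: ham_def hjb_value)
    show "\<forall>\<u>\<in>markov_controls U.
        (\<forall>t\<in>{0..<T}. \<forall>i.
          (INF u\<in>mspace (U i). hjb_term lam c \<theta> ?V t i u) = hjb_term lam c \<theta> ?V t i (\<u> t i)) \<longrightarrow>
        (\<forall>t\<in>{0..T}. \<forall>i. ?R \<u> t i = (INF \<v>\<in>markov_controls U. ?R \<v> t i))"
      using risk_INF opt by metis
  qed
qed

end
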